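(* Let $(N,[(\lambda,\mu)])$ be a nondegenerate 3-dimensional CR-structure, with associated Cartan invariant forms and functions on the 8-dimensional manifold $P$ as in the context. The Fefferman metrics $g_F$ of $(N,[(\lambda,\mu)])$ satisfy the Bach equations if and only if $$\mathcal S_1=0,$$ or, what is the same, $$d\mathcal S\wedge\theta^2\wedge\theta^3\wedge(2\Omega_2+3\bar\Omega_2)\wedge\bar\Omega_3=0.$$
   Context: All considerations are local and concern nonsingular points; here $i^2=-1$ and the bar is complex conjugation. A CR-structure $[(\lambda,\mu)]$ on a 3-manifold $N$ is a class of pairs of 1-forms, $\lambda$ real and $\mu$ complex, with $\lambda\wedge\mu\wedge\bar\mu\neq0$, given up to $\lambda\to a\lambda$, $\mu\to b\mu+c\lambda$ with functions $a\neq0$ real and $b\neq0$, $c$ complex. It is nondegenerate iff $d\lambda\wedge\lambda\neq0$. By a theorem of Cartan, a nondegenerate CR-structure uniquely defines an 8-dimensional manifold $P$ (a bundle over $N$), 1-forms $\theta^1,\theta^2=\overline{\theta^1},\theta^3,\Omega_2,\bar\Omega_2,\Omega_3,\bar\Omega_3,\Omega_4$ ($\theta^3,\Omega_4$ real) that are linearly independent at each point of $P$, and complex functions $\mathcal R,\mathcal S$ on $P$, such that $\theta^1=b\mu+c\lambda$, $\theta^2=\bar b\bar\mu+\bar c\lambda$, $\theta^3=a\lambda$ for some functions $a\ne0$ (real), $b\neq0$, $c$ (complex) on $P$, and $$d\theta^1=\Omega_2\wedge\theta^1+\Omega_3\wedge\theta^3,\qquad d\theta^3=i\theta^1\wedge\theta^2+(\Omega_2+\bar\Omega_2)\wedge\theta^3,$$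 $$d\Omega_2=2i\theta^1\wedge\bar\Omega_3+i\theta^2\wedge\Omega_3+\Omega_4\wedge\theta^3,$$ $$d\Omega_3=\Omega_4\wedge\theta^1+\Omega_3\wedge\bar\Omega_2+\mathcal R\,\theta^2\wedge\theta^3,$$ $$d\Omega_4=i\Omega_3\wedge\bar\Omega_3+\Omega_4\wedge(\Omega_2+\bar\Omega_2)+\bar{\mathcal S}\,\theta^1\wedge\theta^3+\mathcal S\,\theta^2\wedge\theta^3,$$ together with the complex conjugate equations. Moreover $$d\mathcal R=-\mathcal R(\Omega_2+3\bar\Omega_2)-\mathcal S\theta^1+\mathcal R_2\theta^2+\mathcal R_3\theta^3,$$ $$d\mathcal S=-\mathcal S(2\Omega_2+3\bar\Omega_2)-i\mathcal R\bar\Omega_3+\mathcal S_1\theta^1+\mathcal S_2\theta^2+\mathcal S_3\theta^3,$$ for appropriate functions $\mathcal R_2,\mathcal R_3,\mathcal S_1,\mathcal S_2,\mathcal S_3$, and $\mathcal S_1$ is real; this defines $\mathcal S_1$. Fefferman metrics: let $X_1,X_2,X_3,Y_2,\bar Y_2,Y_3,\bar Y_3,Y_4$ be the frame dual to $\theta^1,\theta^2,\theta^3,\Omega_2,\bar\Omega_2,\Omega_3,\bar\Omega_3,\Omega_4$. The bilinear form $G=2\theta^1\theta^2+\frac{2}{3i}\theta^3(\Omega_2-\bar\Omega_2)$ on $P$ is degenerate exactly along the integrable distribution spanned by $Y_2+\bar Y_2,Y_3,\bar Y_3,Y_4$, and is preserved up to scale along these vector fields. Hence $G$ descends to a conformal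 class $[g_F]$ of Lorentzian metrics on the 4-dimensional leaf space $P/\!\sim$; these are the Fefferman metrics of the CR-structure. A metric satisfies the Bach equations if its Bach tensor vanishes (a conformally invariant condition in dimension 4). *)

theory Defs
  imports "HOL-Analysis.Analysis"
begin

section \<open>Smooth maps and complex differential forms on open subsets of Euclidean spaces\<close>

text \<open>Only open sets \<open>U\<close> are ever used, so all derivatives are two-sided.\<close>

primrec Ck_on :: "nat \<Rightarrow> 'a::euclidean_space set \<Rightarrow> ('a \<Rightarrow> 'b::real_normed_vector) \<Rightarrow> bool" where
  "Ck_on 0 U f \<longleftrightarrow> continuous_on U f"
| "Ck_on (Suc k) U f \<longleftrightarrow>
     (\<forall>x\<in>U. f differentiable (at x)) \<and> (\<forall>v. Ck_on k U (\<lambda>x. frechet_derivative f (at x) v))"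

definition smooth_map_on :: "'a::euclidean_space set \<Rightarrow> ('a \<Rightarrow> 'b::real_normed_vector) \<Rightarrow> bool" where
  "smooth_map_on U f \<longleftrightarrow> (\<forall>k. Ck_on k U f)"

definition submersion_onto ::
  "'a::euclidean_space set \<Rightarrow> 'b::euclidean_space set \<Rightarrow> ('a \<Rightarrow> 'b) \<Rightarrow> bool" where
  "submersion_onto U V p \<longleftrightarrow>
     smooth_map_on U p \<and> p ` U = V \<and> (\<forall>x\<in>U. surj (frechet_derivative p (at x)))"

text \<open>The value of a \<open>k\<close>-form at a point is a function of a list of \<open>k\<close> tangent vectors;
  its values on lists of any other length carry no meaning.\<close>

type_synonym 'a cform = "'a \<Rightarrow> 'a list \<Rightarrow> complex"

definition smooth_one_form :: "'a::euclidean_space set \<Rightarrow> 'a cform \<Rightarrow> bool" where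
  "smooth_one_form U \<omega> \<longleftrightarrow>
     (\<forall>x\<in>U. linear (\<lambda>v. \<omega> x [v])) \<and> (\<forall>v. smooth_map_on U (\<lambda>x. \<omega> x [v]))"

definition real_one_form :: "'a set \<Rightarrow> 'a cform \<Rightarrow> bool" where
  "real_one_form U \<omega> \<longleftrightarrow> (\<forall>x\<in>U. \<forall>v. \<omega> x [v] \<in> \<real>)"

definition fun_form :: "('a \<Rightarrow> complex) \<Rightarrow> 'a cform" where
  "fun_form f = (\<lambda>x vs. f x)"

definition cnj_form :: "'a cform \<Rightarrow> 'a cform" where
  "cnj_form \<omega> = (\<lambda>x vs. cnj (\<omega> x vs))"

definition form_add :: "'a cform \<Rightarrow> 'a cform \<Rightarrow> 'a cform"  (infixl "+\<^sub>f" 65) where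
  "\<omega> +\<^sub>f \<eta> = (\<lambda>x vs. \<omega> x vs + \<eta> x vs)"

definition form_scale :: "complex \<Rightarrow> 'a cform \<Rightarrow> 'a cform"  (infixr "*\<^sub>f" 75) where
  "c *\<^sub>f \<omega> = (\<lambda>x vs. c * \<omega> x vs)"

definition drop_nth :: "nat \<Rightarrow> 'a list \<Rightarrow> 'a list" where
  "drop_nth i vs = take i vs @ drop (Suc i) vs"

text \<open>Exterior product of a form (of any degree) with a one-form on its right, normalised so that
  \<open>(\<alpha> \<and> \<beta>)(u,v) = \<alpha>(u) \<beta>(v) - \<alpha>(v) \<beta>(u)\<close> for one-forms.\<close>

definition form_wedge :: "'a cform \<Rightarrow> 'a cform \<Rightarrow> 'a cform"  (infixl "\<and>\<^sub>f" 70) where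
  "\<omega> \<and>\<^sub>f \<alpha> = (\<lambda>x vs. \<Sum>i<length vs.
      (-1) ^ (length vs - 1 - i) * \<omega> x (drop_nth i vs) * \<alpha> x [vs ! i])"

text \<open>On constant vector fields the bracket terms of the invariant formula for \<open>d\<close> vanish;
  on one-forms \<open>d\<omega>(u,v) = u(\<omega>(v)) - v(\<omega>(u))\<close>.\<close>

definition ext_d :: "'a::euclidean_space cform \<Rightarrow> 'a cform" where
  "ext_d \<omega> = (\<lambda>x vs. \<Sum>i<length vs.
      (-1) ^ i * frechet_derivative (\<lambda>y. \<omega> y (drop_nth i vs)) (at x) (vs ! i))"

definition pullback ::
  "('a::euclidean_space \<Rightarrow> 'b::euclidean_space) \<Rightarrow> 'b cform \<Rightarrow> 'a cform" where
  "pullback p \<omega> = (\<lambda>x vs. \<omega> (p x) (map (frechet_derivative p (at x)) vs))"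

definition sym_prod :: "'a cform \<Rightarrow> 'a cform \<Rightarrow> 'a \<Rightarrow> 'a \<Rightarrow> 'a \<Rightarrow> complex" where
  "sym_prod \<alpha> \<beta> x u v = (\<alpha> x [u] * \<beta> x [v] + \<alpha> x [v] * \<beta> x [u]) / 2"

definition lin_indep_at :: "'a \<Rightarrow> 'a cform list \<Rightarrow> bool" where
  "lin_indep_at x \<omega>s \<longleftrightarrow>
     (\<forall>c::nat \<Rightarrow> complex. (\<forall>v. (\<Sum>i<length \<omega>s. c i * (\<omega>s ! i) x [v]) = 0)
        \<longrightarrow> (\<forall>i<length \<omega>s. c i = 0))"


section \<open>CR-structures and their Cartan invariants\<close>

text \<open>The CR-structure is given by a representative \<open>(\<lambda>,\<mu>)\<close> of its class; the condition
  \<open>adapted\<close> below is unaffected by a change of representative.\<close>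

locale nondegenerate_cr_structure =
  fixes N :: "(real^3) set" and lam mu :: "(real^3) cform"
  assumes open_N: "open N"
    and lam: "smooth_one_form N lam" "real_one_form N lam"
    and mu: "smooth_one_form N mu"
    and cr: "\<forall>x\<in>N. \<exists>u v w. (lam \<and>\<^sub>f mu \<and>\<^sub>f cnj_form mu) x [u, v, w] \<noteq> 0"
    and nondegenerate: "\<forall>x\<in>N. \<exists>u v w. (ext_d lam \<and>\<^sub>f lam) x [u, v, w] \<noteq> 0"

abbreviation cartan_coframe ::
  "'a cform \<Rightarrow> 'a cform \<Rightarrow> 'a cform \<Rightarrow> 'a cform \<Rightarrow> 'a cform \<Rightarrow> 'a cform list" where
  "cartan_coframe th1 th3 Om2 Om3 Om4 \<equiv>
     [th1, cnj_form th1, th3, Om2, cnj_form Om2, Om3, cnj_form Om3, Om4]"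

text \<open>Here \<open>\<theta>\<^sup>2\<close> is written \<open>cnj_form th1\<close>. The conjugate structure equations are equivalent to the
  listed ones and are not repeated.\<close>

locale cartan_invariants = nondegenerate_cr_structure N lam mu
  for N :: "(real^3) set" and lam mu :: "(real^3) cform" +
  fixes P :: "(real^8) set" and pr :: "real^8 \<Rightarrow> real^3"
    and th1 th3 Om2 Om3 Om4 :: "(real^8) cform"
    and R S R2 R3 S1 S2 S3 :: "real^8 \<Rightarrow> complex"
  assumes open_P: "open P"
    and projection: "submersion_onto P N pr"
    and smooth_forms: "smooth_one_form P th1" "smooth_one_form P th3" "smooth_one_form P Om2"
      "smooth_one_form P Om3" "smooth_one_form P Om4"
    and real_forms: "real_one_form P th3" "real_one_form P Om4"
    and smooth_functions: "smooth_map_on P R" "smooth_map_on P S" "smooth_map_on P R2"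
      "smooth_map_on P R3" "smooth_map_on P S1" "smooth_map_on P S2" "smooth_map_on P S3"
    and coframe: "\<forall>x\<in>P. lin_indep_at x (cartan_coframe th1 th3 Om2 Om3 Om4)"
    and adapted: "\<exists>(a :: real^8 \<Rightarrow> real) (b :: real^8 \<Rightarrow> complex) (c :: real^8 \<Rightarrow> complex).
      smooth_map_on P a \<and> smooth_map_on P b \<and> smooth_map_on P c \<and>
      (\<forall>x\<in>P. a x \<noteq> 0 \<and> b x \<noteq> 0 \<and>
        (\<forall>v. th1 x [v] = b x * pullback pr mu x [v] + c x * pullback pr lam x [v] \<and>
             th3 x [v] = a x * pullback pr lam x [v]))"
    and d_th1: "\<forall>x\<in>P. \<forall>u v. ext_d th1 x [u, v] =
      (Om2 \<and>\<^sub>f th1 +\<^sub>f Om3 \<and>\<^sub>f th3) x [u, v]"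
    and d_th3: "\<forall>x\<in>P. \<forall>u v. ext_d th3 x [u, v] =
      (\<i> *\<^sub>f th1 \<and>\<^sub>f cnj_form th1 +\<^sub>f (Om2 +\<^sub>f cnj_form Om2) \<and>\<^sub>f th3) x [u, v]"
    and d_Om2: "\<forall>x\<in>P. \<forall>u v. ext_d Om2 x [u, v] =
      ((2 * \<i>) *\<^sub>f th1 \<and>\<^sub>f cnj_form Om3 +\<^sub>f \<i> *\<^sub>f cnj_form th1 \<and>\<^sub>f Om3
        +\<^sub>f Om4 \<and>\<^sub>f th3) x [u, v]"
    and d_Om3: "\<forall>x\<in>P. \<forall>u v. ext_d Om3 x [u, v] =
      (Om4 \<and>\<^sub>f th1 +\<^sub>f Om3 \<and>\<^sub>f cnj_form Om2 +\<^sub>f R x *\<^sub>f cnj_form th1 \<and>\<^sub>f th3) x [u, v]"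
    and d_Om4: "\<forall>x\<in>P. \<forall>u v. ext_d Om4 x [u, v] =
      (\<i> *\<^sub>f Om3 \<and>\<^sub>f cnj_form Om3 +\<^sub>f Om4 \<and>\<^sub>f (Om2 +\<^sub>f cnj_form Om2)
        +\<^sub>f cnj (S x) *\<^sub>f th1 \<and>\<^sub>f th3 +\<^sub>f S x *\<^sub>f cnj_form th1 \<and>\<^sub>f th3) x [u, v]"
    and d_R: "\<forall>x\<in>P. \<forall>v. ext_d (fun_form R) x [v] =
      ((- R x) *\<^sub>f (Om2 +\<^sub>f 3 *\<^sub>f cnj_form Om2) +\<^sub>f (- S x) *\<^sub>f th1
        +\<^sub>f R2 x *\<^sub>f cnj_form th1 +\<^sub>f R3 x *\<^sub>f th3) x [v]"
    and d_S: "\<forall>x\<in>P. \<forall>v. ext_d (fun_form S) x [v] =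
      ((- S x) *\<^sub>f (2 *\<^sub>f Om2 +\<^sub>f 3 *\<^sub>f cnj_form Om2) +\<^sub>f (- \<i> * R x) *\<^sub>f cnj_form Om3
        +\<^sub>f S1 x *\<^sub>f th1 +\<^sub>f S2 x *\<^sub>f cnj_form th1 +\<^sub>f S3 x *\<^sub>f th3) x [v]"
    and real_S1: "\<forall>x\<in>P. S1 x \<in> \<real>"


section \<open>Fefferman metrics\<close>

text \<open>Complex tangent vectors are elements of \<open>complex^'n\<close>; one-forms are evaluated on them by
  complex-linear extension.\<close>

definition cvec :: "real^'n \<Rightarrow> complex^'n" where
  "cvec v = (\<chi> i. complex_of_real (v $ i))"

definition ceval :: "(real^'n) cform \<Rightarrow> real^'n \<Rightarrow> complex^'n \<Rightarrow> complex" where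
  "ceval \<omega> x z = \<omega> x [\<chi> i. Re (z $ i)] + \<i> * \<omega> x [\<chi> i. Im (z $ i)]"

definition dual_frame_at :: "real^'n \<Rightarrow> (real^'n) cform list \<Rightarrow> (complex^'n) list \<Rightarrow> bool" where
  "dual_frame_at x \<omega>s Es \<longleftrightarrow> length Es = length \<omega>s \<and>
     (\<forall>i<length \<omega>s. \<forall>j<length \<omega>s. ceval (\<omega>s ! i) x (Es ! j) = (if i = j then 1 else 0))"

text \<open>The real vectors in the complex span of the four complex fields; a suffix \<open>b\<close> stands for the bar.\<close>

definition fefferman_distribution ::
  "(real^8) cform \<Rightarrow> (real^8) cform \<Rightarrow> (real^8) cform \<Rightarrow> (real^8) cform \<Rightarrow> (real^8) cform
    \<Rightarrow> real^8 \<Rightarrow> (real^8) set" where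
  "fefferman_distribution th1 th3 Om2 Om3 Om4 x =
     {v. \<exists>X1 X2 X3 Y2 Y2b Y3 Y3b Y4.
        dual_frame_at x (cartan_coframe th1 th3 Om2 Om3 Om4) [X1, X2, X3, Y2, Y2b, Y3, Y3b, Y4] \<and>
        cvec v \<in> vec.span {Y2 + Y2b, Y3, Y3b, Y4}}"

definition fefferman_form ::
  "(real^8) cform \<Rightarrow> (real^8) cform \<Rightarrow> (real^8) cform \<Rightarrow> real^8 \<Rightarrow> real^8 \<Rightarrow> real^8 \<Rightarrow> complex" where
  "fefferman_form th1 th3 Om2 x u v =
     2 * sym_prod th1 (cnj_form th1) x u v
       + 2 / (3 * \<i>) * sym_prod th3 (Om2 +\<^sub>f (-1) *\<^sub>f cnj_form Om2) x u v"

text \<open>A metric on an open subset of \<open>real^4\<close> is given by its matrix of coordinate components.\<close>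

definition lorentzian_metric :: "(real^4) set \<Rightarrow> (real^4 \<Rightarrow> real^4^4) \<Rightarrow> bool" where
  "lorentzian_metric M g \<longleftrightarrow> smooth_map_on M g \<and>
     (\<forall>y\<in>M. transpose (g y) = g y \<and>
        (\<exists>A :: real^4^4. invertible A \<and> transpose A ** g y ** A =
             (\<chi> i j. if i = j then (if i = 1 then -1 else 1) else 0)))"

text \<open>The map \<open>q\<close> presents \<open>M\<close> as the leaf space \<open>P / \<sim>\<close>: its fibres are connected and tangent to the
  distribution, i.e. they are the leaves. The metric \<open>g\<close> belongs to the class to which \<open>G\<close>
  descends if \<open>q\<^sup>* g\<close> is a positive multiple of \<open>G\<close>; the factor need not be constant along
  the leaves because \<open>G\<close> is preserved along them only up to scale.\<close>

locale fefferman_metric =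
  cartan_invariants N lam mu P pr th1 th3 Om2 Om3 Om4 R S R2 R3 S1 S2 S3
  for N :: "(real^3) set" and lam mu :: "(real^3) cform"
    and P :: "(real^8) set" and pr :: "real^8 \<Rightarrow> real^3"
    and th1 th3 Om2 Om3 Om4 :: "(real^8) cform"
    and R S R2 R3 S1 S2 S3 :: "real^8 \<Rightarrow> complex" +
  fixes M :: "(real^4) set" and q :: "real^8 \<Rightarrow> real^4" and g :: "real^4 \<Rightarrow> real^4^4"
  assumes open_M: "open M"
    and leaf_projection: "submersion_onto P M q"
    and leaf_tangent: "\<forall>x\<in>P. {v. frechet_derivative q (at x) v = 0}
      = fefferman_distribution th1 th3 Om2 Om3 Om4 x"
    and leaf_connected: "\<forall>y\<in>M. connected {x\<in>P. q x = y}"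
    and lorentzian: "lorentzian_metric M g"
    and descends: "\<forall>x\<in>P. \<exists>f>0. \<forall>u v.
      complex_of_real (frechet_derivative q (at x) u \<bullet> (g (q x) *v frechet_derivative q (at x) v))
        = complex_of_real f * fefferman_form th1 th3 Om2 x u v"


section \<open>The Bach tensor in dimension four\<close>

definition pd :: "4 \<Rightarrow> (real^4 \<Rightarrow> real) \<Rightarrow> real^4 \<Rightarrow> real" where
  "pd k f x = frechet_derivative f (at x) (axis k 1)"

definition ginv :: "(real^4 \<Rightarrow> real^4^4) \<Rightarrow> real^4 \<Rightarrow> 4 \<Rightarrow> 4 \<Rightarrow> real" where
  "ginv g x i j = matrix_inv (g x) $ i $ j"

text \<open>\<open>christoffel g x i j k\<close> is \<open>\<Gamma>\<^sup>i\<^sub>j\<^sub>k\<close>.\<close>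

definition christoffel :: "(real^4 \<Rightarrow> real^4^4) \<Rightarrow> real^4 \<Rightarrow> 4 \<Rightarrow> 4 \<Rightarrow> 4 \<Rightarrow> real" where
  "christoffel g x i j k = (\<Sum>l\<in>UNIV. ginv g x i l *
     (pd j (\<lambda>y. g y $ l $ k) x + pd k (\<lambda>y. g y $ l $ j) x - pd l (\<lambda>y. g y $ j $ k) x)) / 2"

text \<open>\<open>riemann_up g x i j k l\<close> is \<open>R\<^sup>i\<^sub>j\<^sub>k\<^sub>l\<close>, the \<open>i\<close>-th component of
  \<open>(\<nabla>\<^sub>k \<nabla>\<^sub>l - \<nabla>\<^sub>l \<nabla>\<^sub>k) \<partial>\<^sub>j\<close>; the Ricci tensor \<open>R\<^sup>k\<^sub>j\<^sub>k\<^sub>l\<close> is positive on round spheres.\<close>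

definition riemann_up :: "(real^4 \<Rightarrow> real^4^4) \<Rightarrow> real^4 \<Rightarrow> 4 \<Rightarrow> 4 \<Rightarrow> 4 \<Rightarrow> 4 \<Rightarrow> real" where
  "riemann_up g x i j k l =
     pd k (\<lambda>y. christoffel g y i l j) x - pd l (\<lambda>y. christoffel g y i k j) x
     + (\<Sum>m\<in>UNIV. christoffel g x i k m * christoffel g x m l j
                   - christoffel g x i l m * christoffel g x m k j)"

definition riemann :: "(real^4 \<Rightarrow> real^4^4) \<Rightarrow> real^4 \<Rightarrow> 4 \<Rightarrow> 4 \<Rightarrow> 4 \<Rightarrow> 4 \<Rightarrow> real" where
  "riemann g x i j k l = (\<Sum>m\<in>UNIV. g x $ i $ m * riemann_up g x m j k l)"

definition ricci :: "(real^4 \<Rightarrow> real^4^4) \<Rightarrow> real^4 \<Rightarrow> 4 \<Rightarrow> 4 \<Rightarrow> real" where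
  "ricci g x j l = (\<Sum>k\<in>UNIV. riemann_up g x k j k l)"

definition scalar_curv :: "(real^4 \<Rightarrow> real^4^4) \<Rightarrow> real^4 \<Rightarrow> real" where
  "scalar_curv g x = (\<Sum>j\<in>UNIV. \<Sum>l\<in>UNIV. ginv g x j l * ricci g x j l)"

definition weyl :: "(real^4 \<Rightarrow> real^4^4) \<Rightarrow> real^4 \<Rightarrow> 4 \<Rightarrow> 4 \<Rightarrow> 4 \<Rightarrow> 4 \<Rightarrow> real" where
  "weyl g x i j k l = riemann g x i j k l
     - (g x $ i $ k * ricci g x j l - g x $ i $ l * ricci g x j k
        + g x $ j $ l * ricci g x i k - g x $ j $ k * ricci g x i l) / 2
     + scalar_curv g x / 6 * (g x $ i $ k * g x $ j $ l - g x $ i $ l * g x $ j $ k)"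

text \<open>Covariant derivative of a covariant tensor with components indexed by lists; the
  index of differentiation comes first.\<close>

definition cov_deriv ::
  "(real^4 \<Rightarrow> real^4^4) \<Rightarrow> (real^4 \<Rightarrow> 4 list \<Rightarrow> real) \<Rightarrow> real^4 \<Rightarrow> 4 list \<Rightarrow> real" where
  "cov_deriv g T x is = pd (hd is) (\<lambda>y. T y (tl is)) x
     - (\<Sum>p<length (tl is). \<Sum>a\<in>UNIV.
          christoffel g x a (hd is) (tl is ! p) * T x ((tl is)[p := a]))"

definition weyl_tensor :: "(real^4 \<Rightarrow> real^4^4) \<Rightarrow> real^4 \<Rightarrow> 4 list \<Rightarrow> real" where
  "weyl_tensor g x is = weyl g x (is ! 0) (is ! 1) (is ! 2) (is ! 3)"

text \<open>\<open>B\<^sub>i\<^sub>j = \<nabla>\<^sup>k \<nabla>\<^sup>l W\<^sub>i\<^sub>k\<^sub>j\<^sub>l + (1/2) R\<^sup>k\<^sup>l W\<^sub>i\<^sub>k\<^sub>j\<^sub>l\<close>.\<close>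

definition bach :: "(real^4 \<Rightarrow> real^4^4) \<Rightarrow> real^4 \<Rightarrow> 4 \<Rightarrow> 4 \<Rightarrow> real" where
  "bach g x i j = (\<Sum>k\<in>UNIV. \<Sum>l\<in>UNIV. \<Sum>a\<in>UNIV. \<Sum>b\<in>UNIV. ginv g x k a * ginv g x l b *
     (cov_deriv g (cov_deriv g (weyl_tensor g)) x [a, b, i, k, j, l]
      + ricci g x a b * weyl g x i k j l / 2))"

definition satisfies_bach_equations :: "(real^4) set \<Rightarrow> (real^4 \<Rightarrow> real^4^4) \<Rightarrow> bool" where
  "satisfies_bach_equations M g \<longleftrightarrow> (\<forall>y\<in>M. \<forall>i j. bach g y i j = 0)"

end

theory Submission
  imports Defs
begin

text \<open>The computation takes place on \<open>P\<close>, without choosing a section of \<open>q\<close>. The forms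
  \<open>\<theta>\<^sup>1, \<theta>\<^sup>2, \<theta>\<^sup>3, \<theta>\<^sup>4 = (\<Omega>\<^sub>2 - \<Omega>\<^sub>2\<^sup>b) / 3\<i>\<close> (a bar is written \<open>b\<close>) vanish on the leaves, and
  \<open>q\<^sup>* g = F (2 \<theta>\<^sup>1 \<theta>\<^sup>2 + 2 \<theta>\<^sup>3 \<theta>\<^sup>4)\<close> for a positive function \<open>F\<close>. Tensors on \<open>M\<close> are pulled back to \<open>P\<close> and
  evaluated on the images of the dual vector fields \<open>X\<^sub>1, \<dots>, X\<^sub>4\<close>. In these components the Levi-Civita connection
  is determined, as usual, by vanishing torsion and compatibility with the metric, hence by the structure equations
  and by \<open>d log F\<close>. The Weyl tensor turns out to be of type N,
  \<open>W = - F (R (\<theta>\<^sup>3 \<and> \<theta>\<^sup>2)\<^sup>2 + R\<^sup>b (\<theta>\<^sup>3 \<and> \<theta>\<^sup>1)\<^sup>2)\<close>. Its divergence involves only the derivatives of \<open>R\<close> along \<open>X\<^sub>1\<close> and \<open>X\<^sub>4\<close>,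
  that is \<open>S\<close> and \<open>R\<close> (and conjugates), and its double divergence only those of \<open>S\<close>. All terms containing \<open>d log F\<close>
  cancel against the Ricci term, and what remains of the Bach tensor is its component along
  \<open>\<theta>\<^sup>3 \<otimes> \<theta>\<^sup>3\<close>, equal to \<open>2 S\<^sub>1 / F\<close>.\<close>

section \<open>Calculus of smooth maps\<close>

text \<open>Working on \<open>P\<close> has a price. The images of the \<open>X a\<close> in
  \<open>M\<close> vary along the leaves, so the vertical parts of the brackets of the
  \<open>X a\<close> enter the curvature; and \<open>F\<close> is rescaled along
  \<open>Y2 + Y2b\<close>. What keeps this under control is that every term of \<open>d Om2\<close>
  contains \<open>Om3\<close>, its conjugate or \<open>Om4\<close>. Hence these vertical parts
  involve only \<open>Y3\<close>, \<open>Y3b\<close> and \<open>Y4\<close>, and along these three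
  fields \<open>F\<close> is constant. So half of \<open>d log F\<close> satisfies the closedness
  relation with the horizontal bracket coefficients alone, the Schouten tensor is symmetric, and the
  classical conformal change formulas apply as if the frame lived on \<open>M\<close>. The divisor
  \<open>3 i\<close> in the fourth form turns \<open>G\<close> into a form with constant
  coefficients in the frame; the bracket coefficients are constant too. Curvature identities thus
  become finitely many polynomial identities in \<open>R\<close>, \<open>S\<close>, the components
  \<open>s\<close> of half of \<open>d log F\<close>, and derivatives of these. The frame matrix is
  invertible at each point and \<open>q\<close> is onto, so the equivalence is obtained point by
  point.\<close>

lemma Ck_on_cong:
  assumes U: "open U"
  shows "\<forall>x\<in>U. f x = g x \<Longrightarrow> Ck_on k U f \<Longrightarrow> Ck_on k U g"
proof (induction k arbitrary: f g)
  case 0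
  then show ?case by (auto cong: continuous_on_cong)
next
  case (Suc k)
  have g: "(g has_derivative frechet_derivative f (at x)) (at x)" if x: "x \<in> U" for x
  proof (rule has_derivative_transform_within_open[OF _ U x])
    show "(f has_derivative frechet_derivative f (at x)) (at x)"
      using Suc.prems(2) x by (simp add: frechet_derivative_works)
  qed (use Suc.prems(1) in auto)
  have eq: "frechet_derivative f (at x) = frechet_derivative g (at x)" if "x \<in> U" for x
    using frechet_derivative_at[OF g[OF that]] .
  have "Ck_on k U (\<lambda>x. frechet_derivative g (at x) v)" for v
    by (rule Suc.IH[of "\<lambda>x. frechet_derivative f (at x) v"]) (use eq Suc.prems(2) in auto)
  then show ?case using g by (auto simp: differentiable_def)
qed

text \<open>The inductive steps below go through this rule: an explicitly computed derivative may
  stand in for \<open>frechet_derivative\<close>, with which it agrees on the open set.\<close>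

lemma Ck_on_intro:
  assumes "open U" and der: "\<And>x. x \<in> U \<Longrightarrow> (f has_derivative f' x) (at x)"
    and Ck: "\<And>v. Ck_on k U (\<lambda>x. f' x v)"
  shows "Ck_on (Suc k) U f"
proof -
  have "f' x = frechet_derivative f (at x)" if "x \<in> U" for x
    using frechet_derivative_at[OF der[OF that]] .
  then have "Ck_on k U (\<lambda>x. frechet_derivative f (at x) v)" for v
    by (intro Ck_on_cong[OF assms(1) _ Ck[of v]]) auto
  then show ?thesis using der by (auto simp: differentiable_def)
qed

lemma Ck_on_SucD: "Ck_on (Suc k) U f \<Longrightarrow> Ck_on k U f"
proof (induction k arbitrary: f)
  case 0
  then have "\<forall>x\<in>U. continuous (at x) f"
    unfolding Ck_on.simps(2) using differentiable_imp_continuous_within by blast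
  then show ?case unfolding Ck_on.simps(1) by (rule continuous_at_imp_continuous_on)
next
  case (Suc k)
  have 1: "\<forall>x\<in>U. f differentiable (at x)" "\<And>v. Ck_on (Suc k) U (\<lambda>x. frechet_derivative f (at x) v)"
    using Suc.prems unfolding Ck_on.simps(2)[of "Suc k"] by blast+
  show ?case
    unfolding Ck_on.simps(2)[of k] using 1(1) Suc.IH[OF 1(2)] by blast
qed

lemma Ck_on_has_derivative:
  "Ck_on (Suc k) U f \<Longrightarrow> x \<in> U \<Longrightarrow> (f has_derivative frechet_derivative f (at x)) (at x)"
  unfolding Ck_on.simps(2) using frechet_derivative_works by blast

lemma Ck_on_const: "Ck_on k U (\<lambda>x. c)"
proof (induction k arbitrary: c)
  case (Suc k)
  show ?case unfolding Ck_on.simps(2) frechet_derivative_const using Suc.IH by (intro conjI ballI allI differentiable_const)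
qed simp

lemma Ck_on_frechet: "Ck_on (Suc k) U f \<Longrightarrow> Ck_on k U (\<lambda>x. frechet_derivative f (at x) v)"
  by simp

lemma Ck_on_linear:
  assumes U: "open U" and L: "bounded_linear L"
  shows "Ck_on k U f \<Longrightarrow> Ck_on k U (\<lambda>x. L (f x))"
proof (induction k arbitrary: f)
  case 0
  then show ?case using L by (simp add: bounded_linear.continuous_on)
next
  case (Suc k)
  show ?case
  proof (rule Ck_on_intro[OF U])
    show "((\<lambda>x. L (f x)) has_derivative (\<lambda>v. L (frechet_derivative f (at x) v))) (at x)" if "x \<in> U" for x
      by (rule bounded_linear.has_derivative[OF L Ck_on_has_derivative[OF Suc.prems that]])
  qed (rule Suc.IH[OF Ck_on_frechet[OF Suc.prems]])
qed

lemma Ck_on_add: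
  assumes U: "open U"
  shows "Ck_on k U f \<Longrightarrow> Ck_on k U g \<Longrightarrow> Ck_on k U (\<lambda>x. f x + g x)"
proof (induction k arbitrary: f g)
  case 0
  then show ?case by (simp add: continuous_on_add)
next
  case (Suc k)
  show ?case
  proof (rule Ck_on_intro[OF U])
    show "((\<lambda>x. f x + g x) has_derivative
        (\<lambda>v. frechet_derivative f (at x) v + frechet_derivative g (at x) v)) (at x)" if "x \<in> U" for x
      by (rule has_derivative_add[OF Ck_on_has_derivative Ck_on_has_derivative]) (fact Suc.prems that)+
  qed (rule Suc.IH[OF Ck_on_frechet Ck_on_frechet], (fact Suc.prems)+)
qed

text \<open>The product rule also contains the undifferentiated factors, for which only order
  \<open>k\<close> is wanted; \<open>Ck_on_SucD\<close> lowers them.\<close>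

lemma Ck_on_bilinear:
  assumes U: "open U" and bl: "bounded_bilinear b"
  shows "Ck_on k U f \<Longrightarrow> Ck_on k U g \<Longrightarrow> Ck_on k U (\<lambda>x. b (f x) (g x))"
proof (induction k arbitrary: f g)
  case 0
  then show ?case by (simp add: bounded_bilinear.continuous_on[OF bl])
next
  case (Suc k)
  show ?case
  proof (rule Ck_on_intro[OF U])
    show "((\<lambda>x. b (f x) (g x)) has_derivative
        (\<lambda>v. b (f x) (frechet_derivative g (at x) v) + b (frechet_derivative f (at x) v) (g x))) (at x)"
      if "x \<in> U" for x
      by (rule bounded_bilinear.FDERIV[OF bl Ck_on_has_derivative Ck_on_has_derivative])
        (fact Suc.prems that)+
  qed (intro Ck_on_add[OF U] Suc.IH Ck_on_frechet Ck_on_SucD[OF Suc.prems(1)] Ck_on_SucD[OF Suc.prems(2)]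
      Suc.prems)
qed

text \<open>The derivative of the inverse contains the inverse itself, of which the induction
  hypothesis gives order \<open>k\<close>.\<close>

lemma Ck_on_inverse:
  fixes f :: "'a::euclidean_space \<Rightarrow> 'b::real_normed_field"
  assumes U: "open U" and nz: "\<And>x. x \<in> U \<Longrightarrow> f x \<noteq> 0"
  shows "Ck_on k U f \<Longrightarrow> Ck_on k U (\<lambda>x. inverse (f x))"
proof (induction k)
  case 0
  then show ?case using nz by (simp add: continuous_on_inverse)
next
  case (Suc k)
  have *: "Ck_on k U (\<lambda>x. inverse (f x))" using Suc.IH[OF Ck_on_SucD[OF Suc.prems]] .
  show ?case
  proof (rule Ck_on_intro[OF U])
    show "((\<lambda>x. inverse (f x)) has_derivative
        (\<lambda>v. - (inverse (f x) * frechet_derivative f (at x) v * inverse (f x)))) (at x)"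
      if "x \<in> U" for x
      by (rule Deriv.has_derivative_inverse[OF nz[OF that] Ck_on_has_derivative[OF Suc.prems that]])
  qed (intro * Ck_on_bilinear[OF U bounded_bilinear_mult] Ck_on_frechet Suc.prems
      Ck_on_linear[OF U bounded_linear_minus[OF bounded_linear_ident]])
qed

lemma Ck_on_sum:
  assumes U: "open U"
  shows "(\<And>i. i \<in> A \<Longrightarrow> Ck_on k U (f i)) \<Longrightarrow> Ck_on k U (\<lambda>x. \<Sum>i\<in>A. f i x)"
  by (induction A rule: infinite_finite_induct) (auto intro: Ck_on_const Ck_on_add[OF U])

text \<open>The chain rule gives \<open>?Dh (p x) (?Dp x v)\<close>, which is not a fixed function
  composed with \<open>p\<close>. Expanding the inner vector in the standard basis turns it into a
  finite sum of products to which the induction hypothesis for \<open>h\<close> applies.\<close>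

lemma Ck_on_compose:
  fixes h :: "'b::euclidean_space \<Rightarrow> 'c::real_normed_vector" and p :: "'a::euclidean_space \<Rightarrow> 'b"
  assumes U: "open U" and img: "p ` U \<subseteq> V" and p: "\<And>k. Ck_on k U p"
  shows "Ck_on k V h \<Longrightarrow> Ck_on k U (\<lambda>x. h (p x))"
proof (induction k arbitrary: h)
  case 0
  then show ?case
    using continuous_on_compose2[of V h U p] p[of 0] img by simp
next
  case (Suc k)
  let ?Dp = "\<lambda>x. frechet_derivative p (at x)" and ?Dh = "\<lambda>y. frechet_derivative h (at y)"
  have lin: "?Dh (p x) w = (\<Sum>b\<in>Basis. (w \<bullet> b) *\<^sub>R ?Dh (p x) b)" if "x \<in> U" for x w
  proof -
    have "bounded_linear (?Dh (p x))"
      using that img Ck_on_has_derivative[OF Suc.prems] by (blast intro: has_derivative_bounded_linear)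
    then interpret bounded_linear "?Dh (p x)" .
    have "?Dh (p x) w = ?Dh (p x) (\<Sum>b\<in>Basis. (w \<bullet> b) *\<^sub>R b)" by (simp add: euclidean_representation)
    then show ?thesis by (simp only: sum scaleR)
  qed
  have Dp: "Ck_on k U (\<lambda>x. ?Dp x v)" for v using p[of "Suc k"] by simp
  show ?case
  proof (rule Ck_on_intro[where f' = "\<lambda>x v. \<Sum>b\<in>Basis. (?Dp x v \<bullet> b) *\<^sub>R ?Dh (p x) b", OF U])
    fix x assume x: "x \<in> U"
    have "((\<lambda>x. h (p x)) has_derivative (\<lambda>v. ?Dh (p x) (?Dp x v))) (at x)"
      by (rule has_derivative_compose[OF Ck_on_has_derivative[OF p x] Ck_on_has_derivative[OF Suc.prems]])
        (use x img in blast)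
    moreover have "(\<lambda>v. ?Dh (p x) (?Dp x v)) = (\<lambda>v. \<Sum>b\<in>Basis. (?Dp x v \<bullet> b) *\<^sub>R ?Dh (p x) b)"
      by (rule ext) (rule lin[OF x])
    ultimately show "((\<lambda>x. h (p x)) has_derivative (\<lambda>v. \<Sum>b\<in>Basis. (?Dp x v \<bullet> b) *\<^sub>R ?Dh (p x) b)) (at x)"
      by metis
  next
    fix v
    show "Ck_on k U (\<lambda>x. \<Sum>b\<in>Basis. (?Dp x v \<bullet> b) *\<^sub>R ?Dh (p x) b)"
      by (intro Ck_on_sum[OF U] Ck_on_bilinear[OF U bounded_bilinear_scaleR]
          Ck_on_linear[OF U bounded_linear_inner_left] Dp Suc.IH Ck_on_frechet Suc.prems)
  qed
qed

lemma smooth_const: "smooth_map_on U (\<lambda>x. c)"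
  by (simp add: smooth_map_on_def Ck_on_const)

lemma smooth_cong: "open U \<Longrightarrow> (\<And>x. x \<in> U \<Longrightarrow> f x = g x) \<Longrightarrow> smooth_map_on U f \<Longrightarrow> smooth_map_on U g"
  by (auto simp: smooth_map_on_def intro: Ck_on_cong)

lemma smooth_linear:
  "bounded_linear L \<Longrightarrow> open U \<Longrightarrow> smooth_map_on U f \<Longrightarrow> smooth_map_on U (\<lambda>x. L (f x))"
  by (simp add: smooth_map_on_def Ck_on_linear)

lemma smooth_add:
  "open U \<Longrightarrow> smooth_map_on U f \<Longrightarrow> smooth_map_on U g \<Longrightarrow> smooth_map_on U (\<lambda>x. f x + g x)"
  by (simp add: smooth_map_on_def Ck_on_add)

lemma smooth_mult:
  fixes f :: "_ \<Rightarrow> 'b::real_normed_algebra"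
  shows "open U \<Longrightarrow> smooth_map_on U f \<Longrightarrow> smooth_map_on U g \<Longrightarrow> smooth_map_on U (\<lambda>x. f x * g x)"
  unfolding smooth_map_on_def by (blast intro: Ck_on_bilinear[OF _ bounded_bilinear_mult])

lemma smooth_uminus: "open U \<Longrightarrow> smooth_map_on U f \<Longrightarrow> smooth_map_on U (\<lambda>x. - f x)"
  by (rule smooth_linear[of uminus]) (simp_all add: bounded_linear_minus bounded_linear_ident)

lemma smooth_diff:
  "open U \<Longrightarrow> smooth_map_on U f \<Longrightarrow> smooth_map_on U g \<Longrightarrow> smooth_map_on U (\<lambda>x. f x - g x)"
  using smooth_add[of U f "\<lambda>x. - g x"] smooth_uminus[of U g] by simp

lemma smooth_sum:
  "open U \<Longrightarrow> (\<And>i. i \<in> A \<Longrightarrow> smooth_map_on U (f i)) \<Longrightarrow> smooth_map_on U (\<lambda>x. \<Sum>i\<in>A. f i x)"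
  by (simp add: smooth_map_on_def Ck_on_sum)

lemma smooth_prod:
  fixes f :: "_ \<Rightarrow> _ \<Rightarrow> 'b::real_normed_field"
  shows "open U \<Longrightarrow> (\<And>i. i \<in> A \<Longrightarrow> smooth_map_on U (f i)) \<Longrightarrow> smooth_map_on U (\<lambda>x. \<Prod>i\<in>A. f i x)"
  by (induction A rule: infinite_finite_induct) (auto intro: smooth_const smooth_mult)

lemma smooth_inverse:
  fixes f :: "_ \<Rightarrow> 'b::real_normed_field"
  shows "open U \<Longrightarrow> smooth_map_on U f \<Longrightarrow> (\<And>x. x \<in> U \<Longrightarrow> f x \<noteq> 0) \<Longrightarrow> smooth_map_on U (\<lambda>x. inverse (f x))"
  by (simp add: smooth_map_on_def Ck_on_inverse)

lemma smooth_divide: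
  fixes f :: "_ \<Rightarrow> 'b::real_normed_field"
  shows "open U \<Longrightarrow> smooth_map_on U f \<Longrightarrow> smooth_map_on U g \<Longrightarrow> (\<And>x. x \<in> U \<Longrightarrow> g x \<noteq> 0)
    \<Longrightarrow> smooth_map_on U (\<lambda>x. f x / g x)"
  by (simp add: divide_inverse smooth_mult smooth_inverse)

lemma smooth_compose:
  assumes "open U" "p ` U \<subseteq> V" and p: "smooth_map_on U p" and h: "smooth_map_on V h"
  shows "smooth_map_on U (\<lambda>x. h (p x))"
proof -
  have p': "Ck_on k U p" and h': "Ck_on k V h" for k
    using p h unfolding smooth_map_on_def by simp_all
  have "Ck_on k U (\<lambda>x. h (p x))" for k
    by (rule Ck_on_compose[OF assms(1,2) p' h'])
  then show ?thesis by (simp add: smooth_map_on_def)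
qed

lemma smooth_of_real:
  fixes f :: "_ \<Rightarrow> real"
  shows "open U \<Longrightarrow> smooth_map_on U f \<Longrightarrow> smooth_map_on U (\<lambda>x. complex_of_real (f x))"
  by (rule smooth_linear[OF bounded_linear_of_real])

lemma smooth_cnj: "open U \<Longrightarrow> smooth_map_on U f \<Longrightarrow> smooth_map_on U (\<lambda>x. cnj (f x))"
  by (rule smooth_linear[OF bounded_linear_cnj])

lemma smooth_nth: "open U \<Longrightarrow> smooth_map_on U f \<Longrightarrow> smooth_map_on U (\<lambda>x. f x $ i)"
  by (rule smooth_linear[OF bounded_linear_vec_nth])

lemma smooth_frechet: "smooth_map_on U f \<Longrightarrow> smooth_map_on U (\<lambda>x. frechet_derivative f (at x) v)"
  unfolding smooth_map_on_def by (metis Ck_on.simps(2))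

lemma smooth_has_derivative:
  "smooth_map_on U f \<Longrightarrow> x \<in> U \<Longrightarrow> (f has_derivative frechet_derivative f (at x)) (at x)"
  unfolding smooth_map_on_def by (metis Ck_on_has_derivative)

lemma smooth_det:
  fixes A :: "_ \<Rightarrow> 'b::real_normed_field^'n^'n"
  assumes "open U" "\<And>i j. smooth_map_on U (\<lambda>x. A x $ i $ j)"
  shows "smooth_map_on U (\<lambda>x. det (A x))"
  unfolding det_def by (intro smooth_sum smooth_mult smooth_const smooth_prod assms)

lemma matrix_inv_inverse:
  assumes "invertible A"
  shows "A ** matrix_inv A = mat 1" "matrix_inv A ** A = mat 1"
  using someI_ex[OF assms[unfolded invertible_def]] unfolding matrix_inv_def by blast+

text \<open>Cramer's rule writes each entry of the inverse as a quotient of two determinants of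
  smooth matrices.\<close>

lemma smooth_matrix_inv:
  fixes A :: "_ \<Rightarrow> 'b::real_normed_field^'n^'n"
  assumes U: "open U" and A: "\<And>i j. smooth_map_on U (\<lambda>x. A x $ i $ j)"
    and inv: "\<And>x. x \<in> U \<Longrightarrow> invertible (A x)"
  shows "smooth_map_on U (\<lambda>x. matrix_inv (A x) $ i $ j)"
proof (rule smooth_cong[OF U])
  let ?B = "\<lambda>x. (\<chi> k l. if l = i then axis j 1 $ k else A x $ k $ l) :: 'b^'n^'n"
  fix x assume x: "x \<in> U"
  then have d: "det (A x) \<noteq> 0" using inv invertible_det_nz by blast
  have "A x *v (matrix_inv (A x) *v axis j 1) = axis j 1"
    using inv[OF x] by (simp add: matrix_vector_mul_assoc matrix_inv_inverse)
  then have "matrix_inv (A x) *v axis j 1 = (\<chi> m. det (\<chi> k l. if l = m then axis j 1 $ k else A x $ k $ l) / det (A x))"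
    using cramer[OF d] by blast
  then have "(matrix_inv (A x) *v axis j 1) $ i = det (?B x) / det (A x)"
    by simp
  then show "det (?B x) / det (A x) = matrix_inv (A x) $ i $ j"
    by (simp add: matrix_vector_mult_def axis_def if_distrib cong: if_cong)
next
  have "smooth_map_on U (\<lambda>x. (if l = i then axis j 1 $ k else A x $ k $ l))" for k l
    using A by (cases "l = i") (auto intro: smooth_const)
  then show "smooth_map_on U (\<lambda>x. det (\<chi> k l. if l = i then axis j 1 $ k else A x $ k $ l) / det (A x))"
    using inv A U by (intro smooth_divide smooth_det) (auto simp: invertible_det_nz)
qed

section \<open>Symmetry of second derivatives\<close>

text \<open>The mean value theorem is applied twice: along \<open>u\<close> to the difference of two
  parallel copies of \<open>f\<close>, then along \<open>v\<close> to the derivative so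
  obtained.\<close>

lemma mixed_difference:
  fixes f :: "'a::euclidean_space \<Rightarrow> real"
  assumes f: "Ck_on (Suc (Suc 0)) U f" and h: "h > 0"
    and box: "\<And>s t. 0 \<le> s \<Longrightarrow> s \<le> h \<Longrightarrow> 0 \<le> t \<Longrightarrow> t \<le> h \<Longrightarrow> x + s *\<^sub>R u + t *\<^sub>R v \<in> U"
  obtains s t where "0 \<le> s" "s \<le> h" "0 \<le> t" "t \<le> h"
    "f (x + h *\<^sub>R u + h *\<^sub>R v) - f (x + h *\<^sub>R u) - f (x + h *\<^sub>R v) + f x
      = h * h * frechet_derivative (\<lambda>y. frechet_derivative f (at y) u) (at (x + s *\<^sub>R u + t *\<^sub>R v)) v"
proof -
  let ?D = "\<lambda>y. frechet_derivative f (at y)"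
  let ?DD = "\<lambda>y. frechet_derivative (\<lambda>y. ?D y u) (at y)"
  have f1: "(f has_derivative ?D y) (at y)" if "y \<in> U" for y
    using f that Ck_on_has_derivative by blast
  have f2: "((\<lambda>y. ?D y u) has_derivative ?DD y) (at y)" if "y \<in> U" for y
    using f that by (auto simp: frechet_derivative_works)
  have lin: "?D y (c *\<^sub>R w) = c * ?D y w" if "y \<in> U" for y c w
    using has_derivative_bounded_linear[OF f1[OF that]] by (simp add: linear_simps)
  have lin2: "?DD y (c *\<^sub>R w) = c * ?DD y w" if "y \<in> U" for y c w
    using has_derivative_bounded_linear[OF f2[OF that]] by (simp add: linear_simps)
  let ?\<phi> = "\<lambda>s. f (x + s *\<^sub>R u + h *\<^sub>R v) - f (x + s *\<^sub>R u)"
  have d\<phi>: "(?\<phi> has_real_derivative ?D (x + s *\<^sub>R u + h *\<^sub>R v) u - ?D (x + s *\<^sub>R u) u) (at s)"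
    if "0 \<le> s" "s \<le> h" for s
  proof -
    have in1: "x + s *\<^sub>R u + h *\<^sub>R v \<in> U" and in2: "x + s *\<^sub>R u \<in> U"
      using box[of s h] box[of s 0] that h by auto
    have "((\<lambda>s. f (x + s *\<^sub>R u + h *\<^sub>R v)) has_derivative (\<lambda>r. ?D (x + s *\<^sub>R u + h *\<^sub>R v) (r *\<^sub>R u))) (at s)"
      by (rule has_derivative_compose[where f="\<lambda>s. x + s *\<^sub>R u + h *\<^sub>R v", OF _ f1[OF in1]]) (auto intro!: derivative_eq_intros)
    moreover have "((\<lambda>s. f (x + s *\<^sub>R u)) has_derivative (\<lambda>r. ?D (x + s *\<^sub>R u) (r *\<^sub>R u))) (at s)"
      by (rule has_derivative_compose[where f="\<lambda>s. x + s *\<^sub>R u", OF _ f1[OF in2]]) (auto intro!: derivative_eq_intros)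
    ultimately have "(?\<phi> has_derivative (\<lambda>r. ?D (x + s *\<^sub>R u + h *\<^sub>R v) (r *\<^sub>R u) - ?D (x + s *\<^sub>R u) (r *\<^sub>R u))) (at s)"
      by (rule has_derivative_diff)
    moreover have "(\<lambda>r. ?D (x + s *\<^sub>R u + h *\<^sub>R v) (r *\<^sub>R u) - ?D (x + s *\<^sub>R u) (r *\<^sub>R u))
        = (*) (?D (x + s *\<^sub>R u + h *\<^sub>R v) u - ?D (x + s *\<^sub>R u) u)"
      by (rule ext) (simp only: lin[OF in1] lin[OF in2] right_diff_distrib mult.commute)
    ultimately show ?thesis by (simp only: has_field_derivative_def)
  qed
  obtain s where s: "0 < s" "s < h" and
    \<phi>: "?\<phi> h - ?\<phi> 0 = (h - 0) * (?D (x + s *\<^sub>R u + h *\<^sub>R v) u - ?D (x + s *\<^sub>R u) u)"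
    using MVT2[OF h d\<phi>] by auto
  let ?\<psi> = "\<lambda>t. ?D (x + s *\<^sub>R u + t *\<^sub>R v) u"
  have d\<psi>: "(?\<psi> has_real_derivative ?DD (x + s *\<^sub>R u + t *\<^sub>R v) v) (at t)" if "0 \<le> t" "t \<le> h" for t
  proof -
    have in1: "x + s *\<^sub>R u + t *\<^sub>R v \<in> U" using box[of s t] that s by auto
    have "(?\<psi> has_derivative (\<lambda>r. ?DD (x + s *\<^sub>R u + t *\<^sub>R v) (r *\<^sub>R v))) (at t)"
      by (rule has_derivative_compose[where f="\<lambda>t. x + s *\<^sub>R u + t *\<^sub>R v", OF _ f2[OF in1]]) (auto intro!: derivative_eq_intros)
    then show ?thesis using lin2[OF in1] by (simp add: has_field_derivative_def mult_commute_abs)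
  qed
  obtain t where t: "0 < t" "t < h" and
    \<psi>: "?\<psi> h - ?\<psi> 0 = (h - 0) * ?DD (x + s *\<^sub>R u + t *\<^sub>R v) v"
    using MVT2[OF h d\<psi>] by auto
  show thesis
    by (rule that[of s t]) (use s t \<phi> \<psi> in auto)
qed

text \<open>The second difference over a small parallelogram is symmetric in \<open>u\<close> and
  \<open>v\<close>, so the two mixed derivatives agree at two points close to \<open>x\<close>;
  continuity does the rest.\<close>

lemma mixed_derivative_commute_real:
  fixes f :: "'a::euclidean_space \<Rightarrow> real"
  assumes U: "open U" and f: "Ck_on (Suc (Suc 0)) U f" and x: "x \<in> U"
  shows "frechet_derivative (\<lambda>y. frechet_derivative f (at y) u) (at x) v
       = frechet_derivative (\<lambda>y. frechet_derivative f (at y) v) (at x) u"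
proof -
  define a where "a y = frechet_derivative (\<lambda>y. frechet_derivative f (at y) u) (at y) v" for y
  define b where "b y = frechet_derivative (\<lambda>y. frechet_derivative f (at y) v) (at y) u" for y
  have ca: "continuous_on U a" and cb: "continuous_on U b"
    using f by (auto simp: a_def b_def)
  have "dist (a x) (b x) < e" if e: "e > 0" for e
  proof -
    obtain d1 where d1: "d1 > 0" "\<And>y. y \<in> U \<Longrightarrow> dist y x < d1 \<Longrightarrow> dist (a y) (a x) < e/2"
      using ca x e unfolding continuous_on_iff by (metis half_gt_zero)
    obtain d2 where d2: "d2 > 0" "\<And>y. y \<in> U \<Longrightarrow> dist y x < d2 \<Longrightarrow> dist (b y) (b x) < e/2"
      using cb x e unfolding continuous_on_iff by (metis half_gt_zero)
    obtain d3 where d3: "d3 > 0" "ball x d3 \<subseteq> U" using U x openE by blast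
    define d where "d = min d1 (min d2 d3)"
    \<comment> \<open>Keeps the whole parallelogram within \<open>d / 2\<close> of \<open>x\<close>;
      the summand 1 covers the case \<open>u = v = 0\<close>.\<close>
    define h where "h = d / (2 * (norm u + norm v + 1))"
    have pos: "norm u + norm v + 1 > 0" by (smt (verit) norm_ge_zero)
    have d: "d > 0" using d1 d2 d3 by (simp add: d_def)
    have h: "h > 0" using d pos by (simp add: h_def)
    have near: "dist (x + s *\<^sub>R u + t *\<^sub>R v) x < d" if "0 \<le> s" "s \<le> h" "0 \<le> t" "t \<le> h" for s t
    proof -
      have "norm (s *\<^sub>R u + t *\<^sub>R v) \<le> s * norm u + t * norm v"
        using norm_triangle_ineq[of "s *\<^sub>R u" "t *\<^sub>R v"] that by simp
      also have "\<dots> \<le> h * norm u + h * norm v"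
        using that by (intro add_mono mult_right_mono) auto
      also have "\<dots> \<le> h * (norm u + norm v + 1)" using h by (simp add: algebra_simps)
      also have "\<dots> = d / 2" using pos unfolding h_def by (simp add: divide_simps)
      also have "\<dots> < d" using d by simp
      finally show ?thesis by (simp add: dist_norm add.assoc)
    qed
    have inU: "x + s *\<^sub>R u + t *\<^sub>R v \<in> U" if "0 \<le> s" "s \<le> h" "0 \<le> t" "t \<le> h" for s t
      using near[OF that] d3 by (auto simp: d_def dist_commute subset_iff)
    obtain s t where st: "0 \<le> s" "s \<le> h" "0 \<le> t" "t \<le> h" and
      A: "f (x + h *\<^sub>R u + h *\<^sub>R v) - f (x + h *\<^sub>R u) - f (x + h *\<^sub>R v) + f x
        = h * h * a (x + s *\<^sub>R u + t *\<^sub>R v)"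
      using mixed_difference[OF f h, of x u v] inU unfolding a_def by blast
    have inU': "x + s *\<^sub>R v + t *\<^sub>R u \<in> U" if "0 \<le> s" "s \<le> h" "0 \<le> t" "t \<le> h" for s t
      using inU[of t s] that by (simp add: add_ac)
    obtain s' t' where st': "0 \<le> s'" "s' \<le> h" "0 \<le> t'" "t' \<le> h" and
      B: "f (x + h *\<^sub>R v + h *\<^sub>R u) - f (x + h *\<^sub>R v) - f (x + h *\<^sub>R u) + f x
        = h * h * b (x + s' *\<^sub>R v + t' *\<^sub>R u)"
      using mixed_difference[OF f h, of x v u] inU' unfolding b_def by blast
    have swap: "x + c *\<^sub>R v + c' *\<^sub>R u = x + c' *\<^sub>R u + c *\<^sub>R v" for c c'
      by (simp add: add.commute add.left_commute)
    have "h * h * a (x + s *\<^sub>R u + t *\<^sub>R v) = h * h * b (x + t' *\<^sub>R u + s' *\<^sub>R v)"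
      using A B[unfolded swap] by linarith
    then have eq: "a (x + s *\<^sub>R u + t *\<^sub>R v) = b (x + t' *\<^sub>R u + s' *\<^sub>R v)" using h by simp
    have "dist (a (x + s *\<^sub>R u + t *\<^sub>R v)) (a x) < e/2"
      by (rule d1(2)) (use inU[OF st] near[OF st] in \<open>auto simp: d_def\<close>)
    moreover have "dist (b (x + t' *\<^sub>R u + s' *\<^sub>R v)) (b x) < e/2"
      by (rule d2(2)) (use inU[of t' s'] near[of t' s'] st' in \<open>auto simp: d_def\<close>)
    ultimately show ?thesis using eq dist_triangle_half_r by metis
  qed
  then have "\<not> dist (a x) (b x) > 0" by blast
  then show ?thesis by (simp add: a_def b_def)
qed

lemma frechet_derivative_linear_comp:
  assumes "bounded_linear L" "f differentiable at x"
  shows "frechet_derivative (\<lambda>x. L (f x)) (at x) v = L (frechet_derivative f (at x) v)"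
  by (metis assms bounded_linear.has_derivative frechet_derivative_at frechet_derivative_works)

text \<open>The mean value theorem is confined to real values, so real and imaginary parts are
  treated separately.\<close>

lemma mixed_derivative_commute:
  fixes f :: "'a::euclidean_space \<Rightarrow> complex"
  assumes U: "open U" and f: "smooth_map_on U f" and x: "x \<in> U"
  shows "frechet_derivative (\<lambda>y. frechet_derivative f (at y) u) (at x) v
       = frechet_derivative (\<lambda>y. frechet_derivative f (at y) v) (at x) u"
proof -
  have *: "L (frechet_derivative (\<lambda>y. frechet_derivative f (at y) u) (at x) v)
       = L (frechet_derivative (\<lambda>y. frechet_derivative f (at y) v) (at x) u)"
    if L: "bounded_linear L" for L :: "complex \<Rightarrow> real"
  proof -
    have D: "f differentiable at y" "(\<lambda>y. frechet_derivative f (at y) w) differentiable at y"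
      if "y \<in> U" for y w
      using smooth_has_derivative[OF f that] smooth_has_derivative[OF smooth_frechet[OF f] that]
      by (auto simp: differentiable_def)
    have 1: "frechet_derivative (\<lambda>y. frechet_derivative (\<lambda>y. L (f y)) (at y) w) (at x) w'
        = L (frechet_derivative (\<lambda>y. frechet_derivative f (at y) w) (at x) w')" for w w'
    proof -
      have "((\<lambda>y. L (frechet_derivative f (at y) w)) has_derivative
          (\<lambda>w'. L (frechet_derivative (\<lambda>y. frechet_derivative f (at y) w) (at x) w'))) (at x)"
        using D[OF x] by (intro bounded_linear.has_derivative[OF L]) (simp add: frechet_derivative_works)
      then have "((\<lambda>y. frechet_derivative (\<lambda>y. L (f y)) (at y) w) has_derivative
          (\<lambda>w'. L (frechet_derivative (\<lambda>y. frechet_derivative f (at y) w) (at x) w'))) (at x)"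
        by (rule has_derivative_transform_within_open[OF _ U x])
          (simp add: frechet_derivative_linear_comp[OF L] D)
      then show ?thesis by (metis frechet_derivative_at)
    qed
    have "Ck_on (Suc (Suc 0)) U (\<lambda>x. L (f x))"
      using smooth_linear[OF L U f] unfolding smooth_map_on_def by blast
    from mixed_derivative_commute_real[OF U this x] show ?thesis by (simp add: 1)
  qed
  show ?thesis
    using *[OF bounded_linear_Re] *[OF bounded_linear_Im] by (intro complex_eqI)
qed

section \<open>Complex vector fields as derivations\<close>

text \<open>The derivative is extended complex-linearly in its direction, because the frame dual to
  a complex coframe consists of complex fields.\<close>

definition vder :: "(real^'n \<Rightarrow> complex^'n) \<Rightarrow> (real^'n \<Rightarrow> complex) \<Rightarrow> real^'n \<Rightarrow> complex" where
  "vder Z f x = (\<Sum>j\<in>UNIV. Z x $ j * frechet_derivative f (at x) (axis j 1))"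

definition smooth_field :: "(real^'n) set \<Rightarrow> (real^'n \<Rightarrow> complex^'n) \<Rightarrow> bool" where
  "smooth_field U Z \<longleftrightarrow> (\<forall>j. smooth_map_on U (\<lambda>x. Z x $ j))"

definition lie :: "(real^'n \<Rightarrow> complex^'n) \<Rightarrow> (real^'n \<Rightarrow> complex^'n) \<Rightarrow> real^'n \<Rightarrow> complex^'n" where
  "lie Z W x = (\<chi> j. vder Z (\<lambda>x. W x $ j) x - vder W (\<lambda>x. Z x $ j) x)"

lemma smooth_vder:
  assumes "open U" "smooth_field U Z" "smooth_map_on U f"
  shows "smooth_map_on U (vder Z f)"
proof -
  have "smooth_map_on U (\<lambda>x. \<Sum>j\<in>UNIV. Z x $ j * frechet_derivative f (at x) (axis j 1))"
    using assms(2) unfolding smooth_field_def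
    by (intro smooth_sum[OF assms(1)] smooth_mult[OF assms(1)] smooth_frechet[OF assms(3)]) blast
  then show ?thesis unfolding vder_def .
qed

lemma vder_I: "(f has_derivative D) (at x) \<Longrightarrow> vder Z f x = (\<Sum>j\<in>UNIV. Z x $ j * D (axis j 1))"
  using frechet_derivative_at[of f D x] by (simp add: vder_def)

lemma vder_const: "vder Z (\<lambda>x. c) x = 0"
  by (simp add: vder_I[OF has_derivative_const])

lemma vder_cong:
  assumes "open U" "x \<in> U" "\<And>y. y \<in> U \<Longrightarrow> f y = h y"
  shows "vder Z f x = vder Z h x"
proof -
  have "(f has_derivative D) (at x) \<longleftrightarrow> (h has_derivative D) (at x)" for D
    using assms has_derivative_transform_within_open[OF _ assms(1,2)] by metis
  then show ?thesis unfolding vder_def frechet_derivative_def by simp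
qed

context
  fixes U :: "(real^'n) set" and x :: "real^'n" and f h :: "real^'n \<Rightarrow> complex"
  assumes x: "x \<in> U" and f: "smooth_map_on U f" and h: "smooth_map_on U h"
begin

lemma vder_add: "vder Z (\<lambda>x. f x + h x) x = vder Z f x + vder Z h x"
  by (subst vder_I[OF has_derivative_add[OF smooth_has_derivative[OF f x] smooth_has_derivative[OF h x]]])
    (simp add: vder_def sum.distrib algebra_simps)

lemma vder_diff: "vder Z (\<lambda>x. f x - h x) x = vder Z f x - vder Z h x"
  by (subst vder_I[OF has_derivative_diff[OF smooth_has_derivative[OF f x] smooth_has_derivative[OF h x]]])
    (simp add: vder_def sum_subtractf algebra_simps)

lemma vder_mult: "vder Z (\<lambda>x. f x * h x) x = vder Z f x * h x + f x * vder Z h x"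
  by (subst vder_I[OF has_derivative_mult[OF smooth_has_derivative[OF f x] smooth_has_derivative[OF h x]]])
    (simp add: vder_def sum.distrib sum_distrib_left algebra_simps)

end

lemma vder_cmult:
  "x \<in> U \<Longrightarrow> smooth_map_on U f \<Longrightarrow> vder Z (\<lambda>x. c * f x) x = c * vder Z f x"
  using vder_mult[OF _ smooth_const[of U c], of x f Z] by (simp add: vder_const)

lemma vder_sum:
  assumes "open U" "x \<in> U"
  shows "(\<And>i. i \<in> A \<Longrightarrow> smooth_map_on U (f i)) \<Longrightarrow> vder Z (\<lambda>x. \<Sum>i\<in>A. f i x) x = (\<Sum>i\<in>A. vder Z (f i) x)"
proof (induction A rule: infinite_finite_induct)
  case (insert a A)
  have "vder Z (\<lambda>x. f a x + (\<Sum>i\<in>A. f i x)) x = vder Z (f a) x + vder Z (\<lambda>x. \<Sum>i\<in>A. f i x) x"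
    by (rule vder_add[OF assms(2)]) (use insert.prems in \<open>auto intro: smooth_sum[OF assms(1)]\<close>)
  with insert show ?case by simp
qed (simp_all add: vder_const)

lemma vder_cnj:
  assumes "x \<in> U" "smooth_map_on U f"
  shows "vder Z (\<lambda>x. cnj (f x)) x = cnj (vder (\<lambda>x. \<chi> j. cnj (Z x $ j)) f x)"
  by (subst vder_I[OF bounded_linear.has_derivative[OF bounded_linear_cnj smooth_has_derivative[OF assms(2,1)]]])
    (simp add: vder_def)

lemma vder_field_scale: "vder (\<lambda>x. c *s (Z x - W x)) f x = c * (vder Z f x - vder W f x)"
  by (simp add: vder_def sum_distrib_left sum_subtractf algebra_simps)

lemma vder_field_eq: "Z x = (\<Sum>i\<in>A. c i *s W i x) \<Longrightarrow> vder Z f x = (\<Sum>i\<in>A. c i * vder (W i) f x)"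
  by (simp add: vder_def sum_distrib_left sum_distrib_right sum.swap[of _ UNIV A] mult.assoc)

text \<open>The second-order terms of the two compositions cancel by
  \<open>mixed_derivative_commute\<close>; only derivatives of the coefficients of the fields
  survive.\<close>

lemma vder_lie:
  assumes U: "open U" and x: "x \<in> U" and Z: "smooth_field U Z" and W: "smooth_field U W"
    and f: "smooth_map_on U f"
  shows "vder Z (vder W f) x - vder W (vder Z f) x = vder (lie Z W) f x"
proof -
  let ?D = "\<lambda>j y. frechet_derivative f (at y) (axis j 1)"
  have D: "smooth_map_on U (?D j)" for j by (rule smooth_frechet[OF f])
  have *: "vder A (vder B f) x = (\<Sum>j\<in>UNIV. vder A (\<lambda>x. B x $ j) x * ?D j x)
        + (\<Sum>j\<in>UNIV. \<Sum>k\<in>UNIV. B x $ j * A x $ k * frechet_derivative (?D j) (at x) (axis k 1))"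
    if "smooth_field U B" for A B
  proof -
    have B: "smooth_map_on U (\<lambda>x. B x $ j)" for j using that by (simp add: smooth_field_def)
    have "vder A (vder B f) x = vder A (\<lambda>x. \<Sum>j\<in>UNIV. B x $ j * ?D j x) x"
      by (simp add: vder_def[abs_def])
    also have "\<dots> = (\<Sum>j\<in>UNIV. vder A (\<lambda>x. B x $ j * ?D j x) x)"
      by (rule vder_sum[OF U x]) (intro smooth_mult[OF U] B D)
    also have "\<dots> = (\<Sum>j\<in>UNIV. vder A (\<lambda>x. B x $ j) x * ?D j x + B x $ j * vder A (?D j) x)"
      by (simp only: vder_mult[OF x B D])
    finally show ?thesis
      by (simp add: sum.distrib vder_def[of A "?D _"] sum_distrib_left mult.assoc)
  qed
  have "(\<Sum>j\<in>UNIV. \<Sum>k\<in>UNIV. W x $ j * Z x $ k * frechet_derivative (?D j) (at x) (axis k 1))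
      = (\<Sum>k\<in>UNIV. \<Sum>j\<in>UNIV. W x $ j * Z x $ k * frechet_derivative (?D j) (at x) (axis k 1))"
    by (rule sum.swap)
  also have "\<dots> = (\<Sum>j\<in>UNIV. \<Sum>k\<in>UNIV. Z x $ j * W x $ k * frechet_derivative (?D j) (at x) (axis k 1))"
    by (intro sum.cong refl) (simp add: mixed_derivative_commute[OF U f x, of "axis _ 1" "axis _ 1"] mult.commute)
  finally show ?thesis
    unfolding *[OF W] *[OF Z] by (simp add: vder_def[of "lie Z W"] lie_def left_diff_distrib sum_subtractf)
qed

text \<open>The components of the image of \<open>Z\<close> under \<open>q\<close> appear as
  derivatives of the coordinates of \<open>q\<close>. Tensors on \<open>M\<close> can thus be
  differentiated on \<open>P\<close> within the calculus of \<open>vder\<close>.\<close>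

lemma vder_chain:
  fixes h :: "real^4 \<Rightarrow> real" and q :: "real^'n \<Rightarrow> real^4"
  assumes q: "smooth_map_on U q" "x \<in> U" and h: "smooth_map_on V h" "q x \<in> V"
  shows "vder Z (\<lambda>x. of_real (h (q x))) x = (\<Sum>i\<in>UNIV. vder Z (\<lambda>x. of_real (q x $ i)) x * of_real (pd i h (q x)))"
proof -
  let ?Dq = "frechet_derivative q (at x)" and ?Dh = "frechet_derivative h (at (q x))"
  have Dq: "(q has_derivative ?Dq) (at x)" by (rule smooth_has_derivative[OF q])
  have Dh: "(h has_derivative ?Dh) (at (q x))" by (rule smooth_has_derivative[OF h])
  interpret bounded_linear ?Dh by (rule has_derivative_bounded_linear[OF Dh])
  have lin: "?Dh w = (\<Sum>i\<in>UNIV. w $ i * pd i h (q x))" for w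
  proof -
    have "?Dh w = ?Dh (\<Sum>i\<in>UNIV. w $ i *\<^sub>R axis i 1)"
      by (simp add: basis_expansion[of w, unfolded scalar_mult_eq_scaleR])
    then show ?thesis by (simp only: sum scaleR pd_def real_scaleR_def)
  qed
  have 1: "((\<lambda>x. complex_of_real (h (q x))) has_derivative (\<lambda>v. of_real (?Dh (?Dq v)))) (at x)"
    by (rule bounded_linear.has_derivative[OF bounded_linear_of_real
          has_derivative_compose[OF Dq Dh]])
  have 2: "((\<lambda>x. complex_of_real (q x $ i)) has_derivative (\<lambda>v. of_real (?Dq v $ i))) (at x)" for i
    by (rule bounded_linear.has_derivative[OF bounded_linear_of_real
          bounded_linear.has_derivative[OF bounded_linear_vec_nth Dq]])
  show ?thesis
    unfolding vder_I[OF 1] vder_I[OF 2] lin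
    by (simp add: sum_distrib_left sum_distrib_right sum.swap[of _ "UNIV :: 'n set"] mult.assoc)
qed

section \<open>One-forms on complex vectors and Cartan's formula\<close>

definition lin_form_at :: "'a::real_vector \<Rightarrow> 'a cform \<Rightarrow> bool" where
  "lin_form_at x \<omega> \<longleftrightarrow> linear (\<lambda>v. \<omega> x [v])"

lemma lin_form_at_intros:
  "lin_form_at x \<alpha> \<Longrightarrow> lin_form_at x \<beta> \<Longrightarrow> lin_form_at x (\<alpha> +\<^sub>f \<beta>)"
  "lin_form_at x \<alpha> \<Longrightarrow> lin_form_at x (c *\<^sub>f \<alpha>)"
  "lin_form_at x \<alpha> \<Longrightarrow> lin_form_at x (cnj_form \<alpha>)"
  by (auto simp: lin_form_at_def form_add_def form_scale_def cnj_form_def linear_iff algebra_simps)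

lemma ceval_expand:
  assumes "lin_form_at x \<omega>"
  shows "ceval \<omega> x z = (\<Sum>j\<in>UNIV. z $ j * \<omega> x [axis j 1])"
proof -
  interpret linear "\<lambda>v. \<omega> x [v]" using assms by (simp add: lin_form_at_def)
  have lin: "\<omega> x [v] = (\<Sum>j\<in>UNIV. v $ j *\<^sub>R \<omega> x [axis j 1])" for v
  proof -
    have "\<omega> x [v] = \<omega> x [\<Sum>j\<in>UNIV. v $ j *\<^sub>R axis j 1]"
      by (simp add: basis_expansion[of v, unfolded scalar_mult_eq_scaleR])
    then show ?thesis by (simp only: sum scale)
  qed
  have "ceval \<omega> x z = (\<Sum>j\<in>UNIV. (complex_of_real (Re (z $ j)) + \<i> * complex_of_real (Im (z $ j))) * \<omega> x [axis j 1])"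
    unfolding ceval_def lin[of "\<chi> i. Re (z $ i)"] lin[of "\<chi> i. Im (z $ i)"]
    by (simp add: scaleR_conv_of_real sum_distrib_left sum.distrib algebra_simps)
  then show ?thesis by (simp only: complex_eq[symmetric])
qed

lemma ceval_add: "ceval (\<alpha> +\<^sub>f \<beta>) x z = ceval \<alpha> x z + ceval \<beta> x z"
  and ceval_scale: "ceval (c *\<^sub>f \<alpha>) x z = c * ceval \<alpha> x z"
  by (simp_all add: ceval_def form_add_def form_scale_def algebra_simps)

definition ceval2 :: "(real^'n) cform \<Rightarrow> real^'n \<Rightarrow> complex^'n \<Rightarrow> complex^'n \<Rightarrow> complex" where
  "ceval2 \<omega> x z w = (\<Sum>j\<in>UNIV. \<Sum>k\<in>UNIV. z $ j * w $ k * \<omega> x [axis j 1, axis k 1])"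

lemma ceval2_cong: "(\<And>u v. \<alpha> x [u, v] = \<beta> x [u, v]) \<Longrightarrow> ceval2 \<alpha> x z w = ceval2 \<beta> x z w"
  by (simp add: ceval2_def)

lemma ceval2_add: "ceval2 (\<alpha> +\<^sub>f \<beta>) x z w = ceval2 \<alpha> x z w + ceval2 \<beta> x z w"
  by (simp add: ceval2_def form_add_def sum.distrib algebra_simps)

lemma wedge_two: "(\<alpha> \<and>\<^sub>f \<beta>) x [u, v] = \<alpha> x [u] * \<beta> x [v] - \<alpha> x [v] * \<beta> x [u]"
  by (simp add: form_wedge_def drop_nth_def lessThan_Suc)

lemma ceval2_wedge:
  assumes "lin_form_at x \<alpha>" "lin_form_at x \<beta>"
  shows "ceval2 (\<alpha> \<and>\<^sub>f \<beta>) x z w = ceval \<alpha> x z * ceval \<beta> x w - ceval \<alpha> x w * ceval \<beta> x z"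
proof -
  let ?a = "\<lambda>j. \<alpha> x [axis j 1]" and ?b = "\<lambda>j. \<beta> x [axis j 1]"
  have "ceval2 (\<alpha> \<and>\<^sub>f \<beta>) x z w = (\<Sum>j\<in>UNIV. \<Sum>k\<in>UNIV. (z $ j * ?a j) * (w $ k * ?b k))
     - (\<Sum>j\<in>UNIV. \<Sum>k\<in>UNIV. (z $ j * ?b j) * (w $ k * ?a k))"
    unfolding ceval2_def wedge_two by (simp add: sum_subtractf[symmetric] algebra_simps)
  also have "\<dots> = (\<Sum>j\<in>UNIV. z $ j * ?a j) * (\<Sum>k\<in>UNIV. w $ k * ?b k)
      - (\<Sum>j\<in>UNIV. z $ j * ?b j) * (\<Sum>k\<in>UNIV. w $ k * ?a k)"
    by (simp only: sum_product)
  finally show ?thesis using assms by (simp add: ceval_expand)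
qed

lemma cnj_form_distrib:
  "cnj_form (\<alpha> +\<^sub>f \<beta>) = cnj_form \<alpha> +\<^sub>f cnj_form \<beta>"
  "cnj_form (c *\<^sub>f \<alpha>) = cnj c *\<^sub>f cnj_form \<alpha>"
  "cnj_form (\<alpha> \<and>\<^sub>f \<beta>) = cnj_form \<alpha> \<and>\<^sub>f cnj_form \<beta>"
  "cnj_form (cnj_form \<alpha>) = \<alpha>"
  by (simp_all add: cnj_form_def form_add_def form_scale_def form_wedge_def)

lemma ext_d_two:
  "ext_d \<omega> x [u, v] = frechet_derivative (\<lambda>y. \<omega> y [v]) (at x) u - frechet_derivative (\<lambda>y. \<omega> y [u]) (at x) v"
  by (simp add: ext_d_def drop_nth_def lessThan_Suc)

lemma smooth_one_form_cnj: "open U \<Longrightarrow> smooth_one_form U \<omega> \<Longrightarrow> smooth_one_form U (cnj_form \<omega>)"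
  unfolding smooth_one_form_def
  by (auto simp: cnj_form_def linear_iff intro: smooth_cnj)

lemma smooth_one_form_lin: "smooth_one_form U \<omega> \<Longrightarrow> x \<in> U \<Longrightarrow> lin_form_at x \<omega>"
  by (simp add: smooth_one_form_def lin_form_at_def)

lemma ext_d_cnj:
  assumes "smooth_one_form U \<omega>" "x \<in> U"
  shows "ext_d (cnj_form \<omega>) x [u, v] = cnj_form (ext_d \<omega>) x [u, v]"
proof -
  have "frechet_derivative (\<lambda>y. cnj (\<omega> y [v])) (at x) u = cnj (frechet_derivative (\<lambda>y. \<omega> y [v]) (at x) u)" for u v
    using assms
    by (intro frechet_derivative_linear_comp[OF bounded_linear_cnj])
      (auto simp: smooth_one_form_def differentiable_def intro: smooth_has_derivative)
  then show ?thesis by (simp add: ext_d_two cnj_form_def)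
qed

text \<open>Differentiating the two pairings yields derivatives of the coefficients of the form,
  which make up its exterior derivative, and derivatives of the coefficients of the fields, which
  make up the bracket.\<close>

lemma cartan_formula:
  assumes U: "open U" and x: "x \<in> U" and \<omega>: "smooth_one_form U \<omega>"
    and Z: "smooth_field U Z" and W: "smooth_field U W"
  shows "ceval2 (ext_d \<omega>) x (Z x) (W x) = vder Z (\<lambda>x. ceval \<omega> x (W x)) x
    - vder W (\<lambda>x. ceval \<omega> x (Z x)) x - ceval \<omega> x (lie Z W x)"
proof -
  let ?w = "\<lambda>k y. \<omega> y [axis k 1]"
  have w: "smooth_map_on U (?w k)" for k using \<omega> by (simp add: smooth_one_form_def)
  have ce: "ceval \<omega> y z = (\<Sum>j\<in>UNIV. z $ j * ?w j y)" if "y \<in> U" for y z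
    by (rule ceval_expand[OF smooth_one_form_lin[OF \<omega> that]])
  have *: "vder A (\<lambda>x. ceval \<omega> x (B x)) x = (\<Sum>j\<in>UNIV. vder A (\<lambda>x. B x $ j) x * ?w j x)
      + (\<Sum>j\<in>UNIV. \<Sum>k\<in>UNIV. B x $ j * A x $ k * frechet_derivative (?w j) (at x) (axis k 1))"
    if "smooth_field U B" for A B
  proof -
    have B: "smooth_map_on U (\<lambda>x. B x $ j)" for j using that by (simp add: smooth_field_def)
    have "vder A (\<lambda>x. ceval \<omega> x (B x)) x = vder A (\<lambda>x. \<Sum>j\<in>UNIV. B x $ j * ?w j x) x"
      by (rule vder_cong[OF U x]) (rule ce)
    also have "\<dots> = (\<Sum>j\<in>UNIV. vder A (\<lambda>x. B x $ j * ?w j x) x)"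
      by (rule vder_sum[OF U x]) (intro smooth_mult[OF U] B w)
    also have "\<dots> = (\<Sum>j\<in>UNIV. vder A (\<lambda>x. B x $ j) x * ?w j x + B x $ j * vder A (?w j) x)"
      by (simp only: vder_mult[OF x B w])
    finally show ?thesis
      by (simp add: sum.distrib vder_def[of A "?w _"] sum_distrib_left mult.assoc)
  qed
  have "ceval2 (ext_d \<omega>) x (Z x) (W x)
    = (\<Sum>j\<in>UNIV. \<Sum>k\<in>UNIV. W x $ k * Z x $ j * frechet_derivative (?w k) (at x) (axis j 1))
    - (\<Sum>j\<in>UNIV. \<Sum>k\<in>UNIV. Z x $ j * W x $ k * frechet_derivative (?w j) (at x) (axis k 1))"
    by (simp add: ceval2_def ext_d_two right_diff_distrib sum_subtractf mult.commute)
  also have "(\<Sum>j\<in>UNIV. \<Sum>k\<in>UNIV. W x $ k * Z x $ j * frechet_derivative (?w k) (at x) (axis j 1))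
    = (\<Sum>j\<in>UNIV. \<Sum>k\<in>UNIV. W x $ j * Z x $ k * frechet_derivative (?w j) (at x) (axis k 1))"
    by (rule sum.swap)
  finally show ?thesis
    unfolding *[OF W] *[OF Z] ce[OF x]
    by (simp add: lie_def left_diff_distrib sum_subtractf)
qed

section \<open>Dual frames and their commutators\<close>

text \<open>The frame consists of the columns of the inverse of the coefficient matrix of the
  coframe; its smoothness is that of the inverse matrix.\<close>

lemma dual_frame_exists:
  fixes \<omega>s :: "(real^'n) cform list"
  assumes U: "open U" and len: "length \<omega>s = CARD('n)"
    and smooth: "\<And>i. i < CARD('n) \<Longrightarrow> smooth_one_form U (\<omega>s ! i)"
    and indep: "\<And>x. x \<in> U \<Longrightarrow> lin_indep_at x \<omega>s"
  obtains E :: "nat \<Rightarrow> real^'n \<Rightarrow> complex^'n"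
  where "\<And>i. i < CARD('n) \<Longrightarrow> smooth_field U (E i)"
    and "\<And>x i j. x \<in> U \<Longrightarrow> i < CARD('n) \<Longrightarrow> j < CARD('n) \<Longrightarrow> ceval (\<omega>s ! i) x (E j x) = (if i = j then 1 else 0)"
    and "\<And>x z. x \<in> U \<Longrightarrow> z = (\<Sum>i<CARD('n). ceval (\<omega>s ! i) x z *s E i x)"
proof -
  \<comment> \<open>Forms are numbered by naturals, matrices are indexed by the type
    \<open>'n\<close>; \<open>b\<close> and its inverse \<open>c\<close> translate.\<close>
  obtain b where b: "bij_betw b {0..<CARD('n)} (UNIV :: 'n set)"
    using ex_bij_betw_nat_finite[of "UNIV :: 'n set"] by auto
  define c where "c = inv_into {0..<CARD('n)} b"
  have c: "c k < CARD('n)" "b (c k) = k" for k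
    using b bij_betw_inv_into_right[OF b, of k] bij_betwE[OF bij_betw_inv_into[OF b]] by (auto simp: c_def)
  have cb: "c (b i) = i" if "i < CARD('n)" for i
    using b that by (simp add: c_def bij_betw_inv_into_left)
  define A where "A x = (\<chi> k j. (\<omega>s ! c k) x [axis j 1])" for x :: "real^'n"
  have lin: "lin_form_at x (\<omega>s ! i)" if "x \<in> U" "i < CARD('n)" for x i
    using smooth_one_form_lin[OF smooth] that by blast
  have ce: "ceval (\<omega>s ! i) x z = (A x *v z) $ b i" if "x \<in> U" "i < CARD('n)" for x i z
    using that by (simp add: ceval_expand[OF lin] matrix_vector_mult_def A_def cb mult.commute)
  have reindex: "(\<Sum>k\<in>UNIV. f k) = (\<Sum>i<CARD('n). f (b i))" for f :: "'n \<Rightarrow> 'z::comm_monoid_add"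
    using sum.reindex_bij_betw[OF b, of f] by (simp add: atLeast0LessThan)
  have inv: "invertible (A x)" if x: "x \<in> U" for x
  proof -
    \<comment> \<open>A kernel vector of the transpose is a linear relation among the forms, first
      on basis vectors and then, by linearity, on all real vectors.\<close>
    have "y = 0" if y: "transpose (A x) *v y = 0" for y
    proof -
      have 1: "(\<Sum>i<length \<omega>s. y $ b i * (\<omega>s ! i) x [axis j 1]) = 0" for j
      proof -
        have "(\<Sum>k\<in>UNIV. y $ k * A x $ k $ j) = 0"
          using y by (simp add: vec_eq_iff matrix_vector_mult_def transpose_def mult.commute)
        then show ?thesis unfolding reindex len by (simp add: A_def cb)
      qed
      have "(\<Sum>i<length \<omega>s. y $ b i * (\<omega>s ! i) x [v]) = 0" for v
      proof -
        have "(\<omega>s ! i) x [v] = (\<Sum>j\<in>UNIV. cvec v $ j * (\<omega>s ! i) x [axis j 1])" if "i < CARD('n)" for i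
        proof -
          have "ceval (\<omega>s ! i) x (cvec v) = (\<omega>s ! i) x [v]"
            using linear_0[OF lin[OF x that, unfolded lin_form_at_def]]
            by (simp add: ceval_def cvec_def vec_lambda_eta zero_vec_def[symmetric])
          then show ?thesis using ceval_expand[OF lin[OF x that]] by metis
        qed
        then have "(\<Sum>i<length \<omega>s. y $ b i * (\<omega>s ! i) x [v])
          = (\<Sum>i<length \<omega>s. \<Sum>j\<in>UNIV. cvec v $ j * (y $ b i * (\<omega>s ! i) x [axis j 1]))"
          by (simp add: len sum_distrib_left algebra_simps)
        also have "\<dots> = (\<Sum>j\<in>UNIV. cvec v $ j * (\<Sum>i<length \<omega>s. y $ b i * (\<omega>s ! i) x [axis j 1]))"
          by (subst sum.swap) (simp add: sum_distrib_left)
        finally show ?thesis using 1 by simp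
      qed
      then have "\<forall>i<length \<omega>s. y $ b i = 0"
        using indep[OF x] unfolding lin_indep_at_def by (elim allE[of _ "\<lambda>i. y $ b i"]) blast
      then show "y = 0" using c by (metis len vec_eq_iff zero_index)
    qed
    then have "invertible (transpose (A x))"
      using matrix_left_invertible_ker invertible_left_inverse by metis
    then show ?thesis by (simp add: invertible_det_nz)
  qed
  define E where "E i x = (\<chi> j. matrix_inv (A x) $ j $ b i)" for i and x :: "real^'n"
  have AE: "A x *v E i x = axis (b i) 1" if "x \<in> U" for x i
  proof -
    have "(A x *v E i x) $ k = (A x ** matrix_inv (A x)) $ k $ b i" for k
      by (simp add: matrix_vector_mult_def matrix_matrix_mult_def E_def)
    then show ?thesis using matrix_inv_inverse(1)[OF inv[OF that]] by (simp add: vec_eq_iff mat_def axis_def)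
  qed
  show thesis
  proof (rule that)
    show "smooth_field U (E i)" if "i < CARD('n)" for i
    proof -
      have "smooth_map_on U (\<lambda>x. matrix_inv (A x) $ j $ b i)" for j
      proof (rule smooth_matrix_inv[OF U _ inv])
        show "smooth_map_on U (\<lambda>x. A x $ k $ l)" for k l
          using smooth[OF c(1)] by (simp add: A_def smooth_one_form_def)
      qed
      then show ?thesis by (simp add: smooth_field_def E_def)
    qed
    show "ceval (\<omega>s ! i) x (E j x) = (if i = j then 1 else 0)"
      if "x \<in> U" "i < CARD('n)" "j < CARD('n)" for x i j
      using ce[OF that(1,2)] AE[OF that(1)] cb that by (auto simp: axis_def) metis
    show "z = (\<Sum>i<CARD('n). ceval (\<omega>s ! i) x z *s E i x)" if x: "x \<in> U" for x z
    proof -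
      have "z = matrix_inv (A x) *v (A x *v z)"
        by (simp add: matrix_vector_mul_assoc matrix_inv_inverse[OF inv[OF x]])
      also have "\<dots> = (\<Sum>i<CARD('n). ceval (\<omega>s ! i) x z *s E i x)"
        by (simp add: vec_eq_iff matrix_vector_mult_def[of "matrix_inv (A x)"] reindex ce[OF x] E_def mult.commute)
      finally show ?thesis .
    qed
  qed
qed

text \<open>The pairings of form and field are constant, so Cartan's formula identifies the
  components of a bracket with minus the values of the exterior derivatives.\<close>

lemma frame_commutator:
  fixes \<omega>s :: "(real^'n) cform list"
  assumes U: "open U" and x: "x \<in> U" and smooth: "\<And>i. i < CARD('n) \<Longrightarrow> smooth_one_form U (\<omega>s ! i)"
    and E: "\<And>i. i < CARD('n) \<Longrightarrow> smooth_field U (E i)"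
    and dual: "\<And>x i j. x \<in> U \<Longrightarrow> i < CARD('n) \<Longrightarrow> j < CARD('n) \<Longrightarrow> ceval (\<omega>s ! i) x (E j x) = (if i = j then 1 else 0)"
    and complete: "\<And>x z. x \<in> U \<Longrightarrow> z = (\<Sum>i<CARD('n). ceval (\<omega>s ! i) x z *s E i x)"
    and f: "smooth_map_on U f" and i: "i < CARD('n)" and j: "j < CARD('n)"
  shows "vder (E i) (vder (E j) f) x - vder (E j) (vder (E i) f) x
    = - (\<Sum>k<CARD('n). ceval2 (ext_d (\<omega>s ! k)) x (E i x) (E j x) * vder (E k) f x)"
proof -
  have "ceval (\<omega>s ! k) x (lie (E i) (E j) x) = - ceval2 (ext_d (\<omega>s ! k)) x (E i x) (E j x)"
    if k: "k < CARD('n)" for k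
  proof -
    have "vder Z (\<lambda>x. ceval (\<omega>s ! k) x (E l x)) x = 0" if l: "l < CARD('n)" for Z l
    proof -
      have "vder Z (\<lambda>x. ceval (\<omega>s ! k) x (E l x)) x = vder Z (\<lambda>x. if k = l then 1 else 0) x"
        by (rule vder_cong[OF U x]) (simp add: dual k l)
      then show ?thesis by (simp add: vder_const)
    qed
    then show ?thesis
      using cartan_formula[OF U x smooth[OF k] E[OF i] E[OF j]] i j by simp
  qed
  then have "lie (E i) (E j) x = (\<Sum>k<CARD('n). - ceval2 (ext_d (\<omega>s ! k)) x (E i x) (E j x) *s E k x)"
    using complete[OF x, of "lie (E i) (E j) x"] by simp
  then have "vder (lie (E i) (E j)) f x = (\<Sum>k<CARD('n). - ceval2 (ext_d (\<omega>s ! k)) x (E i x) (E j x) * vder (E k) f x)"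
    by (rule vder_field_eq)
  then show ?thesis
    using vder_lie[OF U x E[OF i] E[OF j] f] by (simp add: sum_negf)
qed

section \<open>The Levi-Civita connection pulled back along a map\<close>

text \<open>Frame indices have type \<open>4\<close>. The index \<open>st a\<close> is the one paired with \<open>a\<close> by the metric
  \<open>2 \<theta>\<^sup>1 \<theta>\<^sup>2 + 2 \<theta>\<^sup>3 \<theta>\<^sup>4\<close>, so raising and lowering an index amounts to applying \<open>st\<close>.\<close>

definition st :: "4 \<Rightarrow> 4" where
  "st a = (if a = 1 then 2 else if a = 2 then 1 else if a = 3 then 4 else 3)"

lemma st_simps [simp]: "st 1 = 2" "st 2 = 1" "st 3 = 4" "st 4 = 3"
  by (simp_all add: st_def)

lemma st_st [simp]: "st (st a) = a"
  using exhaust_4[of a] by auto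

lemma st_inj [simp]: "st a = st b \<longleftrightarrow> a = b"
  by (metis st_st)

definition eta :: "4 \<Rightarrow> 4 \<Rightarrow> complex" where
  "eta a b = (if b = st a then 1 else 0)"

lemma eta_sym: "eta a b = eta b a"
  by (auto simp: eta_def)

lemma sum_eta: "(\<Sum>c\<in>UNIV. f c * eta c a) = f (st a)" "(\<Sum>c\<in>UNIV. f c * eta a c) = f (st a)"
  by (simp_all add: eta_sym[of _ a]) (simp_all add: eta_def if_distrib cong: if_cong)

lemma sum_rotate:
  "(\<Sum>i\<in>A. \<Sum>j\<in>B. \<Sum>d\<in>D. f i j d) = (\<Sum>d\<in>D. \<Sum>i\<in>A. \<Sum>j\<in>B. f i j d)"
proof -
  have "(\<Sum>i\<in>A. \<Sum>j\<in>B. \<Sum>d\<in>D. f i j d) = (\<Sum>i\<in>A. \<Sum>d\<in>D. \<Sum>j\<in>B. f i j d)"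
    by (intro sum.cong refl sum.swap)
  then show ?thesis by (simp only: sum.swap[of _ A D])
qed

lemma pd_cong:
  assumes "open U" "y \<in> U" and eq: "\<And>z. z \<in> U \<Longrightarrow> f z = h z"
  shows "pd k f y = pd k h y"
proof -
  have "(f has_derivative D) (at y) \<longleftrightarrow> (h has_derivative D) (at y)" for D
  proof
    show "(h has_derivative D) (at y)" if "(f has_derivative D) (at y)"
      by (rule has_derivative_transform_within_open[OF that assms(1,2) eq])
    show "(f has_derivative D) (at y)" if "(h has_derivative D) (at y)"
      by (rule has_derivative_transform_within_open[OF that assms(1,2) eq[symmetric]])
  qed
  then show ?thesis unfolding pd_def frechet_derivative_def by simp
qed

locale smooth_metric =
  fixes M :: "(real^4) set" and g :: "real^4 \<Rightarrow> real^4^4"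
  assumes open_M: "open M" and g: "smooth_map_on M g"
    and g_sym: "\<And>y i j. y \<in> M \<Longrightarrow> g y $ i $ j = g y $ j $ i"
    and g_inv: "\<And>y. y \<in> M \<Longrightarrow> invertible (g y)"
begin

lemma smooth_g: "smooth_map_on M (\<lambda>y. g y $ i $ j)"
  by (intro smooth_nth[OF open_M] g)

lemma smooth_ginv: "smooth_map_on M (\<lambda>y. ginv g y i j)"
  unfolding ginv_def by (rule smooth_matrix_inv[OF open_M smooth_g g_inv])

lemma smooth_pd: "smooth_map_on M f \<Longrightarrow> smooth_map_on M (pd k f)"
  unfolding pd_def[abs_def] by (rule smooth_frechet)

lemma smooth_halve: "smooth_map_on M f \<Longrightarrow> smooth_map_on M (\<lambda>y. f y / c)" for f :: "real^4 \<Rightarrow> real"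
  using smooth_mult[OF open_M _ smooth_const[of M "inverse c"]] by (simp add: divide_inverse)

lemmas smooth_M = smooth_sum[OF open_M] smooth_add[OF open_M] smooth_diff[OF open_M]
  smooth_mult[OF open_M] smooth_pd smooth_g smooth_ginv smooth_halve

lemma smooth_christoffel: "smooth_map_on M (\<lambda>y. christoffel g y i j k)"
  unfolding christoffel_def by (intro smooth_M)

lemma smooth_riemann_up: "smooth_map_on M (\<lambda>y. riemann_up g y i j k l)"
  unfolding riemann_up_def by (intro smooth_M smooth_christoffel)

lemma smooth_ricci: "smooth_map_on M (\<lambda>y. ricci g y i j)"
  unfolding ricci_def by (intro smooth_M smooth_riemann_up)

lemma smooth_weyl: "smooth_map_on M (\<lambda>y. weyl g y i j k l)"
  unfolding weyl_def riemann_def scalar_curv_def by (intro smooth_M smooth_riemann_up smooth_ricci)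

lemma smooth_cov_deriv:
  assumes "\<And>is. smooth_map_on M (\<lambda>y. T y is)"
  shows "smooth_map_on M (\<lambda>y. cov_deriv g T y is)"
  unfolding cov_deriv_def by (intro smooth_M smooth_christoffel assms)

lemma g_ginv:
  assumes "y \<in> M"
  shows "(\<Sum>j\<in>UNIV. g y $ i $ j * ginv g y j k) = (if i = k then 1 else 0)"
proof -
  have "(g y ** matrix_inv (g y)) $ i $ k = (mat 1 :: real^4^4) $ i $ k"
    by (simp only: matrix_inv_inverse(1)[OF g_inv[OF assms]])
  then show ?thesis by (simp add: matrix_matrix_mult_def mat_def ginv_def)
qed

lemma christoffel_sym:
  assumes "y \<in> M"
  shows "christoffel g y i j k = christoffel g y i k j"
proof -
  have "pd l (\<lambda>y. g y $ j $ k) y = pd l (\<lambda>y. g y $ k $ j) y" for l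
    by (rule pd_cong[OF open_M assms]) (rule g_sym)
  then show ?thesis unfolding christoffel_def by (simp add: add.commute)
qed

lemma christoffel_lower:
  assumes "y \<in> M"
  shows "(\<Sum>i\<in>UNIV. g y $ m $ i * christoffel g y i j k)
    = (pd j (\<lambda>y. g y $ m $ k) y + pd k (\<lambda>y. g y $ m $ j) y - pd m (\<lambda>y. g y $ j $ k) y) / 2"
proof -
  let ?t = "\<lambda>l. pd j (\<lambda>y. g y $ l $ k) y + pd k (\<lambda>y. g y $ l $ j) y - pd l (\<lambda>y. g y $ j $ k) y"
  have "(\<Sum>i\<in>UNIV. g y $ m $ i * christoffel g y i j k)
      = (\<Sum>i\<in>UNIV. \<Sum>l\<in>UNIV. g y $ m $ i * ginv g y i l * ?t l) / 2"
    by (simp add: christoffel_def sum_distrib_left sum_divide_distrib mult.assoc)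
  also have "(\<Sum>i\<in>UNIV. \<Sum>l\<in>UNIV. g y $ m $ i * ginv g y i l * ?t l)
      = (\<Sum>l\<in>UNIV. (\<Sum>i\<in>UNIV. g y $ m $ i * ginv g y i l) * ?t l)"
    by (subst sum.swap) (simp only: sum_distrib_right)
  also have "\<dots> = (\<Sum>l\<in>UNIV. (if m = l then ?t l else 0))"
    unfolding g_ginv[OF assms] by (intro sum.cong) auto
  finally show ?thesis by simp
qed

text \<open>Metric compatibility of the Christoffel symbols: of the six terms in the two lowered
  symbols, four cancel by the symmetry of \<open>g\<close> and the other two agree.\<close>

lemma pd_g:
  assumes "y \<in> M"
  shows "pd k (\<lambda>y. g y $ i $ j) y
    = (\<Sum>m\<in>UNIV. christoffel g y m k i * g y $ m $ j + christoffel g y m k j * g y $ i $ m)"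
proof -
  have sym: "pd l (\<lambda>y. g y $ a $ b) y = pd l (\<lambda>y. g y $ b $ a) y" for l a b
    by (rule pd_cong[OF open_M assms]) (rule g_sym)
  have "(\<Sum>m\<in>UNIV. christoffel g y m k i * g y $ m $ j + christoffel g y m k j * g y $ i $ m)
    = (\<Sum>m\<in>UNIV. g y $ j $ m * christoffel g y m k i) + (\<Sum>m\<in>UNIV. g y $ i $ m * christoffel g y m k j)"
    by (simp add: sum.distrib mult.commute g_sym[OF assms, of _ j])
  then show ?thesis
    unfolding christoffel_lower[OF assms] by (simp add: sym[of k j i] sym[of i j k] sym[of j k i] add_divide_distrib diff_divide_distrib)
qed

end

text \<open>Recursion on the first index matches \<open>cov_deriv_Cons\<close>, so covariant
  derivatives of all ranks can be treated by one induction on the index list.\<close>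

primrec frame_comp :: "(4 \<Rightarrow> 4 \<Rightarrow> complex) \<Rightarrow> (4 list \<Rightarrow> complex) \<Rightarrow> 4 list \<Rightarrow> complex" where
  "frame_comp e T [] = T []"
| "frame_comp e T (a # as) = (\<Sum>i\<in>UNIV. e a i * frame_comp e (\<lambda>is. T (i # is)) as)"

lemma frame_comp_diff:
  "frame_comp e (\<lambda>is. T is - T' is) as = frame_comp e T as - frame_comp e T' as"
  by (induction as arbitrary: T T') (simp_all add: right_diff_distrib sum_subtractf)

lemma frame_comp_sum:
  "frame_comp e (\<lambda>is. \<Sum>m\<in>UNIV. c m * T m is) as = (\<Sum>m\<in>(UNIV::4 set). c m * frame_comp e (T m) as)"
proof (induction as arbitrary: T)
  case (Cons a as)
  have "frame_comp e (\<lambda>is. \<Sum>m\<in>UNIV. c m * T m is) (a # as)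
      = (\<Sum>i\<in>UNIV. \<Sum>m\<in>UNIV. e a i * (c m * frame_comp e (\<lambda>is. T m (i # is)) as))"
    by (simp only: frame_comp.simps Cons.IH sum_distrib_left)
  also have "\<dots> = (\<Sum>m\<in>UNIV. \<Sum>i\<in>UNIV. e a i * (c m * frame_comp e (\<lambda>is. T m (i # is)) as))"
    by (rule sum.swap)
  finally show ?case by (simp add: sum_distrib_left mult.left_commute)
qed simp

text \<open>The index \<open>j\<close> can be frozen as a parameter, lowering the rank by one, if
  its own Christoffel term is split off.\<close>

lemma cov_deriv_Cons:
  "cov_deriv g T x (i # j # is) = cov_deriv g (\<lambda>y is. T y (j # is)) x (i # is)
     - (\<Sum>m\<in>UNIV. christoffel g x m i j * T x (m # is))"
  by (simp add: cov_deriv_def sum.lessThan_Suc_shift del: sum.lessThan_Suc)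

text \<open>\<open>X\<close> consists of vector fields on \<open>P\<close>, a space larger than \<open>M\<close>, whose images \<open>E a\<close> under \<open>q\<close>
  form a null frame of \<open>g\<close> up to the factor \<open>F\<close>. Since \<open>E a\<close> varies along the
  fibres of \<open>q\<close>, the vertical parts of the commutators of the \<open>X a\<close> contribute the terms \<open>v\<close>.\<close>

locale conformal_frame = smooth_metric M g
  for M :: "(real^4) set" and g :: "real^4 \<Rightarrow> real^4^4" +
  fixes P :: "(real^'n) set" and q :: "real^'n \<Rightarrow> real^4"
    and X :: "4 \<Rightarrow> real^'n \<Rightarrow> complex^'n" and E :: "4 \<Rightarrow> 4 \<Rightarrow> real^'n \<Rightarrow> complex"
    and F :: "real^'n \<Rightarrow> complex" and C :: "4 \<Rightarrow> 4 \<Rightarrow> 4 \<Rightarrow> complex"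
    and w :: "4 \<Rightarrow> 4 \<Rightarrow> 4 \<Rightarrow> real^'n \<Rightarrow> complex" and v :: "4 \<Rightarrow> 4 \<Rightarrow> 4 \<Rightarrow> 4 \<Rightarrow> real^'n \<Rightarrow> complex"
  assumes E_def: "\<And>a i. E a i = vder (X a) (\<lambda>x. of_real (q x $ i))"
    and open_P: "open P" and q: "smooth_map_on P q" "q ` P \<subseteq> M"
    and X: "\<And>a. smooth_field P (X a)"
    and F: "smooth_map_on P F" "\<And>x. x \<in> P \<Longrightarrow> F x \<noteq> 0"
    and metric: "\<And>a b x. x \<in> P \<Longrightarrow>
      (\<Sum>i\<in>UNIV. \<Sum>j\<in>UNIV. E a i x * E b j x * of_real (g (q x) $ i $ j)) = F x * eta a b"
    and torsion: "\<And>a b i x. x \<in> P \<Longrightarrow>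
      vder (X a) (E b i) x - vder (X b) (E a i) x = (\<Sum>c\<in>UNIV. C a b c * E c i x)"
    and w: "\<And>a b c. smooth_map_on P (w a b c)"
    and w_torsion: "\<And>a b c x. x \<in> P \<Longrightarrow> w a b c x - w b a c x = C a b c"
    and w_metric: "\<And>a b c x. x \<in> P \<Longrightarrow> F x * (w a b (st c) x + w a c (st b) x) = vder (X a) F x * eta b c"
    and bracket: "\<And>a b c i x. x \<in> P \<Longrightarrow>
      vder (X a) (vder (X b) (E c i)) x - vder (X b) (vder (X a) (E c i)) x
        = (\<Sum>d\<in>UNIV. C a b d * vder (X d) (E c i) x) + (\<Sum>d\<in>UNIV. v a b c d x * E d i x)"
begin

lemma qM: "x \<in> P \<Longrightarrow> q x \<in> M"
  using q(2) by blast

lemma smooth_E: "smooth_map_on P (E a i)"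
  unfolding E_def by (intro smooth_vder[OF open_P X] smooth_of_real[OF open_P] smooth_nth[OF open_P] q)

lemma smooth_pullback: "smooth_map_on M h \<Longrightarrow> smooth_map_on P (\<lambda>x. complex_of_real (h (q x)))"
  by (intro smooth_of_real[OF open_P] smooth_compose[OF open_P q(2,1)])

lemma chain:
  assumes "x \<in> P" "smooth_map_on M h"
  shows "vder (X a) (\<lambda>x. of_real (h (q x))) x = (\<Sum>i\<in>UNIV. E a i x * of_real (pd i h (q x)))"
  unfolding E_def by (rule vder_chain[OF q(1) assms(1,2) qM[OF assms(1)]])

lemmas smooth_P = smooth_sum[OF open_P] smooth_add[OF open_P] smooth_diff[OF open_P]
  smooth_mult[OF open_P] smooth_E w

text \<open>The connection form of the Levi-Civita connection in the coordinate frame, evaluated on \<open>X a\<close>.\<close>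

definition A :: "4 \<Rightarrow> 4 \<Rightarrow> 4 \<Rightarrow> real^'n \<Rightarrow> complex" where
  "A a i k x = (\<Sum>j\<in>UNIV. E a j x * of_real (christoffel g (q x) i j k))"

lemma smooth_A: "smooth_map_on P (A a i k)"
  unfolding A_def[abs_def] by (intro smooth_P smooth_pullback smooth_christoffel)

text \<open>The coframe dual to \<open>E\<close>. As \<open>eta\<close> is its own inverse, it is
  obtained by lowering the paired vector with \<open>g\<close> and dividing by
  \<open>F\<close>.\<close>

definition coE :: "4 \<Rightarrow> 4 \<Rightarrow> real^'n \<Rightarrow> complex" where
  "coE a i x = (\<Sum>j\<in>UNIV. E (st a) j x * of_real (g (q x) $ i $ j)) / F x"

lemma E_coE:
  assumes x: "x \<in> P"
  shows "(\<Sum>i\<in>UNIV. E b i x * coE a i x) = (if a = b then 1 else 0)"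
proof -
  have "(\<Sum>i\<in>UNIV. E b i x * coE a i x)
    = (\<Sum>i\<in>UNIV. \<Sum>j\<in>UNIV. E b i x * E (st a) j x * of_real (g (q x) $ i $ j)) / F x"
    by (simp add: coE_def sum_distrib_left sum_divide_distrib mult.assoc)
  then show ?thesis using metric[OF x, of b "st a"] F(2)[OF x] by (auto simp: eta_def)
qed

text \<open>\<open>E_coE\<close> makes one square matrix a one-sided inverse of the other, hence a
  two-sided one.\<close>

lemma coE_E:
  assumes x: "x \<in> P"
  shows "(\<Sum>a\<in>UNIV. coE a i x * E a j x) = (if i = j then 1 else 0)"
proof -
  let ?A = "\<chi> b i. E b i x" and ?B = "\<chi> i a. coE a i x"
  have "?A ** ?B = mat 1"
    by (auto simp: vec_eq_iff matrix_matrix_mult_def mat_def E_coE[OF x])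
  then have "?B ** ?A = mat 1" by (simp add: matrix_left_right_inverse)
  then show ?thesis by (simp add: vec_eq_iff matrix_matrix_mult_def mat_def)
qed

lemma frame_nondegenerate:
  assumes x: "x \<in> P" and V: "\<And>c. (\<Sum>i\<in>UNIV. V i * coE c i x) = 0"
  shows "V i = 0"
proof -
  have "(\<Sum>c\<in>UNIV. (\<Sum>j\<in>UNIV. V j * coE c j x) * E c i x) = (\<Sum>c\<in>UNIV. \<Sum>j\<in>UNIV. V j * (coE c j x * E c i x))"
    by (simp add: sum_distrib_right mult.assoc)
  also have "\<dots> = (\<Sum>j\<in>UNIV. V j * (\<Sum>c\<in>UNIV. coE c j x * E c i x))"
    by (subst sum.swap) (simp only: sum_distrib_left)
  also have "\<dots> = V i"
    unfolding coE_E[OF x] by (simp add: if_distrib cong: if_cong)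
  finally show ?thesis using V by simp
qed

lemma vder_g:
  assumes x: "x \<in> P"
  shows "vder (X a) (\<lambda>x. of_real (g (q x) $ i $ j)) x
    = (\<Sum>m\<in>UNIV. A a m i x * of_real (g (q x) $ m $ j) + A a m j x * of_real (g (q x) $ i $ m))"
proof -
  have "vder (X a) (\<lambda>x. of_real (g (q x) $ i $ j)) x
    = (\<Sum>k\<in>UNIV. \<Sum>m\<in>UNIV. E a k x * of_real (christoffel g (q x) m k i * g (q x) $ m $ j
        + christoffel g (q x) m k j * g (q x) $ i $ m))"
    by (simp add: chain[OF x smooth_g] pd_g[OF qM[OF x]] sum_distrib_left)
  also have "\<dots> = (\<Sum>m\<in>UNIV. \<Sum>k\<in>UNIV. E a k x * of_real (christoffel g (q x) m k i * g (q x) $ m $ j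
        + christoffel g (q x) m k j * g (q x) $ i $ m))"
    by (rule sum.swap)
  finally show ?thesis
    by (simp add: A_def sum_distrib_left sum_distrib_right distrib_left sum.distrib mult_ac)
qed

text \<open>The usual uniqueness argument for the Levi-Civita connection: the difference of two candidates
  is symmetric in its first two and skew in its last two indices.\<close>

lemma connection:
  assumes x: "x \<in> P"
  shows "vder (X a) (E b i) x = (\<Sum>c\<in>UNIV. w a b c x * E c i x) - (\<Sum>k\<in>UNIV. A a i k x * E b k x)"
proof -
  define G where "G i j = complex_of_real (g (q x) $ i $ j)" for i j
  have Gsym: "G i j = G j i" for i j using g_sym[OF qM[OF x]] by (simp add: G_def)
  \<comment> \<open>\<open>K a b\<close> is the covariant derivative of \<open>E b\<close> along
    \<open>X a\<close>; \<open>low\<close> is the same with its index lowered and evaluated on the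
    frame.\<close>
  define K where "K a b i = vder (X a) (E b i) x + (\<Sum>k\<in>UNIV. A a i k x * E b k x)" for a b i
  define low where "low a b c = (\<Sum>i\<in>UNIV. \<Sum>j\<in>UNIV. K a b i * E c j x * G i j)" for a b c
  have met: "(\<Sum>i\<in>UNIV. \<Sum>j\<in>UNIV. E a i x * E b j x * G i j) = F x * eta a b" for a b
    using metric[OF x] by (simp add: G_def)
  have K_sym: "K a b i - K b a i = (\<Sum>c\<in>UNIV. C a b c * E c i x)" for a b i
  proof -
    have "(\<Sum>k\<in>UNIV. A a i k x * E b k x) = (\<Sum>k\<in>UNIV. A b i k x * E a k x)"
    proof -
      have "(\<Sum>k\<in>UNIV. A a i k x * E b k x)
        = (\<Sum>k\<in>UNIV. \<Sum>j\<in>UNIV. E a j x * E b k x * of_real (christoffel g (q x) i j k))"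
        by (simp add: A_def sum_distrib_left sum_distrib_right mult_ac)
      also have "\<dots> = (\<Sum>k\<in>UNIV. \<Sum>j\<in>UNIV. E a k x * E b j x * of_real (christoffel g (q x) i k j))"
        by (rule sum.swap)
      also have "\<dots> = (\<Sum>k\<in>UNIV. A b i k x * E a k x)"
        by (simp add: A_def sum_distrib_left sum_distrib_right mult_ac christoffel_sym[OF qM[OF x], of i])
      finally show ?thesis .
    qed
    then show ?thesis using torsion[OF x, of a b i] by (simp add: K_def)
  qed
  have low_sym: "low a b c - low b a c = F x * C a b (st c)" for a b c
  proof -
    have "low a b c - low b a c = (\<Sum>i\<in>UNIV. \<Sum>j\<in>UNIV. (K a b i - K b a i) * E c j x * G i j)"
      by (simp add: low_def sum_subtractf[symmetric] left_diff_distrib)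
    also have "\<dots> = (\<Sum>i\<in>UNIV. \<Sum>j\<in>UNIV. \<Sum>d\<in>UNIV. C a b d * (E d i x * E c j x * G i j))"
      unfolding K_sym by (simp add: sum_distrib_right mult.assoc)
    also have "\<dots> = (\<Sum>d\<in>UNIV. \<Sum>i\<in>UNIV. \<Sum>j\<in>UNIV. C a b d * (E d i x * E c j x * G i j))"
      by (rule sum_rotate)
    also have "\<dots> = (\<Sum>d\<in>UNIV. C a b d * (F x * eta d c))"
      unfolding met[symmetric] by (simp only: sum_distrib_left)
    also have "\<dots> = F x * (\<Sum>d\<in>UNIV. C a b d * eta d c)"
      by (simp add: sum_distrib_left mult_ac)
    finally show ?thesis by (simp only: sum_eta)
  qed
  \<comment> \<open>Compatibility with the metric, obtained by differentiating the relation
    \<open>metric\<close> along \<open>X a\<close>.\<close>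
  have low_skew: "low a b c + low a c b = vder (X a) F x * eta b c" for a b c
  proof -
    let ?g = "\<lambda>i j x. complex_of_real (g (q x) $ i $ j)"
    have sg: "smooth_map_on P (?g i j)" for i j by (intro smooth_pullback smooth_g)
    have "vder (X a) F x * eta b c = vder (X a) (\<lambda>x. eta b c * F x) x"
      by (simp add: vder_cmult[OF x F(1)])
    also have "\<dots> = vder (X a) (\<lambda>x. \<Sum>i\<in>UNIV. \<Sum>j\<in>UNIV. E b i x * E c j x * ?g i j x) x"
      by (rule vder_cong[OF open_P x]) (simp only: metric mult.commute[of "eta b c"])
    also have "\<dots> = (\<Sum>i\<in>UNIV. \<Sum>j\<in>UNIV. vder (X a) (\<lambda>x. E b i x * E c j x * ?g i j x) x)"
      using vder_sum[OF open_P x] by (simp add: vder_sum[OF open_P x] smooth_P sg)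
    also have "\<dots> = (\<Sum>i\<in>UNIV. \<Sum>j\<in>UNIV. (vder (X a) (E b i) x * E c j x + E b i x * vder (X a) (E c j) x) * G i j
       + E b i x * E c j x * (\<Sum>m\<in>UNIV. A a m i x * G m j + A a m j x * G i m))"
      by (intro sum.cong refl)
        (simp only: vder_mult[OF x smooth_mult[OF open_P smooth_E smooth_E] sg]
          vder_mult[OF x smooth_E smooth_E] vder_g[OF x] G_def)
    also have "\<dots> = low a b c + low a c b"
      unfolding low_def K_def sum_4 using Gsym[of 2 1] Gsym[of 3 1] Gsym[of 4 1] Gsym[of 3 2] Gsym[of 4 2] Gsym[of 4 3]
      by (simp add: algebra_simps)
    finally show ?thesis by simp
  qed
  define \<Delta> where "\<Delta> a b c = low a b c - F x * w a b (st c) x" for a b c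
  have \<Delta>_sym: "\<Delta> a b c = \<Delta> b a c" for a b c
  proof -
    have "F x * w a b (st c) x - F x * w b a (st c) x = F x * C a b (st c)"
      by (simp only: right_diff_distrib[symmetric] w_torsion[OF x])
    then show ?thesis using low_sym[of a b c] by (simp add: \<Delta>_def algebra_simps)
  qed
  have \<Delta>_skew: "\<Delta> a b c = - \<Delta> a c b" for a b c
  proof -
    have "F x * w a b (st c) x + F x * w a c (st b) x = low a b c + low a c b"
      by (simp only: distrib_left[symmetric] w_metric[OF x] low_skew)
    then show ?thesis by (simp add: \<Delta>_def algebra_simps)
  qed
  have \<Delta>0: "\<Delta> a b c = 0" for a b c
  proof -
    \<comment> \<open>Using symmetry and skewness in turn, six exchanges lead back to the same
      indices and three of them change the sign.\<close>
    have "\<Delta> a b c = - \<Delta> a b c"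
      using \<Delta>_sym[of a b c] \<Delta>_skew[of b a c] \<Delta>_sym[of b c a] \<Delta>_skew[of c b a] \<Delta>_sym[of c a b] \<Delta>_skew[of a c b]
      by simp
    then show ?thesis by simp
  qed
  have "K a b i - (\<Sum>c\<in>UNIV. w a b c x * E c i x) = 0"
  proof (rule frame_nondegenerate[OF x, where V = "\<lambda>i. K a b i - (\<Sum>c\<in>UNIV. w a b c x * E c i x)"])
    fix c
    have "(\<Sum>i\<in>UNIV. K a b i * coE c i x) = low a b (st c) / F x"
      by (simp add: coE_def low_def G_def sum_distrib_left sum_divide_distrib mult.assoc)
    also have "\<dots> = w a b c x" using \<Delta>0[of a b "st c"] F(2)[OF x] by (simp add: \<Delta>_def)
    finally have 1: "(\<Sum>i\<in>UNIV. K a b i * coE c i x) = w a b c x" .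
    have "(\<Sum>i\<in>UNIV. (\<Sum>d\<in>UNIV. w a b d x * E d i x) * coE c i x)
        = (\<Sum>d\<in>UNIV. w a b d x * (\<Sum>i\<in>UNIV. E d i x * coE c i x))"
      by (simp add: sum_distrib_left sum_distrib_right mult.assoc) (rule sum.swap)
    also have "\<dots> = w a b c x"
      unfolding E_coE[OF x] by (simp add: if_distrib cong: if_cong)
    finally show "(\<Sum>i\<in>UNIV. (K a b i - (\<Sum>c\<in>UNIV. w a b c x * E c i x)) * coE c i x) = 0"
      using 1 by (simp add: left_diff_distrib sum_subtractf)
  qed
  then show ?thesis by (simp add: K_def algebra_simps)
qed

end

section \<open>Curvature and covariant derivatives in the frame\<close>

lemma sum_swap_two:
  fixes f :: "4 \<Rightarrow> 4 \<Rightarrow> 'a::comm_monoid_add"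
  shows "(\<Sum>i\<in>UNIV. \<Sum>j\<in>UNIV. f i j) = (\<Sum>j\<in>UNIV. \<Sum>i\<in>UNIV. f i j)"
  by (rule sum.swap)

context conformal_frame
begin

text \<open>Component \<open>e\<close> of the curvature of the plane of \<open>X a\<close> and
  \<open>X b\<close> acting on \<open>E c\<close>. The term \<open>v\<close> removes the action on
  \<open>E c\<close> of the vertical part of the bracket, which has no counterpart on
  \<open>M\<close>.\<close>

definition Rm :: "4 \<Rightarrow> 4 \<Rightarrow> 4 \<Rightarrow> 4 \<Rightarrow> real^'n \<Rightarrow> complex" where
  "Rm a b c e x = vder (X a) (w b c e) x - vder (X b) (w a c e) x
     + (\<Sum>d\<in>UNIV. w b c d x * w a d e x - w a c d x * w b d e x)
     - (\<Sum>d\<in>UNIV. C a b d * w d c e x) - v a b c e x"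

lemma vder_A:
  assumes x: "x \<in> P"
  shows "vder (X a) (A b i k) x = (\<Sum>j\<in>UNIV. vder (X a) (E b j) x * of_real (christoffel g (q x) i j k)
    + E b j x * (\<Sum>l\<in>UNIV. E a l x * of_real (pd l (\<lambda>y. christoffel g y i j k) (q x))))"
proof -
  let ?G = "\<lambda>j x. complex_of_real (christoffel g (q x) i j k)"
  have G: "smooth_map_on P (?G j)" for j by (intro smooth_pullback smooth_christoffel)
  have "vder (X a) (A b i k) x = (\<Sum>j\<in>UNIV. vder (X a) (\<lambda>x. E b j x * ?G j x) x)"
    unfolding A_def[abs_def] by (rule vder_sum[OF open_P x]) (intro smooth_mult[OF open_P] smooth_E G)
  then show ?thesis
    by (simp only: vder_mult[OF x smooth_E G] chain[OF x smooth_christoffel])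
qed

text \<open>The curvature form of the pulled-back coordinate connection. Derivatives of
  \<open>E\<close> occur only in the combination given by \<open>torsion\<close> and cancel the
  terms with \<open>C\<close>; vertical parts of brackets do not contribute because \<open>A\<close>
  depends on a field through its image in \<open>M\<close>.\<close>

lemma curvature_A:
  assumes x: "x \<in> P"
  shows "vder (X a) (A b i k) x - vder (X b) (A a i k) x
      + (\<Sum>m\<in>UNIV. A a i m x * A b m k x - A b i m x * A a m k x) - (\<Sum>d\<in>UNIV. C a b d * A d i k x)
    = (\<Sum>l\<in>UNIV. \<Sum>j\<in>UNIV. E a l x * E b j x * of_real (riemann_up g (q x) i k l j))"
proof -
  define G where "G i j k = complex_of_real (christoffel g (q x) i j k)" for i j k
  define pG where "pG l i j k = complex_of_real (pd l (\<lambda>y. christoffel g y i j k) (q x))" for l i j k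
  define e where "e a i = E a i x" for a i
  define de where "de a b j = vder (X a) (E b j) x" for a b j
  have dA: "vder (X a) (A b i k) x = (\<Sum>j\<in>UNIV. de a b j * G i j k) + (\<Sum>j\<in>UNIV. \<Sum>l\<in>UNIV. e b j * e a l * pG l i j k)" for a b
    by (simp add: vder_A[OF x] G_def pG_def e_def de_def sum_distrib_left sum.distrib mult.assoc)
  have AG: "A a i k x = (\<Sum>j\<in>UNIV. e a j * G i j k)" for a i k
    by (simp add: A_def G_def e_def)
  have tor: "(\<Sum>j\<in>UNIV. de a b j * G i j k) - (\<Sum>j\<in>UNIV. de b a j * G i j k) = (\<Sum>d\<in>UNIV. C a b d * A d i k x)"
  proof -
    have "(\<Sum>j\<in>UNIV. de a b j * G i j k) - (\<Sum>j\<in>UNIV. de b a j * G i j k)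
        = (\<Sum>j\<in>UNIV. (\<Sum>d\<in>UNIV. C a b d * e d j) * G i j k)"
      unfolding e_def torsion[OF x, symmetric] by (simp add: de_def sum_subtractf left_diff_distrib)
    also have "\<dots> = (\<Sum>d\<in>UNIV. C a b d * A d i k x)"
      unfolding AG sum_distrib_left sum_distrib_right mult.assoc by (rule sum.swap)
    finally show ?thesis .
  qed
  have quad: "(\<Sum>m\<in>UNIV. A a i m x * A b m k x) = (\<Sum>l\<in>UNIV. \<Sum>j\<in>UNIV. e a l * e b j * (\<Sum>m\<in>UNIV. G i l m * G m j k))" for a b
  proof -
    have "(\<Sum>m\<in>UNIV. A a i m x * A b m k x) = (\<Sum>m\<in>UNIV. \<Sum>l\<in>UNIV. \<Sum>j\<in>UNIV. e a l * e b j * (G i l m * G m j k))"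
      unfolding AG sum_product by (simp add: mult_ac)
    also have "\<dots> = (\<Sum>l\<in>UNIV. \<Sum>j\<in>UNIV. \<Sum>m\<in>UNIV. e a l * e b j * (G i l m * G m j k))"
      by (rule sum_rotate[symmetric])
    finally show ?thesis by (simp only: sum_distrib_left)
  qed
  have riem: "complex_of_real (riemann_up g (q x) i k l j) = pG l i j k - pG j i l k
     + (\<Sum>m\<in>UNIV. G i l m * G m j k) - (\<Sum>m\<in>UNIV. G i j m * G m l k)" for l j
    by (simp add: riemann_up_def G_def pG_def sum_subtractf)
  have "(\<Sum>l\<in>UNIV. \<Sum>j\<in>UNIV. e a l * e b j * of_real (riemann_up g (q x) i k l j))
    = (\<Sum>l\<in>UNIV. \<Sum>j\<in>UNIV. e a l * e b j * pG l i j k) - (\<Sum>l\<in>UNIV. \<Sum>j\<in>UNIV. e a l * e b j * pG j i l k)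
     + (\<Sum>l\<in>UNIV. \<Sum>j\<in>UNIV. e a l * e b j * (\<Sum>m\<in>UNIV. G i l m * G m j k))
     - (\<Sum>l\<in>UNIV. \<Sum>j\<in>UNIV. e a l * e b j * (\<Sum>m\<in>UNIV. G i j m * G m l k))"
    unfolding riem distrib_left right_diff_distrib sum.distrib sum_subtractf by simp
  moreover have "(\<Sum>l\<in>UNIV. \<Sum>j\<in>UNIV. e a l * e b j * pG l i j k) = (\<Sum>j\<in>UNIV. \<Sum>l\<in>UNIV. e b j * e a l * pG l i j k)"
    by (subst sum_swap_two) (simp add: mult_ac)
  moreover have "(\<Sum>l\<in>UNIV. \<Sum>j\<in>UNIV. e a l * e b j * (\<Sum>m\<in>UNIV. G i j m * G m l k)) = (\<Sum>m\<in>UNIV. A b i m x * A a m k x)"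
    unfolding quad by (subst sum_swap_two) (simp only: mult.commute[of "e a _"])
  ultimately show ?thesis
    unfolding dA sum_subtractf e_def[symmetric] tor[symmetric] quad[of a b, symmetric] by simp
qed

text \<open>The commutator of two derivatives of \<open>E c\<close> is evaluated twice, by iterating
  \<open>connection\<close> and by \<open>bracket\<close>; the comparison relates the curvature of
  \<open>A\<close> to that of \<open>w\<close>.\<close>

lemma curvature:
  assumes x: "x \<in> P"
  shows "(\<Sum>k\<in>UNIV. \<Sum>l\<in>UNIV. \<Sum>j\<in>UNIV. E c k x * E a l x * E b j x * of_real (riemann_up g (q x) i k l j))
    = (\<Sum>e\<in>UNIV. Rm a b c e x * E e i x)"
proof -
  define D where "D a c i = (\<Sum>d\<in>UNIV. w a c d x * E d i x) - (\<Sum>k\<in>UNIV. A a i k x * E c k x)" for a c i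
  have conn: "vder (X a) (E c i) x = D a c i" for a c i
    unfolding D_def by (rule connection[OF x])
  have second: "vder (X a) (vder (X b) (E c i)) x
     = (\<Sum>d\<in>UNIV. vder (X a) (w b c d) x * E d i x + w b c d x * D a d i)
     - (\<Sum>k\<in>UNIV. vder (X a) (A b i k) x * E c k x + A b i k x * D a c k)" for a b
  proof -
    have 1: "smooth_map_on P (\<lambda>x. w b c d x * E d i x)" "smooth_map_on P (\<lambda>x. A b i d x * E c d x)" for d
      by (intro smooth_mult[OF open_P] w smooth_E smooth_A)+
    have "vder (X a) (vder (X b) (E c i)) x
      = vder (X a) (\<lambda>x. (\<Sum>d\<in>UNIV. w b c d x * E d i x) - (\<Sum>k\<in>UNIV. A b i k x * E c k x)) x"
      by (rule vder_cong[OF open_P x]) (rule connection)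
    also have "\<dots> = (\<Sum>d\<in>UNIV. vder (X a) (\<lambda>x. w b c d x * E d i x) x) - (\<Sum>k\<in>UNIV. vder (X a) (\<lambda>x. A b i k x * E c k x) x)"
      by (simp only: vder_diff[OF x smooth_sum[OF open_P 1(1)] smooth_sum[OF open_P 1(2)]] vder_sum[OF open_P x 1(1)] vder_sum[OF open_P x 1(2)])
    finally show ?thesis
      by (simp only: vder_mult[OF x w smooth_E] vder_mult[OF x smooth_A smooth_E] conn)
  qed
  define Q where "Q k = vder (X a) (A b i k) x - vder (X b) (A a i k) x
      + (\<Sum>m\<in>UNIV. A a i m x * A b m k x - A b i m x * A a m k x) - (\<Sum>d\<in>UNIV. C a b d * A d i k x)" for k
  have "(\<Sum>d\<in>UNIV. vder (X a) (w b c d) x * E d i x + w b c d x * D a d i)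
     - (\<Sum>k\<in>UNIV. vder (X a) (A b i k) x * E c k x + A b i k x * D a c k)
     - ((\<Sum>d\<in>UNIV. vder (X b) (w a c d) x * E d i x + w a c d x * D b d i)
     - (\<Sum>k\<in>UNIV. vder (X b) (A a i k) x * E c k x + A a i k x * D b c k))
     = (\<Sum>d\<in>UNIV. C a b d * D d c i) + (\<Sum>d\<in>UNIV. v a b c d x * E d i x)"
    using bracket[OF x, of a b c i] unfolding second conn .
  \<comment> \<open>Pure algebra: the products of \<open>w\<close> with \<open>A\<close> cancel in
    the commutator. The right side is the difference of the two sides of the preceding
    equation.\<close>
  moreover have "(\<Sum>k\<in>UNIV. Q k * E c k x) - (\<Sum>e\<in>UNIV. Rm a b c e x * E e i x) =
     (\<Sum>d\<in>UNIV. C a b d * D d c i) + (\<Sum>d\<in>UNIV. v a b c d x * E d i x)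
    - ((\<Sum>d\<in>UNIV. vder (X a) (w b c d) x * E d i x + w b c d x * D a d i)
     - (\<Sum>k\<in>UNIV. vder (X a) (A b i k) x * E c k x + A b i k x * D a c k)
     - ((\<Sum>d\<in>UNIV. vder (X b) (w a c d) x * E d i x + w a c d x * D b d i)
     - (\<Sum>k\<in>UNIV. vder (X b) (A a i k) x * E c k x + A a i k x * D b c k)))"
    unfolding Q_def Rm_def D_def sum_4 by (simp add: algebra_simps)
  ultimately have "(\<Sum>k\<in>UNIV. Q k * E c k x) = (\<Sum>e\<in>UNIV. Rm a b c e x * E e i x)" by simp
  moreover have "(\<Sum>k\<in>UNIV. Q k * E c k x)
    = (\<Sum>k\<in>UNIV. \<Sum>l\<in>UNIV. \<Sum>j\<in>UNIV. E c k x * E a l x * E b j x * of_real (riemann_up g (q x) i k l j))"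
    unfolding Q_def curvature_A[OF x] sum_distrib_right by (simp only: mult_ac)
  ultimately show ?thesis by simp
qed

definition frame_tensor :: "(real^4 \<Rightarrow> 4 list \<Rightarrow> real) \<Rightarrow> 4 list \<Rightarrow> real^'n \<Rightarrow> complex" where
  "frame_tensor T as x = frame_comp (\<lambda>a i. E a i x) (\<lambda>is. of_real (T (q x) is)) as"

lemma frame_tensor_Nil: "frame_tensor T [] x = of_real (T (q x) [])"
  by (simp add: frame_tensor_def)

lemma frame_tensor_Cons: "frame_tensor T (a # as) x = (\<Sum>i\<in>UNIV. E a i x * frame_tensor (\<lambda>y is. T y (i # is)) as x)"
  by (simp add: frame_tensor_def)

lemma smooth_frame_tensor: "(\<And>is. smooth_map_on M (\<lambda>y. T y is)) \<Longrightarrow> smooth_map_on P (frame_tensor T as)"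
proof (induction as arbitrary: T)
  case Nil
  then show ?case unfolding frame_tensor_Nil[abs_def] by (intro smooth_pullback)
next
  case (Cons a as)
  show ?case unfolding frame_tensor_Cons[abs_def]
    by (intro smooth_sum[OF open_P] smooth_mult[OF open_P] smooth_E Cons.IH Cons.prems)
qed

text \<open>In each slot the Christoffel term cancels the \<open>A\<close> term that
  \<open>connection\<close> produces when \<open>E\<close> is differentiated, and \<open>w\<close>
  remains. With an index frozen, \<open>T\<close> is no longer a tensor, but
  \<open>cov_deriv\<close> is a formula in components, so the induction hypothesis still
  applies.\<close>

lemma frame_tensor_cov_deriv:
  assumes x: "x \<in> P"
  shows "(\<And>is. smooth_map_on M (\<lambda>y. T y is)) \<Longrightarrow>
    frame_tensor (cov_deriv g T) (a # bs) x = vder (X a) (frame_tensor T bs) x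
      - (\<Sum>p<length bs. \<Sum>c\<in>UNIV. w a (bs ! p) c x * frame_tensor T (bs[p := c]) x)"
proof (induction bs arbitrary: T)
  case Nil
  have "frame_tensor (cov_deriv g T) [a] x = (\<Sum>i\<in>UNIV. E a i x * of_real (pd i (\<lambda>y. T y []) (q x)))"
    by (simp add: frame_tensor_Cons frame_tensor_Nil cov_deriv_def)
  then show ?case
    using chain[OF x Nil, of a "[]"] by (simp add: frame_tensor_Nil[abs_def])
next
  case (Cons b bs)
  let ?T = "\<lambda>j y is. T y (j # is)"
  have sT: "smooth_map_on P (frame_tensor (?T j) bs)" for j by (intro smooth_frame_tensor Cons.prems)
  have "frame_tensor (cov_deriv g T) (a # b # bs) x
    = (\<Sum>i\<in>UNIV. \<Sum>j\<in>UNIV. E a i x * (E b j x * (frame_tensor (\<lambda>y is. cov_deriv g (?T j) y (i # is)) bs x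
       - (\<Sum>m\<in>UNIV. of_real (christoffel g (q x) m i j) * frame_tensor (?T m) bs x))))"
    by (simp add: frame_tensor_def cov_deriv_Cons[abs_def] frame_comp_diff frame_comp_sum sum_distrib_left)
  also have "\<dots> = (\<Sum>i\<in>UNIV. \<Sum>j\<in>UNIV. E b j x * (E a i x * frame_tensor (\<lambda>y is. cov_deriv g (?T j) y (i # is)) bs x))
      - (\<Sum>i\<in>UNIV. \<Sum>j\<in>UNIV. \<Sum>m\<in>UNIV. E b j x * (E a i x * of_real (christoffel g (q x) m i j)) * frame_tensor (?T m) bs x)"
    by (simp add: right_diff_distrib sum_subtractf sum_distrib_left mult_ac)
  also have "(\<Sum>i\<in>UNIV. \<Sum>j\<in>UNIV. E b j x * (E a i x * frame_tensor (\<lambda>y is. cov_deriv g (?T j) y (i # is)) bs x))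
      = (\<Sum>j\<in>UNIV. E b j x * frame_tensor (cov_deriv g (?T j)) (a # bs) x)"
    by (subst sum_swap_two) (simp only: frame_tensor_Cons sum_distrib_left)
  also have "(\<Sum>i\<in>UNIV. \<Sum>j\<in>UNIV. \<Sum>m\<in>UNIV. E b j x * (E a i x * of_real (christoffel g (q x) m i j)) * frame_tensor (?T m) bs x)
      = (\<Sum>m\<in>UNIV. (\<Sum>j\<in>UNIV. A a m j x * E b j x) * frame_tensor (?T m) bs x)"
  proof -
    have "(\<Sum>i\<in>UNIV. \<Sum>j\<in>UNIV. \<Sum>m\<in>UNIV. E b j x * (E a i x * of_real (christoffel g (q x) m i j)) * frame_tensor (?T m) bs x)
      = (\<Sum>m\<in>UNIV. \<Sum>i\<in>UNIV. \<Sum>j\<in>UNIV. E b j x * (E a i x * of_real (christoffel g (q x) m i j)) * frame_tensor (?T m) bs x)"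
      by (rule sum_rotate)
    also have "\<dots> = (\<Sum>m\<in>UNIV. \<Sum>j\<in>UNIV. \<Sum>i\<in>UNIV. E b j x * (E a i x * of_real (christoffel g (q x) m i j)) * frame_tensor (?T m) bs x)"
      by (intro sum.cong refl sum_swap_two)
    finally show ?thesis by (simp add: A_def sum_distrib_left sum_distrib_right mult_ac)
  qed
  finally have L: "frame_tensor (cov_deriv g T) (a # b # bs) x = (\<Sum>j\<in>UNIV. E b j x * frame_tensor (cov_deriv g (?T j)) (a # bs) x)
      - (\<Sum>m\<in>UNIV. (\<Sum>j\<in>UNIV. A a m j x * E b j x) * frame_tensor (?T m) bs x)" .
  have IH: "frame_tensor (cov_deriv g (?T j)) (a # bs) x = vder (X a) (frame_tensor (?T j) bs) x
      - (\<Sum>p<length bs. \<Sum>c\<in>UNIV. w a (bs ! p) c x * frame_tensor (?T j) (bs[p := c]) x)" for j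
    by (rule Cons.IH) (rule Cons.prems)
  have "vder (X a) (frame_tensor T (b # bs)) x = (\<Sum>j\<in>UNIV. vder (X a) (\<lambda>x. E b j x * frame_tensor (?T j) bs x) x)"
    unfolding frame_tensor_Cons[abs_def] by (rule vder_sum[OF open_P x]) (intro smooth_mult[OF open_P] smooth_E sT)
  also have "\<dots> = (\<Sum>j\<in>UNIV. ((\<Sum>c\<in>UNIV. w a b c x * E c j x) - (\<Sum>k\<in>UNIV. A a j k x * E b k x)) * frame_tensor (?T j) bs x
      + E b j x * vder (X a) (frame_tensor (?T j) bs) x)"
    by (simp only: vder_mult[OF x smooth_E sT] connection[OF x])
  also have "\<dots> = (\<Sum>j\<in>UNIV. (\<Sum>c\<in>UNIV. w a b c x * E c j x) * frame_tensor (?T j) bs x)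
      - (\<Sum>j\<in>UNIV. (\<Sum>k\<in>UNIV. A a j k x * E b k x) * frame_tensor (?T j) bs x)
      + (\<Sum>j\<in>UNIV. E b j x * vder (X a) (frame_tensor (?T j) bs) x)"
    by (simp add: left_diff_distrib sum_subtractf sum.distrib)
  also have "(\<Sum>j\<in>UNIV. (\<Sum>c\<in>UNIV. w a b c x * E c j x) * frame_tensor (?T j) bs x) = (\<Sum>c\<in>UNIV. w a b c x * frame_tensor T (c # bs) x)"
    unfolding frame_tensor_Cons sum_distrib_left sum_distrib_right mult.assoc by (rule sum_swap_two)
  finally have V: "vder (X a) (frame_tensor T (b # bs)) x = (\<Sum>c\<in>UNIV. w a b c x * frame_tensor T (c # bs) x)
      - (\<Sum>j\<in>UNIV. (\<Sum>k\<in>UNIV. A a j k x * E b k x) * frame_tensor (?T j) bs x)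
      + (\<Sum>j\<in>UNIV. E b j x * vder (X a) (frame_tensor (?T j) bs) x)" .
  have "(\<Sum>j\<in>UNIV. E b j x * (\<Sum>p<length bs. \<Sum>c\<in>UNIV. w a (bs ! p) c x * frame_tensor (?T j) (bs[p := c]) x))
     = (\<Sum>p<length bs. \<Sum>c\<in>UNIV. \<Sum>j\<in>UNIV. E b j x * (w a (bs ! p) c x * frame_tensor (?T j) (bs[p := c]) x))"
    unfolding sum_distrib_left by (rule sum_rotate[symmetric])
  also have "\<dots> = (\<Sum>p<length bs. \<Sum>c\<in>UNIV. w a (bs ! p) c x * frame_tensor T (b # bs[p := c]) x)"
    unfolding frame_tensor_Cons by (simp add: sum_distrib_left mult_ac)
  finally have S: "(\<Sum>p<length (b # bs). \<Sum>c\<in>UNIV. w a ((b # bs) ! p) c x * frame_tensor T ((b # bs)[p := c]) x)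
     = (\<Sum>c\<in>UNIV. w a b c x * frame_tensor T (c # bs) x)
       + (\<Sum>j\<in>UNIV. E b j x * (\<Sum>p<length bs. \<Sum>c\<in>UNIV. w a (bs ! p) c x * frame_tensor (?T j) (bs[p := c]) x))"
    by (simp add: sum.lessThan_Suc_shift del: sum.lessThan_Suc)
  show ?case
    unfolding L V S IH by (simp add: right_diff_distrib sum_subtractf)
qed

end

section \<open>Ricci, Weyl and Bach tensors in the frame\<close>

text \<open>A version for functions of separate indices. \<open>frame4\<close> nests it, so that
  products of two-index tensors, as in the Weyl tensor, factor.\<close>

definition frame2 :: "(4 \<Rightarrow> 4 \<Rightarrow> complex) \<Rightarrow> (4 \<Rightarrow> 4 \<Rightarrow> complex) \<Rightarrow> 4 \<Rightarrow> 4 \<Rightarrow> complex" where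
  "frame2 e u a b = (\<Sum>i\<in>UNIV. e a i * (\<Sum>j\<in>UNIV. e b j * u i j))"

definition frame4 :: "(4 \<Rightarrow> 4 \<Rightarrow> complex) \<Rightarrow> (4 \<Rightarrow> 4 \<Rightarrow> 4 \<Rightarrow> 4 \<Rightarrow> complex) \<Rightarrow> 4 \<Rightarrow> 4 \<Rightarrow> 4 \<Rightarrow> 4 \<Rightarrow> complex" where
  "frame4 e u a b c d = frame2 e (\<lambda>i j. frame2 e (u i j) c d) a b"

lemma frame2_add: "frame2 e (\<lambda>i j. u i j + v i j) a b = frame2 e u a b + frame2 e v a b"
  and frame2_diff: "frame2 e (\<lambda>i j. u i j - v i j) a b = frame2 e u a b - frame2 e v a b"
  and frame2_cmult: "frame2 e (\<lambda>i j. k * u i j) a b = k * frame2 e u a b"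
  and frame2_divide: "frame2 e (\<lambda>i j. u i j / k) a b = frame2 e u a b / k"
  by (simp_all add: frame2_def distrib_left right_diff_distrib sum.distrib sum_subtractf sum_distrib_left
      sum_divide_distrib mult_ac)

lemma frame2_cmult_right: "frame2 e (\<lambda>i j. u i j * k) a b = frame2 e u a b * k"
  using frame2_cmult[of e k u a b] by (simp add: mult.commute)

lemma frame2_prod: "frame2 e (\<lambda>i j. u i * v j) a b = (\<Sum>i\<in>UNIV. e a i * u i) * (\<Sum>j\<in>UNIV. e b j * v j)"
proof -
  have "(\<Sum>j\<in>UNIV. e b j * (u i * v j)) = u i * (\<Sum>j\<in>UNIV. e b j * v j)" for i
    by (simp add: sum_distrib_left mult_ac)
  then show ?thesis by (simp only: frame2_def sum_distrib_right mult.assoc)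
qed

lemma frame4_prod:
  "frame4 e (\<lambda>i j k l. u i k * v j l) a b c d = frame2 e u a c * frame2 e v b d"
  "frame4 e (\<lambda>i j k l. u i l * v j k) a b c d = frame2 e u a d * frame2 e v b c"
proof -
  show "frame4 e (\<lambda>i j k l. u i k * v j l) a b c d = frame2 e u a c * frame2 e v b d"
    unfolding frame4_def frame2_prod by (simp add: frame2_def)
  have "frame2 e (\<lambda>k l. u i l * v j k) c d = (\<Sum>l\<in>UNIV. e d l * u i l) * (\<Sum>k\<in>UNIV. e c k * v j k)" for i j
    using frame2_prod[of e "v j" "u i" c d] by (simp add: mult.commute)
  then show "frame4 e (\<lambda>i j k l. u i l * v j k) a b c d = frame2 e u a d * frame2 e v b c"
    unfolding frame4_def by (simp only: frame2_prod) (simp add: frame2_def)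
qed

lemma frame4_add: "frame4 e (\<lambda>i j k l. u i j k l + v i j k l) a b c d = frame4 e u a b c d + frame4 e v a b c d"
  and frame4_diff: "frame4 e (\<lambda>i j k l. u i j k l - v i j k l) a b c d = frame4 e u a b c d - frame4 e v a b c d"
  and frame4_cmult: "frame4 e (\<lambda>i j k l. s * u i j k l) a b c d = s * frame4 e u a b c d"
  and frame4_divide: "frame4 e (\<lambda>i j k l. u i j k l / s) a b c d = frame4 e u a b c d / s"
  by (simp_all add: frame4_def frame2_add frame2_diff frame2_cmult frame2_divide)

text \<open>A single reindexing of an eightfold product in place of a chain of interchanges; the
  sums are those of the doubly contracted terms in the Bach tensor.\<close>

lemma sum8_reorder:
  fixes f :: "'i::finite \<Rightarrow> 'i \<Rightarrow> 'i \<Rightarrow> 'i \<Rightarrow> 'i \<Rightarrow> 'i \<Rightarrow> 'i \<Rightarrow> 'i \<Rightarrow> 'a::comm_monoid_add"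
  shows "(\<Sum>i\<in>UNIV. \<Sum>j\<in>UNIV. \<Sum>k\<in>UNIV. \<Sum>l\<in>UNIV. \<Sum>p\<in>UNIV. \<Sum>r\<in>UNIV. \<Sum>c\<in>UNIV. \<Sum>d\<in>UNIV. f c d p r i k j l)
    = (\<Sum>c\<in>UNIV. \<Sum>d\<in>UNIV. \<Sum>p\<in>UNIV. \<Sum>r\<in>UNIV. \<Sum>i\<in>UNIV. \<Sum>k\<in>UNIV. \<Sum>j\<in>UNIV. \<Sum>l\<in>UNIV. f c d p r i k j l)"
  unfolding sum.cartesian_product
  by (rule sum.reindex_bij_witness[where i = "\<lambda>(c, d, p, r, i, k, j, l). (i, j, k, l, p, r, c, d)"
        and j = "\<lambda>(i, j, k, l, p, r, c, d). (c, d, p, r, i, k, j, l)"]) auto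

context conformal_frame
begin

text \<open>By completeness of the frame the right side is a left inverse of \<open>g\<close>, hence
  equal to the right inverse \<open>ginv\<close>.\<close>

lemma ginv_frame:
  assumes x: "x \<in> P"
  shows "of_real (ginv g (q x) i j) = (\<Sum>a\<in>UNIV. E a i x * E (st a) j x) / F x"
proof -
  define G where "G i j = complex_of_real (g (q x) $ i $ j)" for i j
  define H where "H i j = (\<Sum>a\<in>UNIV. E a i x * E (st a) j x) / F x" for i j
  define K where "K i j = complex_of_real (ginv g (q x) i j)" for i j
  have HG: "(\<Sum>l\<in>UNIV. H i l * G k l) = (if k = i then 1 else 0)" for i k
  proof -
    have "(\<Sum>l\<in>UNIV. H i l * G k l) = (\<Sum>a\<in>UNIV. \<Sum>l\<in>UNIV. E a i x * E (st a) l x * G k l) / F x"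
      by (subst sum_swap_two) (simp add: H_def sum_divide_distrib sum_distrib_right)
    also have "\<dots> = (\<Sum>a\<in>UNIV. coE a k x * E a i x)"
      by (simp add: coE_def G_def sum_divide_distrib sum_distrib_left sum_distrib_right mult_ac)
    finally show ?thesis by (simp only: coE_E[OF x])
  qed
  have GK: "(\<Sum>k\<in>UNIV. G l k * K k j) = (if l = j then 1 else 0)" for l j
    using g_ginv[OF qM[OF x], of l j] unfolding G_def K_def
    by (metis (mono_tags, lifting) of_real_0 of_real_1 of_real_mult of_real_sum sum.cong)
  have "K i j = (\<Sum>k\<in>UNIV. (\<Sum>l\<in>UNIV. H i l * G k l) * K k j)"
    unfolding HG by (simp add: if_distrib[of "\<lambda>z. z * _"] cong: if_cong)
  also have "\<dots> = (\<Sum>l\<in>UNIV. H i l * (\<Sum>k\<in>UNIV. G l k * K k j))"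
    unfolding sum_distrib_left sum_distrib_right
    by (subst sum_swap_two) (simp add: G_def g_sym[OF qM[OF x], of _ "_::4"] mult.assoc)
  also have "\<dots> = H i j"
    unfolding GK by (simp add: if_distrib cong: if_cong)
  finally show ?thesis by (simp add: K_def H_def)
qed

abbreviation e_at :: "real^'n \<Rightarrow> 4 \<Rightarrow> 4 \<Rightarrow> complex" where
  "e_at x \<equiv> (\<lambda>a i. E a i x)"

lemma frame2_g: "x \<in> P \<Longrightarrow> frame2 (e_at x) (\<lambda>i j. of_real (g (q x) $ i $ j)) a b = F x * eta a b"
  using metric[of x a b] by (simp add: frame2_def sum_distrib_left mult.assoc)

text \<open>\<open>Rm\<close> lists the plane first, whence the change of order; lowering the upper
  index with \<open>F\<close> times \<open>eta\<close> gives the factor \<open>F\<close> and the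
  index \<open>st a\<close>.\<close>

lemma frame_riemann:
  assumes x: "x \<in> P"
  shows "frame4 (e_at x) (\<lambda>i j k l. of_real (riemann g (q x) i j k l)) a b c d = F x * Rm c d b (st a) x"
proof -
  let ?R = "\<lambda>m j k l. complex_of_real (riemann_up g (q x) m j k l)"
  let ?g = "\<lambda>i m. complex_of_real (g (q x) $ i $ m)"
  have inner: "(\<Sum>j\<in>UNIV. E b j x * frame2 (e_at x) (\<lambda>k l. ?R m j k l) c d) = (\<Sum>e\<in>UNIV. Rm c d b e x * E e m x)" for m
    unfolding curvature[OF x, symmetric] by (simp add: frame2_def sum_distrib_left mult.assoc)
  have "frame2 (e_at x) (\<lambda>k l. of_real (riemann g (q x) i j k l)) c d
      = (\<Sum>m\<in>UNIV. ?g i m * frame2 (e_at x) (\<lambda>k l. ?R m j k l) c d)" for i j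
  proof -
    have "frame2 (e_at x) (\<lambda>k l. of_real (riemann g (q x) i j k l)) c d
       = frame2 (e_at x) (\<lambda>k l. ?g i 1 * ?R 1 j k l + ?g i 2 * ?R 2 j k l + ?g i 3 * ?R 3 j k l + ?g i 4 * ?R 4 j k l) c d"
      by (simp add: riemann_def sum_4)
    then show ?thesis by (simp only: frame2_add frame2_cmult sum_4)
  qed
  then have "frame4 (e_at x) (\<lambda>i j k l. of_real (riemann g (q x) i j k l)) a b c d
     = (\<Sum>i\<in>UNIV. E a i x * (\<Sum>j\<in>UNIV. \<Sum>m\<in>UNIV. E b j x * (?g i m * frame2 (e_at x) (\<lambda>k l. ?R m j k l) c d)))"
    unfolding frame4_def by (simp add: frame2_def[of _ _ a b] sum_distrib_left)
  also have "\<dots> = (\<Sum>i\<in>UNIV. E a i x * (\<Sum>m\<in>UNIV. ?g i m * (\<Sum>j\<in>UNIV. E b j x * frame2 (e_at x) (\<lambda>k l. ?R m j k l) c d)))"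
    by (subst sum_swap_two) (simp add: sum_distrib_left mult_ac)
  also have "\<dots> = (\<Sum>i\<in>UNIV. \<Sum>m\<in>UNIV. \<Sum>e\<in>UNIV. Rm c d b e x * (E a i x * (E e m x * ?g i m)))"
    unfolding inner by (simp add: sum_distrib_left mult_ac)
  also have "\<dots> = (\<Sum>e\<in>UNIV. Rm c d b e x * frame2 (e_at x) ?g a e)"
    by (subst sum_rotate) (simp add: frame2_def sum_distrib_left)
  also have "\<dots> = F x * (\<Sum>e\<in>UNIV. Rm c d b e x * eta a e)"
    unfolding frame2_g[OF x] by (simp add: sum_distrib_left mult_ac)
  finally show ?thesis by (simp only: sum_eta)
qed

definition Ric :: "4 \<Rightarrow> 4 \<Rightarrow> real^'n \<Rightarrow> complex" where
  "Ric a b x = (\<Sum>c\<in>UNIV. Rm c b a c x)"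

text \<open>The completeness relation \<open>coE_E\<close> is inserted between the two contracted
  indices, which turns the coordinate trace into a trace over the frame.\<close>

lemma frame_ricci:
  assumes x: "x \<in> P"
  shows "frame2 (e_at x) (\<lambda>j l. of_real (ricci g (q x) j l)) a b = Ric a b x"
proof -
  let ?R = "\<lambda>m j k l. complex_of_real (riemann_up g (q x) m j k l)"
  have tr: "complex_of_real (ricci g (q x) j l) = (\<Sum>c\<in>UNIV. \<Sum>m\<in>UNIV. coE c m x * (\<Sum>k\<in>UNIV. E c k x * ?R m j k l))" for j l
  proof -
    have "(\<Sum>c\<in>UNIV. \<Sum>m\<in>UNIV. coE c m x * (\<Sum>k\<in>UNIV. E c k x * ?R m j k l))
      = (\<Sum>c\<in>UNIV. \<Sum>m\<in>UNIV. \<Sum>k\<in>UNIV. coE c m x * E c k x * ?R m j k l)"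
      by (simp add: sum_distrib_left mult.assoc)
    also have "\<dots> = (\<Sum>m\<in>UNIV. \<Sum>k\<in>UNIV. \<Sum>c\<in>UNIV. coE c m x * E c k x * ?R m j k l)"
      by (rule sum_rotate[symmetric])
    also have "\<dots> = (\<Sum>m\<in>UNIV. \<Sum>k\<in>UNIV. (if m = k then 1 else 0) * ?R m j k l)"
      by (simp only: sum_distrib_right[symmetric] coE_E[OF x])
    also have "\<dots> = of_real (ricci g (q x) j l)"
      by (simp add: ricci_def if_distrib[of "\<lambda>z. z * _"] cong: if_cong)
    finally show ?thesis by simp
  qed
  have inner: "(\<Sum>j\<in>UNIV. E a j x * (\<Sum>l\<in>UNIV. E b l x * (\<Sum>k\<in>UNIV. E c k x * ?R m j k l))) = (\<Sum>e\<in>UNIV. Rm c b a e x * E e m x)" for c m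
  proof -
    have "(\<Sum>j\<in>UNIV. E a j x * (\<Sum>l\<in>UNIV. E b l x * (\<Sum>k\<in>UNIV. E c k x * ?R m j k l)))
      = (\<Sum>j\<in>UNIV. \<Sum>l\<in>UNIV. \<Sum>k\<in>UNIV. E a j x * E c k x * E b l x * ?R m j k l)"
      by (simp add: sum_distrib_left mult_ac)
    also have "\<dots> = (\<Sum>j\<in>UNIV. \<Sum>k\<in>UNIV. \<Sum>l\<in>UNIV. E a j x * E c k x * E b l x * ?R m j k l)"
      by (intro sum.cong refl sum_swap_two)
    finally show ?thesis by (simp only: curvature[OF x])
  qed
  have sw: "(\<Sum>m\<in>UNIV. coE c m x * (\<Sum>e\<in>UNIV. r e * E e m x)) = (\<Sum>e\<in>UNIV. r e * (\<Sum>m\<in>UNIV. E e m x * coE c m x))"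
    for c r
    unfolding sum_distrib_left by (subst sum_swap_two) (simp add: mult_ac)
  have "frame2 (e_at x) (\<lambda>j l. of_real (ricci g (q x) j l)) a b
    = (\<Sum>c\<in>UNIV. \<Sum>m\<in>UNIV. coE c m x * (\<Sum>j\<in>UNIV. E a j x * (\<Sum>l\<in>UNIV. E b l x * (\<Sum>k\<in>UNIV. E c k x * ?R m j k l))))"
  proof -
    let ?f = "\<lambda>j l c m. E a j x * (E b l x * (coE c m x * (\<Sum>k\<in>UNIV. E c k x * ?R m j k l)))"
    have "frame2 (e_at x) (\<lambda>j l. of_real (ricci g (q x) j l)) a b = (\<Sum>j\<in>UNIV. \<Sum>l\<in>UNIV. \<Sum>c\<in>UNIV. \<Sum>m\<in>UNIV. ?f j l c m)"
      unfolding frame2_def tr by (simp only: sum_distrib_left)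
    also have "\<dots> = (\<Sum>c\<in>UNIV. \<Sum>j\<in>UNIV. \<Sum>l\<in>UNIV. \<Sum>m\<in>UNIV. ?f j l c m)"
      by (rule sum_rotate)
    also have "\<dots> = (\<Sum>c\<in>UNIV. \<Sum>m\<in>UNIV. \<Sum>j\<in>UNIV. \<Sum>l\<in>UNIV. ?f j l c m)"
      by (intro sum.cong refl sum_rotate)
    finally show ?thesis by (simp add: sum_distrib_left mult_ac)
  qed
  also have "\<dots> = (\<Sum>c\<in>UNIV. \<Sum>e\<in>UNIV. Rm c b a e x * (\<Sum>m\<in>UNIV. E e m x * coE c m x))"
    unfolding inner sw ..
  also have "\<dots> = Ric a b x"
    unfolding E_coE[OF x] by (simp add: Ric_def if_distrib cong: if_cong)
  finally show ?thesis .
qed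

definition Sc :: "real^'n \<Rightarrow> complex" where
  "Sc x = (\<Sum>a\<in>UNIV. Ric a (st a) x)"

lemma frame_scalar:
  assumes x: "x \<in> P"
  shows "of_real (scalar_curv g (q x)) = Sc x / F x"
proof -
  let ?r = "\<lambda>j l. complex_of_real (ricci g (q x) j l)"
  have "of_real (scalar_curv g (q x)) = (\<Sum>j\<in>UNIV. \<Sum>l\<in>UNIV. \<Sum>a\<in>UNIV. E a j x * (E (st a) l x * ?r j l)) / F x"
    by (simp add: scalar_curv_def ginv_frame[OF x] sum_divide_distrib sum_distrib_left sum_distrib_right mult_ac)
  also have "\<dots> = (\<Sum>a\<in>UNIV. frame2 (e_at x) ?r a (st a)) / F x"
    by (subst sum_rotate) (simp only: frame2_def sum_distrib_left)
  finally show ?thesis by (simp only: frame_ricci[OF x] Sc_def)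
qed

lemma frame_tensor4: "frame_tensor T [a, b, c, d] x = frame4 (e_at x) (\<lambda>i j k l. of_real (T (q x) [i, j, k, l])) a b c d"
  by (simp add: frame_tensor_def frame4_def frame2_def)

text \<open>Every term carries exactly one \<open>F\<close>: in the last one the two factors from
  \<open>g\<close> meet the \<open>1 / F\<close> of \<open>frame_scalar\<close>.\<close>

lemma frame_weyl:
  assumes x: "x \<in> P"
  shows "frame_tensor (weyl_tensor g) [a, b, c, d] x = F x * (Rm c d b (st a) x
    - (eta a c * Ric b d x - eta a d * Ric b c x + eta b d * Ric a c x - eta b c * Ric a d x) / 2
    + Sc x / 6 * (eta a c * eta b d - eta a d * eta b c))"
proof -
  let ?g = "\<lambda>i m. complex_of_real (g (q x) $ i $ m)"
  let ?r = "\<lambda>j l. complex_of_real (ricci g (q x) j l)"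
  have "frame_tensor (weyl_tensor g) [a, b, c, d] x = frame4 (e_at x) (\<lambda>i j k l. of_real (riemann g (q x) i j k l)
     - (?g i k * ?r j l - ?g i l * ?r j k + ?r i k * ?g j l - ?r i l * ?g j k) / 2
     + (of_real (scalar_curv g (q x)) / 6) * (?g i k * ?g j l - ?g i l * ?g j k)) a b c d"
    unfolding frame_tensor4 by (simp add: weyl_tensor_def weyl_def mult.commute)
  then show ?thesis
    using F(2)[OF x]
    by (simp only: frame4_add frame4_diff frame4_cmult frame4_divide frame4_prod frame2_g[OF x]
        frame_ricci[OF x] frame_riemann[OF x] frame_scalar[OF x]) (simp add: field_simps)
qed

text \<open>In dimension four the divergence of the Weyl tensor is the Cotton tensor.\<close>

definition Cot :: "4 \<Rightarrow> 4 \<Rightarrow> 4 \<Rightarrow> real^'n \<Rightarrow> complex" where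
  "Cot i k j x = (\<Sum>d\<in>UNIV. frame_tensor (cov_deriv g (weyl_tensor g)) [st d, i, k, j, d] x) / F x"

lemma smooth_weyl_tensor: "smooth_map_on M (\<lambda>y. weyl_tensor g y is)"
  unfolding weyl_tensor_def by (rule smooth_weyl)

lemma smooth_frame_tensor_cov: "smooth_map_on P (frame_tensor (cov_deriv g (weyl_tensor g)) as)"
  by (intro smooth_frame_tensor smooth_cov_deriv smooth_weyl_tensor)

lemma smooth_Cot: "smooth_map_on P (Cot i k j)"
  unfolding Cot_def[abs_def]
  by (intro smooth_divide[OF open_P] smooth_sum[OF open_P] smooth_frame_tensor_cov F)

text \<open>By \<open>w_metric\<close> the connection terms of the two contracted slots add up to the derivative of \<open>F\<close>,
  which cancels that of the factor \<open>F\<close> in \<open>Cot\<close>.\<close>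

lemma frame_cov_deriv_contract:
  assumes x: "x \<in> P"
  shows "(\<Sum>d\<in>UNIV. frame_tensor (cov_deriv g (cov_deriv g (weyl_tensor g))) [a, st d, i, k, j, d] x)
    = F x * (vder (X a) (Cot i k j) x
       - (\<Sum>m\<in>UNIV. w a i m x * Cot m k j x + w a k m x * Cot i m j x + w a j m x * Cot i k m x))"
proof -
  define D where "D as = frame_tensor (cov_deriv g (weyl_tensor g)) as" for as
  have sD: "smooth_map_on P (D as)" for as unfolding D_def by (rule smooth_frame_tensor_cov)
  have FC: "(\<Sum>d\<in>UNIV. D [st d, i, k, j, d] x) = F x * Cot i k j x" if "x \<in> P" for i k j x
    using F(2)[OF that] by (simp add: Cot_def D_def)
  have 1: "frame_tensor (cov_deriv g (cov_deriv g (weyl_tensor g))) [a, e, i, k, j, d] x = vder (X a) (D [e, i, k, j, d]) x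
     - (\<Sum>m\<in>UNIV. w a e m x * D [m, i, k, j, d] x + w a i m x * D [e, m, k, j, d] x + w a k m x * D [e, i, m, j, d] x
        + w a j m x * D [e, i, k, m, d] x + w a d m x * D [e, i, k, j, m] x)" for e d
  proof -
    have "{..<5} = {0, 1, 2, 3, 4 :: nat}" by auto
    then show ?thesis
      by (subst frame_tensor_cov_deriv[OF x smooth_cov_deriv[OF smooth_weyl_tensor]])
        (simp add: D_def sum.distrib eval_nat_numeral)
  qed
  have 2: "(\<Sum>d\<in>UNIV. vder (X a) (D [st d, i, k, j, d]) x) = vder (X a) F x * Cot i k j x + F x * vder (X a) (Cot i k j) x"
  proof -
    have "(\<Sum>d\<in>UNIV. vder (X a) (D [st d, i, k, j, d]) x) = vder (X a) (\<lambda>x. \<Sum>d\<in>UNIV. D [st d, i, k, j, d] x) x"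
      by (rule vder_sum[OF open_P x, symmetric]) (rule sD)
    also have "\<dots> = vder (X a) (\<lambda>x. F x * Cot i k j x) x"
      by (rule vder_cong[OF open_P x]) (rule FC)
    finally show ?thesis by (simp only: vder_mult[OF x F(1) smooth_Cot])
  qed
  have 3: "(\<Sum>d\<in>UNIV. \<Sum>m\<in>UNIV. w a (st d) m x * D [m, i, k, j, d] x + w a d m x * D [st d, i, k, j, m] x)
     = vder (X a) F x * Cot i k j x"
  proof -
    \<comment> \<open>Renaming both indices puts the two connection terms on the same component of
      \<open>D\<close>, with coefficients that \<open>w_metric\<close> adds up.\<close>
    have "(\<Sum>d\<in>UNIV. \<Sum>m\<in>UNIV. w a d m x * D [st d, i, k, j, m] x)
       = (\<Sum>d\<in>UNIV. \<Sum>m\<in>UNIV. w a (st d) m x * D [d, i, k, j, m] x)"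
      by (rule sum.reindex_bij_witness[of _ st st]) auto
    also have "\<dots> = (\<Sum>d\<in>UNIV. \<Sum>m\<in>UNIV. w a (st m) d x * D [m, i, k, j, d] x)"
      by (rule sum_swap_two)
    finally have "F x * (\<Sum>d\<in>UNIV. \<Sum>m\<in>UNIV. w a (st d) m x * D [m, i, k, j, d] x + w a d m x * D [st d, i, k, j, m] x)
      = (\<Sum>d\<in>UNIV. \<Sum>m\<in>UNIV. F x * (w a (st d) (st (st m)) x + w a (st m) (st (st d)) x) * D [m, i, k, j, d] x)"
      by (simp add: sum.distrib sum_distrib_left algebra_simps)
    also have "\<dots> = (\<Sum>d\<in>UNIV. \<Sum>m\<in>UNIV. (if m = st d then vder (X a) F x * D [m, i, k, j, d] x else 0))"
      unfolding w_metric[OF x] by (intro sum.cong refl) (auto simp: eta_def)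
    also have "\<dots> = (\<Sum>d\<in>UNIV. vder (X a) F x * D [st d, i, k, j, d] x)"
      by simp
    also have "\<dots> = F x * (vder (X a) F x * Cot i k j x)"
      by (simp only: sum_distrib_left[symmetric] FC[OF x] mult_ac)
    finally show ?thesis using F(2)[OF x] by simp
  qed
  have 4: "(\<Sum>d\<in>UNIV. \<Sum>m\<in>UNIV. w a i m x * D [st d, m, k, j, d] x + w a k m x * D [st d, i, m, j, d] x
        + w a j m x * D [st d, i, k, m, d] x)
     = F x * (\<Sum>m\<in>UNIV. w a i m x * Cot m k j x + w a k m x * Cot i m j x + w a j m x * Cot i k m x)"
  proof -
    have "(\<Sum>d\<in>UNIV. \<Sum>m\<in>UNIV. w a i m x * D [st d, m, k, j, d] x + w a k m x * D [st d, i, m, j, d] x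
        + w a j m x * D [st d, i, k, m, d] x)
      = (\<Sum>m\<in>UNIV. \<Sum>d\<in>UNIV. w a i m x * D [st d, m, k, j, d] x + w a k m x * D [st d, i, m, j, d] x
        + w a j m x * D [st d, i, k, m, d] x)"
      by (rule sum_swap_two)
    also have "\<dots> = (\<Sum>m\<in>UNIV. w a i m x * (F x * Cot m k j x) + w a k m x * (F x * Cot i m j x) + w a j m x * (F x * Cot i k m x))"
      by (simp only: sum.distrib sum_distrib_left[symmetric] FC[OF x])
    finally show ?thesis by (simp only: sum_distrib_left distrib_left mult_ac)
  qed
  show ?thesis
    unfolding 1 sum_subtractf 2 using 3 4 by (simp add: sum.distrib algebra_simps)
qed

text \<open>The two inverse metrics account for the square of \<open>F\<close> on the left. The
  inner of the two contractions is \<open>frame_cov_deriv_contract\<close>, which returns one factor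
  \<open>F\<close> on the right.\<close>

lemma frame_bach:
  assumes x: "x \<in> P"
  shows "(F x)\<^sup>2 * frame2 (e_at x) (\<lambda>i j. of_real (bach g (q x) i j)) a b
    = F x * (\<Sum>c\<in>UNIV. vder (X (st c)) (Cot a c b) x
       - (\<Sum>m\<in>UNIV. w (st c) a m x * Cot m c b x + w (st c) c m x * Cot a m b x + w (st c) b m x * Cot a c m x))
     + (\<Sum>c\<in>UNIV. \<Sum>d\<in>UNIV. Ric (st c) (st d) x * frame_tensor (weyl_tensor g) [a, c, b, d] x) / 2"
proof -
  let ?DD = "cov_deriv g (cov_deriv g (weyl_tensor g))"
  define U where "U p r i k j l = complex_of_real (?DD (q x) [p, r, i, k, j, l] + ricci g (q x) p r * weyl g (q x) i k j l / 2)"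
    for p r i k j l
  let ?e = "e_at x"
  let ?f = "\<lambda>c d p r i k j l. ?e (st c) p * ?e (st d) r * ?e a i * ?e c k * ?e b j * ?e d l * U p r i k j l"
  define H where "H k p l r = (\<Sum>c\<in>UNIV. \<Sum>d\<in>UNIV. (?e c k * ?e (st c) p) * (?e d l * ?e (st d) r))" for k p l r
  have H: "of_real (ginv g (q x) k p) * of_real (ginv g (q x) l r) = H k p l r / (F x)\<^sup>2" for k p l r
    unfolding H_def by (simp only: sum_product[symmetric] ginv_frame[OF x] times_divide_times_eq power2_eq_square)
  have B: "of_real (bach g (q x) i j) = (\<Sum>k\<in>UNIV. \<Sum>l\<in>UNIV. \<Sum>p\<in>UNIV. \<Sum>r\<in>UNIV. H k p l r * U p r i k j l) / (F x)\<^sup>2" for i j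
  proof -
    have "of_real (bach g (q x) i j) = (\<Sum>k\<in>UNIV. \<Sum>l\<in>UNIV. \<Sum>p\<in>UNIV. \<Sum>r\<in>UNIV.
        of_real (ginv g (q x) k p) * of_real (ginv g (q x) l r) * U p r i k j l)"
      by (simp add: bach_def U_def)
    then show ?thesis by (simp add: H sum_divide_distrib)
  qed
  have "(F x)\<^sup>2 * frame2 ?e (\<lambda>i j. of_real (bach g (q x) i j)) a b
    = frame2 ?e (\<lambda>i j. \<Sum>k\<in>UNIV. \<Sum>l\<in>UNIV. \<Sum>p\<in>UNIV. \<Sum>r\<in>UNIV. H k p l r * U p r i k j l) a b"
    unfolding B frame2_divide using F(2)[OF x] by simp
  also have "\<dots> = (\<Sum>i\<in>UNIV. \<Sum>j\<in>UNIV. \<Sum>k\<in>UNIV. \<Sum>l\<in>UNIV. \<Sum>p\<in>UNIV. \<Sum>r\<in>UNIV. \<Sum>c\<in>UNIV. \<Sum>d\<in>UNIV. ?f c d p r i k j l)"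
    by (simp add: frame2_def H_def sum_distrib_left sum_distrib_right mult_ac)
  also have "\<dots> = (\<Sum>c\<in>UNIV. \<Sum>d\<in>UNIV. \<Sum>p\<in>UNIV. \<Sum>r\<in>UNIV. \<Sum>i\<in>UNIV. \<Sum>k\<in>UNIV. \<Sum>j\<in>UNIV. \<Sum>l\<in>UNIV. ?f c d p r i k j l)"
    by (rule sum8_reorder)
  also have "\<dots> = (\<Sum>c\<in>UNIV. \<Sum>d\<in>UNIV. frame2 ?e (\<lambda>p r. frame4 ?e (U p r) a c b d) (st c) (st d))"
    by (simp add: frame4_def frame2_def sum_distrib_left mult_ac)
  also have "\<dots> = (\<Sum>c\<in>UNIV. \<Sum>d\<in>UNIV. frame_tensor ?DD [st c, st d, a, c, b, d] x
      + Ric (st c) (st d) x * frame_tensor (weyl_tensor g) [a, c, b, d] x / 2)"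
  proof (intro sum.cong refl)
    fix c d
    have "frame4 ?e (U p r) a c b d = frame4 ?e (\<lambda>i k j l. of_real (?DD (q x) [p, r, i, k, j, l])) a c b d
       + of_real (ricci g (q x) p r) * (frame_tensor (weyl_tensor g) [a, c, b, d] x / 2)" for p r
    proof -
      have "U p r = (\<lambda>i k j l. of_real (?DD (q x) [p, r, i, k, j, l]) + of_real (ricci g (q x) p r) * (of_real (weyl_tensor g (q x) [i, k, j, l]) / 2))"
        by (intro ext) (simp add: U_def weyl_tensor_def)
      then show ?thesis by (simp only: frame4_add frame4_cmult frame4_divide frame_tensor4)
    qed
    moreover have "frame_tensor ?DD [st c, st d, a, c, b, d] x
        = frame2 ?e (\<lambda>p r. frame4 ?e (\<lambda>i k j l. of_real (?DD (q x) [p, r, i, k, j, l])) a c b d) (st c) (st d)"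
      by (simp add: frame_tensor_def frame4_def frame2_def)
    ultimately show "frame2 ?e (\<lambda>p r. frame4 ?e (U p r) a c b d) (st c) (st d) = frame_tensor ?DD [st c, st d, a, c, b, d] x
      + Ric (st c) (st d) x * frame_tensor (weyl_tensor g) [a, c, b, d] x / 2"
      by (simp only: frame2_add frame2_divide frame2_cmult_right frame_ricci[OF x] times_divide_eq_right)
  qed
  also have "\<dots> = (\<Sum>c\<in>UNIV. \<Sum>d\<in>UNIV. frame_tensor ?DD [st c, st d, a, c, b, d] x)
     + (\<Sum>c\<in>UNIV. \<Sum>d\<in>UNIV. Ric (st c) (st d) x * frame_tensor (weyl_tensor g) [a, c, b, d] x) / 2"
    by (simp only: sum.distrib sum_divide_distrib)
  finally show ?thesis
    unfolding frame_cov_deriv_contract[OF x] by (simp only: sum_distrib_left)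
qed

text \<open>The frame matrix has the inverse \<open>coE\<close>, applied here once in each
  index.\<close>

lemma frame2_eq_0_iff:
  assumes x: "x \<in> P"
  shows "(\<forall>a b. frame2 (e_at x) u a b = 0) \<longleftrightarrow> (\<forall>i j. u i j = 0)"
proof
  assume z: "\<forall>a b. frame2 (e_at x) u a b = 0"
  have inv: "V i = 0" if "\<And>a. (\<Sum>i\<in>UNIV. E a i x * V i) = 0" for V :: "4 \<Rightarrow> complex" and i
  proof -
    have "V i = (\<Sum>j\<in>UNIV. (\<Sum>a\<in>UNIV. coE a i x * E a j x) * V j)"
      unfolding coE_E[OF x] by (simp add: if_distrib[of "\<lambda>z. z * _"] cong: if_cong)
    also have "\<dots> = (\<Sum>a\<in>UNIV. coE a i x * (\<Sum>j\<in>UNIV. E a j x * V j))"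
      unfolding sum_distrib_left sum_distrib_right mult.assoc by (rule sum_swap_two)
    finally show ?thesis using that by simp
  qed
  have "(\<Sum>j\<in>UNIV. E b j x * u i j) = 0" for b i
    by (rule inv) (use z in \<open>simp add: frame2_def\<close>)
  then show "\<forall>i j. u i j = 0" using inv by blast
qed (simp add: frame2_def)

end

section \<open>The frame of a Fefferman metric\<close>

text \<open>The numeral 4 of type \<open>4\<close> denotes 0. These facts let the index checks over
  \<open>forall_4\<close> evaluate \<open>kron\<close>.\<close>

lemma four_neq [simp]:
  "(1::4) \<noteq> 2" "(1::4) \<noteq> 3" "(1::4) \<noteq> 4" "(2::4) \<noteq> 1" "(2::4) \<noteq> 3" "(2::4) \<noteq> 4"
  "(3::4) \<noteq> 1" "(3::4) \<noteq> 2" "(3::4) \<noteq> 4" "(4::4) \<noteq> 1" "(4::4) \<noteq> 2" "(4::4) \<noteq> 3"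
  by simp_all

definition kron :: "4 \<Rightarrow> 4 \<Rightarrow> complex" where
  "kron a b = (if a = b then 1 else 0)"

text \<open>With \<open>X\<^sub>4\<close> dual to \<open>\<theta>\<^sup>4 = (\<Omega>\<^sub>2 - \<Omega>\<^sub>2\<^sup>b) / 3\<i>\<close> (a bar is written \<open>b\<close>), \<open>C_fef\<close> encodes the horizontal brackets
  \<open>[X\<^sub>1, X\<^sub>2] = - \<i> X\<^sub>3\<close>, \<open>[X\<^sub>4, X\<^sub>1] = - 3\<i>/2 X\<^sub>1\<close>, \<open>[X\<^sub>4, X\<^sub>2] = 3\<i>/2 X\<^sub>2\<close>,
  \<open>gam\<close> is the skew torsion-free connection with these brackets, and \<open>v_fef\<close> is the action on \<open>E c\<close> of
  the vertical parts \<open>- R Y\<^sub>3 - S Y\<^sub>4\<close> of \<open>[X\<^sub>2, X\<^sub>3]\<close> and \<open>- R\<^sup>b Y\<^sub>3\<^sup>b - S\<^sup>b Y\<^sub>4\<close> of \<open>[X\<^sub>1, X\<^sub>3]\<close>.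
  The terms with \<open>s\<close>, half the logarithmic derivative of the conformal factor, turn \<open>gam\<close> into the
  Levi-Civita connection.\<close>

definition C_fef :: "4 \<Rightarrow> 4 \<Rightarrow> 4 \<Rightarrow> complex" where
  "C_fef a b c = - \<i> * kron c 3 * (kron a 1 * kron b 2 - kron a 2 * kron b 1)
     - 3 * \<i> / 2 * kron c 1 * (kron a 4 * kron b 1 - kron a 1 * kron b 4)
     + 3 * \<i> / 2 * kron c 2 * (kron a 4 * kron b 2 - kron a 2 * kron b 4)"

definition gam :: "4 \<Rightarrow> 4 \<Rightarrow> 4 \<Rightarrow> complex" where
  "gam a b c = - \<i> * kron a 4 * kron b 1 * kron c 1 + \<i> / 2 * kron a 1 * kron b 4 * kron c 1
     + \<i> * kron a 4 * kron b 2 * kron c 2 - \<i> / 2 * kron a 2 * kron b 4 * kron c 2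
     + \<i> / 2 * kron a 2 * kron b 1 * kron c 3 - \<i> / 2 * kron a 1 * kron b 2 * kron c 3"

definition w_fef :: "(4 \<Rightarrow> 'p \<Rightarrow> complex) \<Rightarrow> 4 \<Rightarrow> 4 \<Rightarrow> 4 \<Rightarrow> 'p \<Rightarrow> complex" where
  "w_fef s a b c x = gam a b c + kron b c * s a x + kron a c * s b x - eta a b * s (st c) x"

definition v_fef :: "('p \<Rightarrow> complex) \<Rightarrow> ('p \<Rightarrow> complex) \<Rightarrow> 4 \<Rightarrow> 4 \<Rightarrow> 4 \<Rightarrow> 4 \<Rightarrow> 'p \<Rightarrow> complex" where
  "v_fef R Rb a b c d x
     = - R x * (kron a 2 * kron b 3 - kron a 3 * kron b 2) * (kron c 2 * kron d 4 - kron c 3 * kron d 1)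
       - Rb x * (kron a 1 * kron b 3 - kron a 3 * kron b 1) * (kron c 1 * kron d 4 - kron c 3 * kron d 2)"

text \<open>\<open>phi\<close> and \<open>psi\<close> are the frame components of
  \<open>\<theta>\<^sup>3 \<and> \<theta>\<^sup>2\<close> and
  \<open>\<theta>\<^sup>3 \<and> \<theta>\<^sup>1\<close>, the two null two-forms from which the
  Weyl tensor is built.\<close>

definition phi :: "4 \<Rightarrow> 4 \<Rightarrow> complex" where "phi a b = kron a 3 * kron b 2 - kron b 3 * kron a 2"
definition psi :: "4 \<Rightarrow> 4 \<Rightarrow> complex" where "psi a b = kron a 3 * kron b 1 - kron b 3 * kron a 1"

lemma kron_simps [simp]: "kron a a = 1" "a \<noteq> b \<Longrightarrow> kron a b = 0"
  by (simp_all add: kron_def)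

lemma eta_kron: "eta a b = kron b (st a)"
  by (simp add: eta_def kron_def)

text \<open>The terms with \<open>s\<close>, those of a conformal change of a Levi-Civita
  connection, are symmetric in \<open>a\<close> and \<open>b\<close>; the torsion is that of
  \<open>gam\<close>.\<close>

lemma w_fef_torsion: "w_fef s a b c x - w_fef s b a c x = C_fef a b c"
proof -
  have "\<forall>a b c. gam a b c - gam b a c = C_fef a b c"
    by (simp add: forall_4 gam_def C_fef_def)
  then show ?thesis by (simp add: w_fef_def eta_sym[of b a] flip: diff_diff_eq2)
qed

text \<open>With the last index lowered, \<open>gam\<close> and the last two terms with
  \<open>s\<close> together are skew in \<open>b\<close> and \<open>c\<close>. Only the first term
  with \<open>s\<close> survives, twice.\<close>

lemma w_fef_metric: "w_fef s a b (st c) x + w_fef s a c (st b) x = 2 * s a x * eta b c"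
proof -
  have "\<forall>a b c. gam a b (st c) + gam a c (st b) = 0"
    by (simp add: forall_4 gam_def)
  then have "gam a b (st c) + gam a c (st b) = 0" by blast
  then have "gam a c (st b) = - gam a b (st c)" using add.inverse_unique by metis
  moreover have "kron b (st c) = eta b c" "kron c (st b) = eta b c" "kron a (st c) = eta a c" "kron a (st b) = eta a b"
    by (auto simp: eta_def kron_def)
  ultimately show ?thesis by (simp add: w_fef_def algebra_simps)
qed

text \<open>The relations from which the curvature computation draws, separated from the
  eight-dimensional coframe. \<open>Rb\<close> and \<open>Sb\<close> stand for the conjugates of
  \<open>R\<close> and \<open>S\<close>; that \<open>dS\<close> and \<open>dSb\<close> contain the
  same \<open>S1\<close> expresses its reality.\<close>

locale fefferman_frame =
  conformal_frame M g P q X E F C_fef "w_fef s" "v_fef R Rb"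
  for M :: "(real^4) set" and g :: "real^4 \<Rightarrow> real^4^4" and P :: "(real^'n) set" and q :: "real^'n \<Rightarrow> real^4"
    and X E F and s :: "4 \<Rightarrow> real^'n \<Rightarrow> complex" and R Rb :: "real^'n \<Rightarrow> complex" +
  fixes S Sb S1 :: "real^'n \<Rightarrow> complex"
  assumes s: "\<And>a. smooth_map_on P (s a)" and R: "smooth_map_on P R" and Rb: "smooth_map_on P Rb"
    and S: "smooth_map_on P S" and Sb: "smooth_map_on P Sb"
    and dF: "\<And>a x. x \<in> P \<Longrightarrow> vder (X a) F x = 2 * F x * s a x"
    and ds: "\<And>a b x. x \<in> P \<Longrightarrow> vder (X a) (s b) x - vder (X b) (s a) x = (\<Sum>c\<in>UNIV. C_fef a b c * s c x)"
    and dR: "\<And>x. x \<in> P \<Longrightarrow> vder (X 1) R x = - S x" "\<And>x. x \<in> P \<Longrightarrow> vder (X 4) R x = 3 * \<i> * R x"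
    and dRb: "\<And>x. x \<in> P \<Longrightarrow> vder (X 2) Rb x = - Sb x" "\<And>x. x \<in> P \<Longrightarrow> vder (X 4) Rb x = - 3 * \<i> * Rb x"
    and dS: "\<And>x. x \<in> P \<Longrightarrow> vder (X 1) S x = S1 x" "\<And>x. x \<in> P \<Longrightarrow> vder (X 4) S x = 3 * \<i> / 2 * S x"
    and dSb: "\<And>x. x \<in> P \<Longrightarrow> vder (X 2) Sb x = S1 x" "\<And>x. x \<in> P \<Longrightarrow> vder (X 4) Sb x = - 3 * \<i> / 2 * Sb x"
begin

lemma vder_w:
  assumes x: "x \<in> P"
  shows "vder (X a) (w_fef s b c e) x = kron c e * vder (X a) (s b) x + kron b e * vder (X a) (s c) x
    - eta b c * vder (X a) (s (st e)) x"
proof -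
  have cm: "smooth_map_on P (\<lambda>x. k * s d x)" for k d
    by (intro smooth_mult[OF open_P] smooth_const s)
  show ?thesis
    unfolding w_fef_def[abs_def]
    by (simp add: vder_add[OF x] vder_diff[OF x] vder_cmult[OF x s] vder_const cm
        smooth_add[OF open_P] smooth_diff[OF open_P] smooth_const)
qed

text \<open>\<open>Wh\<close> is the Weyl tensor divided by \<open>F\<close>.\<close>

definition schouten :: "4 \<Rightarrow> 4 \<Rightarrow> real^'n \<Rightarrow> complex" where
  "schouten a b x = kron a 4 * kron b 4 / 4 - (vder (X a) (s b) x - (\<Sum>c\<in>UNIV. gam a b c * s c x)) + s a x * s b x
     - (\<Sum>c\<in>UNIV. s c x * s (st c) x) / 2 * eta a b"

definition Wh :: "4 \<Rightarrow> 4 \<Rightarrow> 4 \<Rightarrow> 4 \<Rightarrow> real^'n \<Rightarrow> complex" where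
  "Wh a b c d x = - (R x * (phi a b * phi c d) + Rb x * (psi a b * psi c d))"

text \<open>Closedness of \<open>s\<close> oriented as rewriting: the smaller index goes to the
  field. This normal form makes the finite checks polynomial identities.\<close>

lemma ds_simps:
  assumes x: "x \<in> P"
  shows "vder (X 2) (s 1) x = vder (X 1) (s 2) x + \<i> * s 3 x"
    "vder (X 3) (s 1) x = vder (X 1) (s 3) x" "vder (X 3) (s 2) x = vder (X 2) (s 3) x"
    "vder (X 4) (s 1) x = vder (X 1) (s 4) x - 3 * \<i> / 2 * s 1 x"
    "vder (X 4) (s 2) x = vder (X 2) (s 4) x + 3 * \<i> / 2 * s 2 x"
    "vder (X 4) (s 3) x = vder (X 3) (s 4) x"
  using ds[OF x, of 2 1] ds[OF x, of 3 1] ds[OF x, of 3 2] ds[OF x, of 4 1] ds[OF x, of 4 2] ds[OF x, of 4 3]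
  by (simp_all add: sum_4 C_fef_def field_simps)

text \<open>The decomposition into Weyl and Schouten parts. \<open>schouten\<close> is one quarter
  of \<open>\<theta>\<^sup>4 \<otimes> \<theta>\<^sup>4\<close>, which belongs to
  \<open>gam\<close>, modified by the classical conformal change formula with \<open>s\<close> as
  differential of the exponent; so \<open>s\<close> does not enter \<open>Wh\<close>.\<close>

lemma Rm_formula:
  assumes x: "x \<in> P"
  shows "Rm a b c e x = Wh (st e) c a b x + kron e a * schouten c b x - kron e b * schouten c a x
     + eta c b * schouten (st e) a x - eta c a * schouten (st e) b x"
proof -
  let ?eq = "\<lambda>a b c e. Rm a b c e x = Wh (st e) c a b x + kron e a * schouten c b x - kron e b * schouten c a x
     + eta c b * schouten (st e) a x - eta c a * schouten (st e) b x"
  \<comment> \<open>Both sides are skew in \<open>a\<close> and \<open>b\<close>, so the six pairs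
    with \<open>a < b\<close> suffice.\<close>
  have *: "\<forall>c e. ?eq 1 2 c e" "\<forall>c e. ?eq 1 3 c e" "\<forall>c e. ?eq 1 4 c e" "\<forall>c e. ?eq 2 3 c e"
    "\<forall>c e. ?eq 2 4 c e" "\<forall>c e. ?eq 3 4 c e"
    by (simp_all add: forall_4 Rm_def vder_w[OF x] sum_4 w_fef_def gam_def C_fef_def v_fef_def eta_kron
        Wh_def schouten_def phi_def psi_def ds_simps[OF x] field_simps)
  have skew: "?eq b a c e" if "?eq a b c e" for a b c e
  proof -
    have "C_fef b a d = - C_fef a b d" for d by (simp add: C_fef_def algebra_simps)
    moreover have "v_fef R Rb b a c e x = - v_fef R Rb a b c e x" by (simp add: v_fef_def algebra_simps)
    ultimately have "Rm b a c e x = - Rm a b c e x"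
      by (simp add: Rm_def sum_subtractf sum_negf)
    moreover have "phi b a = - phi a b" "psi b a = - psi a b" by (simp_all add: phi_def psi_def)
    ultimately show ?thesis using that by (simp add: Wh_def algebra_simps)
  qed
  have "Rm a a c e x = 0" for a
    by (simp add: Rm_def C_fef_def v_fef_def)
  moreover have "phi a a = 0" "psi a a = 0" for a by (simp_all add: phi_def psi_def)
  ultimately have diag: "?eq a a c e" for a by (simp add: Wh_def)
  have "\<forall>a b. ?eq a b c e"
    unfolding forall_4 using * skew diag by blast
  then show ?thesis by blast
qed

text \<open>The skew part of the derivative of \<open>s\<close> is given by \<open>C_fef\<close>,
  which is also the torsion of \<open>gam\<close>.\<close>

lemma schouten_sym: "x \<in> P \<Longrightarrow> schouten a b x = schouten b a x"
proof -
  assume x: "x \<in> P"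
  have "\<forall>a b. schouten a b x = schouten b a x"
    by (simp add: forall_4 schouten_def ds_simps[OF x] sum_4 gam_def eta_kron)
  then show ?thesis by blast
qed

text \<open>\<open>Wh\<close> is trace free, so the contraction sees the Schouten part alone; the 2
  is the dimension minus two.\<close>

lemma Ric_formula:
  assumes x: "x \<in> P"
  shows "Ric a b x = 2 * schouten a b x + (\<Sum>c\<in>UNIV. schouten c (st c) x) * eta a b"
proof -
  have W: "(\<Sum>c\<in>UNIV. Wh (st c) a c b x) = 0"
  proof -
    have "\<forall>a b. (\<Sum>c\<in>UNIV. Wh (st c) a c b x) = 0"
      by (simp add: forall_4 sum_4 Wh_def phi_def psi_def)
    then show ?thesis by blast
  qed
  have "(\<Sum>c\<in>UNIV. kron c b * schouten a c x) = schouten a b x" "(\<Sum>c\<in>UNIV. eta a c * schouten (st c) b x) = schouten a b x"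
    by (simp_all add: kron_def eta_def if_distrib[of "\<lambda>z. z * _"] cong: if_cong)
  moreover have "(\<Sum>c\<in>UNIV. eta a b * schouten (st c) c x) = (\<Sum>c\<in>UNIV. schouten c (st c) x) * eta a b"
    by (simp add: sum_distrib_left sum_distrib_right mult.commute schouten_sym[OF x, of "st _"])
  ultimately show ?thesis
    by (simp add: Ric_def Rm_formula[OF x] sum.distrib sum_subtractf W)
qed

text \<open>With \<open>T\<close> the trace of \<open>schouten\<close>, the scalar curvature is
  \<open>6 * T\<close>, and the Schouten terms of \<open>Rm_formula\<close> cancel exactly against
  the trace corrections in the Weyl tensor.\<close>

lemma weyl_formula:
  assumes x: "x \<in> P"
  shows "frame_tensor (weyl_tensor g) [a, b, c, d] x = F x * Wh a b c d x"
proof -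
  define T where "T = (\<Sum>c\<in>UNIV. schouten c (st c) x)"
  have Ric: "Ric a b x = 2 * schouten a b x + T * eta a b" for a b
    by (simp add: Ric_formula[OF x] T_def)
  have "Sc x = 6 * T"
    unfolding Sc_def Ric sum.distrib by (simp add: sum_distrib_left[symmetric] T_def[symmetric] eta_def)
  moreover have "kron (st a) c = eta a c" "kron (st a) d = eta a d" by (auto simp: eta_def kron_def)
  ultimately show ?thesis
    unfolding frame_weyl[OF x] Ric Rm_formula[OF x] by (simp add: field_simps schouten_sym[OF x, of b a])
qed

text \<open>Up to sign, the coefficients of the Cotton tensor: \<open>cot_k\<close> goes with
  \<open>phi\<close> and index 3, \<open>cot_m\<close> with \<open>phi\<close> and index 2, the
  versions with \<open>b\<close> with \<open>psi\<close> and indices 3 and 1. The terms with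
  \<open>s\<close> come from the conformal change.\<close>

definition cot_k where "cot_k x = - S x + R x * s 1 x"
definition cot_m where "cot_m x = - R x * (\<i> / 2 + s 4 x)"
definition cot_kb where "cot_kb x = - Sb x + Rb x * s 2 x"
definition cot_mb where "cot_mb x = - Rb x * (- \<i> / 2 + s 4 x)"

lemma frame_cov_deriv_weyl:
  assumes x: "x \<in> P"
  shows "frame_tensor (cov_deriv g (weyl_tensor g)) [e, i, k, j, l] x = F x * (2 * s e x * Wh i k j l x
    - (vder (X e) R x * (phi i k * phi j l) + vder (X e) Rb x * (psi i k * psi j l))
    - (\<Sum>m\<in>UNIV. w_fef s e i m x * Wh m k j l x + w_fef s e k m x * Wh i m j l x
        + w_fef s e j m x * Wh i k m l x + w_fef s e l m x * Wh i k j m x))"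
proof -
  have 1: "smooth_map_on P (\<lambda>x. k * R x)" "smooth_map_on P (\<lambda>x. k * Rb x)" for k
    by (intro smooth_mult[OF open_P] smooth_const R Rb)+
  have W': "Wh i k j l = (\<lambda>x. - (phi i k * phi j l) * R x + - (psi i k * psi j l) * Rb x)"
    by (simp add: Wh_def[abs_def] algebra_simps)
  have sW: "smooth_map_on P (Wh i k j l)"
    unfolding W' by (intro smooth_add[OF open_P] 1)
  have dW: "vder (X e) (Wh i k j l) x = - (vder (X e) R x * (phi i k * phi j l) + vder (X e) Rb x * (psi i k * psi j l))"
    unfolding W' vder_add[OF x 1] vder_cmult[OF x R] vder_cmult[OF x Rb] by (simp add: algebra_simps)
  have "vder (X e) (frame_tensor (weyl_tensor g) [i, k, j, l]) x = vder (X e) (\<lambda>x. F x * Wh i k j l x) x"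
    by (rule vder_cong[OF open_P x]) (rule weyl_formula)
  also have "\<dots> = 2 * F x * s e x * Wh i k j l x + F x * vder (X e) (Wh i k j l) x"
    by (simp only: vder_mult[OF x F(1) sW] dF[OF x])
  finally have "vder (X e) (frame_tensor (weyl_tensor g) [i, k, j, l]) x
    = 2 * F x * s e x * Wh i k j l x + F x * vder (X e) (Wh i k j l) x" .
  moreover have "{..<4} = {0, 1, 2, 3 :: nat}" by auto
  ultimately show ?thesis
    by (subst frame_tensor_cov_deriv[OF x smooth_weyl_tensor])
      (simp add: weyl_formula[OF x] dW sum.distrib sum_distrib_left eval_nat_numeral algebra_simps)
qed

text \<open>The differentiating index \<open>st d\<close> is paired with an index \<open>d\<close>
  of \<open>phi\<close>, which is 2 or 3. So \<open>R\<close> is differentiated only along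
  \<open>X 1\<close> and \<open>X 4\<close>, and for the same reason \<open>Rb\<close> only along
  \<open>X 2\<close> and \<open>X 4\<close>.\<close>

lemma Cot_formula:
  assumes x: "x \<in> P"
  shows "Cot i k j x = - (phi i k * (cot_k x * kron j 3 + cot_m x * kron j 2) + psi i k * (cot_kb x * kron j 3 + cot_mb x * kron j 1))"
proof -
  have "\<forall>i k j. Cot i k j x = - (phi i k * (cot_k x * kron j 3 + cot_m x * kron j 2) + psi i k * (cot_kb x * kron j 3 + cot_mb x * kron j 1))"
    using F(2)[OF x]
    by (simp add: forall_4 Cot_def frame_cov_deriv_weyl[OF x] sum_4 Wh_def phi_def psi_def w_fef_def gam_def eta_kron
        dR[OF x] dRb[OF x] cot_k_def cot_m_def cot_kb_def cot_mb_def field_simps)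
  then show ?thesis by blast
qed

lemma vder_Cot:
  assumes x: "x \<in> P"
  shows "vder (X e) (Cot i k j) x
    = - phi i k * kron j 3 * (- vder (X e) S x + vder (X e) R x * s 1 x + R x * vder (X e) (s 1) x)
      - phi i k * kron j 2 * (- vder (X e) R x * (\<i> / 2 + s 4 x) - R x * vder (X e) (s 4) x)
      - psi i k * kron j 3 * (- vder (X e) Sb x + vder (X e) Rb x * s 2 x + Rb x * vder (X e) (s 2) x)
      - psi i k * kron j 1 * (- vder (X e) Rb x * (- \<i> / 2 + s 4 x) - Rb x * vder (X e) (s 4) x)"
proof -
  have m: "smooth_map_on P (\<lambda>x. R x * s a x)" "smooth_map_on P (\<lambda>x. Rb x * s a x)"
    "smooth_map_on P (\<lambda>x. k * R x)" "smooth_map_on P (\<lambda>x. k * Rb x)" for a k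
    by (intro smooth_mult[OF open_P] smooth_const R Rb s)+
  have cot_eqs: "cot_k = (\<lambda>x. R x * s 1 x - S x)" "cot_m = (\<lambda>x. (- \<i> / 2) * R x - R x * s 4 x)"
    "cot_kb = (\<lambda>x. Rb x * s 2 x - Sb x)" "cot_mb = (\<lambda>x. (\<i> / 2) * Rb x - Rb x * s 4 x)"
    by (simp_all add: fun_eq_iff cot_k_def cot_m_def cot_kb_def cot_mb_def algebra_simps)
  have sm: "smooth_map_on P cot_k" "smooth_map_on P cot_m" "smooth_map_on P cot_kb" "smooth_map_on P cot_mb"
    unfolding cot_eqs by (intro smooth_diff[OF open_P] m S Sb)+
  have c: "smooth_map_on P (\<lambda>x. k * cot_k x)" "smooth_map_on P (\<lambda>x. k * cot_m x)"
    "smooth_map_on P (\<lambda>x. k * cot_kb x)" "smooth_map_on P (\<lambda>x. k * cot_mb x)" for k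
    by (intro smooth_mult[OF open_P] smooth_const sm)+
  have "vder (X e) (Cot i k j) x = vder (X e) (\<lambda>x. (- phi i k * kron j 3) * cot_k x + (- phi i k * kron j 2) * cot_m x
      + (- psi i k * kron j 3) * cot_kb x + (- psi i k * kron j 1) * cot_mb x) x"
    by (rule vder_cong[OF open_P x]) (simp add: Cot_formula algebra_simps)
  also have "\<dots> = (- phi i k * kron j 3) * vder (X e) cot_k x + (- phi i k * kron j 2) * vder (X e) cot_m x
      + (- psi i k * kron j 3) * vder (X e) cot_kb x + (- psi i k * kron j 1) * vder (X e) cot_mb x"
    by (simp only: vder_add[OF x] smooth_add[OF open_P] c vder_cmult[OF x sm(1)] vder_cmult[OF x sm(2)]
        vder_cmult[OF x sm(3)] vder_cmult[OF x sm(4)])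
  also have "vder (X e) cot_k x = vder (X e) R x * s 1 x + R x * vder (X e) (s 1) x - vder (X e) S x"
    unfolding cot_eqs by (simp only: vder_diff[OF x m(1) S] vder_mult[OF x R s])
  also have "vder (X e) cot_kb x = vder (X e) Rb x * s 2 x + Rb x * vder (X e) (s 2) x - vder (X e) Sb x"
    unfolding cot_eqs by (simp only: vder_diff[OF x m(2) Sb] vder_mult[OF x Rb s])
  also have "vder (X e) cot_m x = (- \<i> / 2) * vder (X e) R x - (vder (X e) R x * s 4 x + R x * vder (X e) (s 4) x)"
    unfolding cot_eqs by (simp only: vder_diff[OF x m(3) m(1)] vder_mult[OF x R s] vder_cmult[OF x R])
  also have "vder (X e) cot_mb x = (\<i> / 2) * vder (X e) Rb x - (vder (X e) Rb x * s 4 x + Rb x * vder (X e) (s 4) x)"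
    unfolding cot_eqs by (simp only: vder_diff[OF x m(4) m(2)] vder_mult[OF x Rb s] vder_cmult[OF x Rb])
  finally show ?thesis by (simp add: algebra_simps)
qed

text \<open>The second divergence pairs indices as the first did, so of the derivatives of
  \<open>S\<close> only those along \<open>X 1\<close> and \<open>X 4\<close> occur. Derivatives of
  \<open>s\<close> cancel against the Schouten part of the Ricci term. The halves with
  \<open>phi\<close> and \<open>psi\<close> contribute one \<open>S1\<close> each.\<close>

lemma bach_formula:
  assumes x: "x \<in> P"
  shows "F x * frame2 (e_at x) (\<lambda>i j. of_real (bach g (q x) i j)) a b = 2 * S1 x * kron a 3 * kron b 3"
proof -
  have "\<forall>a b. (\<Sum>c\<in>UNIV. vder (X (st c)) (Cot a c b) x
       - (\<Sum>m\<in>UNIV. w_fef s (st c) a m x * Cot m c b x + w_fef s (st c) c m x * Cot a m b x + w_fef s (st c) b m x * Cot a c m x))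
     + (\<Sum>c\<in>UNIV. \<Sum>d\<in>UNIV. Ric (st c) (st d) x * Wh a c b d x) / 2 = 2 * S1 x * kron a 3 * kron b 3"
    by (simp add: forall_4 sum_4 vder_Cot[OF x] Cot_formula[OF x] Ric_formula[OF x] schouten_def Wh_def phi_def psi_def
        w_fef_def gam_def eta_kron dR[OF x] dRb[OF x] dS[OF x] dSb[OF x] cot_k_def cot_m_def cot_kb_def cot_mb_def ds_simps[OF x]
        field_simps)
  then have "(F x)\<^sup>2 * frame2 (e_at x) (\<lambda>i j. of_real (bach g (q x) i j)) a b = F x * (2 * S1 x * kron a 3 * kron b 3)"
    unfolding frame_bach[OF x] weyl_formula[OF x]
    by (simp add: sum_distrib_left[symmetric] distrib_left[symmetric] mult.left_commute[of _ "F x"] flip: times_divide_eq_right)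
  then show ?thesis using F(2)[OF x] by (simp add: power2_eq_square)
qed

lemma bach_eq_0_iff:
  assumes x: "x \<in> P"
  shows "(\<forall>i j. bach g (q x) i j = 0) \<longleftrightarrow> S1 x = 0"
proof -
  have "(\<forall>i j. bach g (q x) i j = 0) \<longleftrightarrow> (\<forall>a b. frame2 (e_at x) (\<lambda>i j. of_real (bach g (q x) i j)) a b = 0)"
    by (simp add: frame2_eq_0_iff[OF x])
  also have "\<dots> \<longleftrightarrow> (\<forall>a b. 2 * S1 x * kron a 3 * kron b 3 = 0)"
    using F(2)[OF x] by (simp flip: bach_formula[OF x])
  also have "\<dots> \<longleftrightarrow> S1 x = 0"
  proof
    assume "\<forall>a b. 2 * S1 x * kron a 3 * kron b 3 = 0"
    then have "2 * S1 x * kron 3 3 * kron 3 3 = 0" by blast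
    then show "S1 x = 0" by simp
  qed simp
  finally show ?thesis .
qed

end

section \<open>The Fefferman metric on the leaf space\<close>

lemma one_form_vder:
  assumes "\<And>v. ext_d (fun_form f) x [v] = \<omega> x [v]" "lin_form_at x \<omega>"
  shows "vder Z f x = ceval \<omega> x (Z x)"
proof -
  have "frechet_derivative f (at x) v = \<omega> x [v]" for v
    using assms(1)[of v] by (simp add: ext_d_def fun_form_def)
  then show ?thesis by (simp add: vder_def ceval_expand[OF assms(2)])
qed

definition cnjv :: "complex^'n \<Rightarrow> complex^'n" where "cnjv z = (\<chi> j. cnj (z $ j))"

lemma ceval_cnjv:
  assumes "lin_form_at x \<omega>"
  shows "ceval \<omega> x (cnjv z) = cnj (ceval (cnj_form \<omega>) x z)"
  unfolding ceval_expand[OF assms] ceval_expand[OF lin_form_at_intros(3)[OF assms]]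
  by (simp add: cnjv_def cnj_form_def)

text \<open>\<open>\<omega>\<close>, of degree \<open>k + 1\<close>, lies in the ideal generated by \<open>\<beta>s\<close>, in the weak sense that
  with the first \<open>k\<close> slots filled it is a combination of the \<open>\<beta>s\<close>.\<close>

definition in_ideal :: "'a \<Rightarrow> 'a cform \<Rightarrow> nat \<Rightarrow> 'a cform list \<Rightarrow> bool" where
  "in_ideal x \<omega> k \<beta>s \<longleftrightarrow>
     (\<forall>us. length us = k \<longrightarrow> (\<exists>c. \<forall>v. \<omega> x (us @ [v]) = (\<Sum>m<length \<beta>s. c m * (\<beta>s ! m) x [v])))"

definition nonzero_in_ideal :: "'a \<Rightarrow> 'a cform \<Rightarrow> nat \<Rightarrow> 'a cform list \<Rightarrow> bool" where
  "nonzero_in_ideal x \<omega> k \<beta>s \<longleftrightarrow> in_ideal x \<omega> k \<beta>s \<and> (\<exists>vs. length vs = Suc k \<and> \<omega> x vs \<noteq> 0)"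

text \<open>Expansion by the slot of the last vector \<open>v\<close>: when \<open>v\<close> is
  inserted into the old form the result stays a combination of the old factors, and the one term
  with \<open>v\<close> in the new factor has the old value as coefficient.\<close>

lemma wedge_last_slot:
  assumes "in_ideal x \<omega> k \<beta>s"
    and len: "length vs = Suc k"
  obtains c where "\<And>v. (\<omega> \<and>\<^sub>f \<beta>) x (vs @ [v]) = (\<Sum>m<Suc (length \<beta>s). c m * ((\<beta>s @ [\<beta>]) ! m) x [v])"
    and "c (length \<beta>s) = \<omega> x vs"
proof -
  have "length (drop_nth i vs) = k" if "i < Suc k" for i
    using that len by (simp add: drop_nth_def)
  then have "\<forall>i\<in>{..<Suc k}. \<exists>c. \<forall>v. \<omega> x (drop_nth i vs @ [v]) = (\<Sum>m<length \<beta>s. c m * (\<beta>s ! m) x [v])"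
    using assms(1) unfolding in_ideal_def by blast
  from bchoice[OF this] obtain C
    where C0: "\<forall>i\<in>{..<Suc k}. \<forall>v. \<omega> x (drop_nth i vs @ [v]) = (\<Sum>m<length \<beta>s. C i m * (\<beta>s ! m) x [v])" ..
  have C: "\<omega> x (drop_nth i vs @ [v]) = (\<Sum>m<length \<beta>s. C i m * (\<beta>s ! m) x [v])" if "i < Suc k" for i v
    using C0[rule_format, of i v] that by simp
  define d where "d m = (\<Sum>i<Suc k. (-1) ^ (Suc k - i) * C i m * \<beta> x [vs ! i])" for m
  define c where "c m = (if m < length \<beta>s then d m else \<omega> x vs)" for m
  show thesis
  proof (rule that)
    fix v
    have drop: "drop_nth i (vs @ [v]) = drop_nth i vs @ [v]" "(vs @ [v]) ! i = vs ! i" if "i < Suc k" for i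
      using that len by (simp_all add: drop_nth_def nth_append)
    have last: "drop_nth (Suc k) (vs @ [v]) = vs" "(vs @ [v]) ! Suc k = v"
      using len by (simp_all add: drop_nth_def nth_append)
    have "(\<omega> \<and>\<^sub>f \<beta>) x (vs @ [v]) = (\<Sum>i<Suc k. (-1) ^ (Suc k - i) * \<omega> x (drop_nth i (vs @ [v])) * \<beta> x [(vs @ [v]) ! i])
        + \<omega> x vs * \<beta> x [v]"
      using len last by (simp add: form_wedge_def sum.lessThan_Suc[of _ "Suc k"])
    also have "(\<Sum>i<Suc k. (-1) ^ (Suc k - i) * \<omega> x (drop_nth i (vs @ [v])) * \<beta> x [(vs @ [v]) ! i])
      = (\<Sum>i<Suc k. \<Sum>m<length \<beta>s. (-1) ^ (Suc k - i) * C i m * \<beta> x [vs ! i] * (\<beta>s ! m) x [v])"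
      by (rule sum.cong[OF refl]) (simp add: drop C sum_distrib_left sum_distrib_right mult_ac)
    also have "\<dots> = (\<Sum>m<length \<beta>s. d m * (\<beta>s ! m) x [v])"
      unfolding d_def sum_distrib_right by (rule sum.swap)
    finally show "(\<omega> \<and>\<^sub>f \<beta>) x (vs @ [v]) = (\<Sum>m<Suc (length \<beta>s). c m * ((\<beta>s @ [\<beta>]) ! m) x [v])"
      by (simp add: c_def nth_append)
  qed (simp add: c_def)
qed

text \<open>If the new product vanished for all last vectors, independence would annihilate the
  coefficient of the new factor, which is a nonzero value of the old product.\<close>

lemma nonzero_in_ideal_wedge:
  assumes good: "nonzero_in_ideal x \<omega> k \<beta>s" and indep: "lin_indep_at x (\<beta>s @ [\<beta>])"
  shows "nonzero_in_ideal x (\<omega> \<and>\<^sub>f \<beta>) (Suc k) (\<beta>s @ [\<beta>])"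
  unfolding nonzero_in_ideal_def
proof
  have ideal: "in_ideal x \<omega> k \<beta>s"
    using good by (simp add: nonzero_in_ideal_def)
  show "in_ideal x (\<omega> \<and>\<^sub>f \<beta>) (Suc k) (\<beta>s @ [\<beta>])"
    unfolding in_ideal_def using wedge_last_slot[OF ideal, of _ \<beta>] by (metis length_append_singleton)
  obtain vs where vs: "length vs = Suc k" "\<omega> x vs \<noteq> 0"
    using good by (auto simp: nonzero_in_ideal_def)
  obtain c where c: "\<And>v. (\<omega> \<and>\<^sub>f \<beta>) x (vs @ [v]) = (\<Sum>m<Suc (length \<beta>s). c m * ((\<beta>s @ [\<beta>]) ! m) x [v])"
    "c (length \<beta>s) = \<omega> x vs"
    using wedge_last_slot[OF ideal vs(1), of \<beta>] by metis
  have "\<exists>v. (\<omega> \<and>\<^sub>f \<beta>) x (vs @ [v]) \<noteq> 0"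
  proof (rule ccontr)
    assume "\<nexists>v. (\<omega> \<and>\<^sub>f \<beta>) x (vs @ [v]) \<noteq> 0"
    then have "\<forall>v. (\<Sum>m<length (\<beta>s @ [\<beta>]). c m * ((\<beta>s @ [\<beta>]) ! m) x [v]) = 0"
      using c(1) by simp
    then have "c (length \<beta>s) = 0"
      using indep unfolding lin_indep_at_def by simp
    then show False using c(2) vs(2) by simp
  qed
  then obtain v where "(\<omega> \<and>\<^sub>f \<beta>) x (vs @ [v]) \<noteq> 0" by blast
  then show "\<exists>vs. length vs = Suc (Suc k) \<and> (\<omega> \<and>\<^sub>f \<beta>) x vs \<noteq> 0"
    using vs(1) by (intro exI[of _ "vs @ [v]"]) simp
qed

lemma lin_indep_at_butlast:
  assumes "lin_indep_at x (\<beta>s @ [\<beta>])"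
  shows "lin_indep_at x \<beta>s"
  unfolding lin_indep_at_def
proof (intro allI impI)
  fix c :: "nat \<Rightarrow> complex" and i
  assume z: "\<forall>v. (\<Sum>i<length \<beta>s. c i * (\<beta>s ! i) x [v]) = 0" and i: "i < length \<beta>s"
  let ?c = "\<lambda>m. if m < length \<beta>s then c m else 0"
  have "\<forall>v. (\<Sum>m<length (\<beta>s @ [\<beta>]). ?c m * ((\<beta>s @ [\<beta>]) ! m) x [v]) = 0"
    using z by (simp add: nth_append)
  then have "\<forall>m<length (\<beta>s @ [\<beta>]). ?c m = 0"
    using assms unfolding lin_indep_at_def by (elim allE[of _ ?c]) blast
  from this[rule_format, of i] i show "c i = 0" by simp
qed

lemma nonzero_in_ideal_single:
  assumes "lin_indep_at x [\<alpha>]"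
  shows "nonzero_in_ideal x \<alpha> 0 [\<alpha>]"
proof -
  have "\<exists>v. \<alpha> x [v] \<noteq> 0"
  proof (rule ccontr)
    assume "\<nexists>v. \<alpha> x [v] \<noteq> 0"
    then have "\<forall>v. (\<Sum>i<length [\<alpha>]. 1 * ([\<alpha>] ! i) x [v]) = 0" by simp
    then show False
      using assms[unfolded lin_indep_at_def, rule_format, of "\<lambda>_. 1" 0] by simp
  qed
  then obtain v where "\<alpha> x [v] \<noteq> 0" by blast
  then show ?thesis
    unfolding nonzero_in_ideal_def in_ideal_def by (auto intro!: exI[of _ "\<lambda>_. 1"] exI[of _ "[v]"])
qed

lemma wedge5_nonzero:
  assumes "lin_indep_at x [\<alpha>, \<beta>, \<gamma>, \<delta>, \<epsilon>]"
  shows "\<exists>v1 v2 v3 v4 v5. (\<alpha> \<and>\<^sub>f \<beta> \<and>\<^sub>f \<gamma> \<and>\<^sub>f \<delta> \<and>\<^sub>f \<epsilon>) x [v1, v2, v3, v4, v5] \<noteq> 0"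
proof -
  have i4: "lin_indep_at x [\<alpha>, \<beta>, \<gamma>, \<delta>]" using lin_indep_at_butlast[of x "[\<alpha>, \<beta>, \<gamma>, \<delta>]" \<epsilon>] assms by simp
  have i3: "lin_indep_at x [\<alpha>, \<beta>, \<gamma>]" using lin_indep_at_butlast[of x "[\<alpha>, \<beta>, \<gamma>]" \<delta>] i4 by simp
  have i2: "lin_indep_at x [\<alpha>, \<beta>]" using lin_indep_at_butlast[of x "[\<alpha>, \<beta>]" \<gamma>] i3 by simp
  have i1: "lin_indep_at x [\<alpha>]" using lin_indep_at_butlast[of x "[\<alpha>]" \<beta>] i2 by simp
  have "nonzero_in_ideal x (\<alpha> \<and>\<^sub>f \<beta> \<and>\<^sub>f \<gamma> \<and>\<^sub>f \<delta> \<and>\<^sub>f \<epsilon>) 4 [\<alpha>, \<beta>, \<gamma>, \<delta>, \<epsilon>]"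
    using nonzero_in_ideal_wedge[OF nonzero_in_ideal_wedge[OF nonzero_in_ideal_wedge[OF nonzero_in_ideal_wedge[OF nonzero_in_ideal_single[OF i1], of \<beta>], of \<gamma>], of \<delta>], of \<epsilon>]
      i2 i3 i4 assms by (simp add: eval_nat_numeral)
  then obtain vs where "length vs = 5" "(\<alpha> \<and>\<^sub>f \<beta> \<and>\<^sub>f \<gamma> \<and>\<^sub>f \<delta> \<and>\<^sub>f \<epsilon>) x vs \<noteq> 0"
    unfolding nonzero_in_ideal_def by auto
  then show ?thesis by (auto simp: eval_nat_numeral length_Suc_conv) blast
qed

lemma wedge_expand:
  "(\<omega> \<and>\<^sub>f \<alpha>) x [u, v, w] = \<omega> x [u, v] * \<alpha> x [w] - \<omega> x [u, w] * \<alpha> x [v] + \<omega> x [v, w] * \<alpha> x [u]"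
  "(\<omega> \<and>\<^sub>f \<alpha>) x [u, v, w, y] = \<omega> x [u, v, w] * \<alpha> x [y] - \<omega> x [u, v, y] * \<alpha> x [w]
     + \<omega> x [u, w, y] * \<alpha> x [v] - \<omega> x [v, w, y] * \<alpha> x [u]"
  "(\<omega> \<and>\<^sub>f \<alpha>) x [u, v, w, y, z] = \<omega> x [u, v, w, y] * \<alpha> x [z] - \<omega> x [u, v, w, z] * \<alpha> x [y]
     + \<omega> x [u, v, y, z] * \<alpha> x [w] - \<omega> x [u, w, y, z] * \<alpha> x [v] + \<omega> x [v, w, y, z] * \<alpha> x [u]"
  by (simp_all add: form_wedge_def drop_nth_def lessThan_Suc)

text \<open>A multiple of a later factor drops out as soon as that factor is reached. Removing it at
  this stage keeps the expansions short.\<close>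

lemma wedge5_alternating:
  assumes "\<And>v. \<omega> x [v] = a * \<alpha> x [v] + b * \<beta> x [v] + c * \<gamma> x [v] + d * \<delta> x [v] + e * \<epsilon> x [v]"
  shows "(\<omega> \<and>\<^sub>f \<beta> \<and>\<^sub>f \<gamma> \<and>\<^sub>f \<delta> \<and>\<^sub>f \<epsilon>) x [v1, v2, v3, v4, v5] = a * (\<alpha> \<and>\<^sub>f \<beta> \<and>\<^sub>f \<gamma> \<and>\<^sub>f \<delta> \<and>\<^sub>f \<epsilon>) x [v1, v2, v3, v4, v5]"
proof -
  have 2: "(\<omega> \<and>\<^sub>f \<beta>) x [u, v] = a * (\<alpha> \<and>\<^sub>f \<beta>) x [u, v] + c * (\<gamma> \<and>\<^sub>f \<beta>) x [u, v]
      + d * (\<delta> \<and>\<^sub>f \<beta>) x [u, v] + e * (\<epsilon> \<and>\<^sub>f \<beta>) x [u, v]" for u v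
    by (simp add: wedge_two assms algebra_simps)
  have "(\<omega> \<and>\<^sub>f \<beta> \<and>\<^sub>f \<gamma>) x [u, v, w] = a * (\<alpha> \<and>\<^sub>f \<beta> \<and>\<^sub>f \<gamma>) x [u, v, w] + c * (\<gamma> \<and>\<^sub>f \<beta> \<and>\<^sub>f \<gamma>) x [u, v, w]
      + d * (\<delta> \<and>\<^sub>f \<beta> \<and>\<^sub>f \<gamma>) x [u, v, w] + e * (\<epsilon> \<and>\<^sub>f \<beta> \<and>\<^sub>f \<gamma>) x [u, v, w]" for u v w
    unfolding wedge_expand(1) 2 by (simp add: algebra_simps)
  moreover have "(\<gamma> \<and>\<^sub>f \<beta> \<and>\<^sub>f \<gamma>) x [u, v, w] = 0" for u v w
    by (simp add: wedge_expand(1) wedge_two algebra_simps)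
  ultimately have 3: "(\<omega> \<and>\<^sub>f \<beta> \<and>\<^sub>f \<gamma>) x [u, v, w] = a * (\<alpha> \<and>\<^sub>f \<beta> \<and>\<^sub>f \<gamma>) x [u, v, w]
      + d * (\<delta> \<and>\<^sub>f \<beta> \<and>\<^sub>f \<gamma>) x [u, v, w] + e * (\<epsilon> \<and>\<^sub>f \<beta> \<and>\<^sub>f \<gamma>) x [u, v, w]" for u v w
    by simp
  have "(\<omega> \<and>\<^sub>f \<beta> \<and>\<^sub>f \<gamma> \<and>\<^sub>f \<delta>) x [u, v, w, y] = a * (\<alpha> \<and>\<^sub>f \<beta> \<and>\<^sub>f \<gamma> \<and>\<^sub>f \<delta>) x [u, v, w, y]
      + d * (\<delta> \<and>\<^sub>f \<beta> \<and>\<^sub>f \<gamma> \<and>\<^sub>f \<delta>) x [u, v, w, y] + e * (\<epsilon> \<and>\<^sub>f \<beta> \<and>\<^sub>f \<gamma> \<and>\<^sub>f \<delta>) x [u, v, w, y]" for u v w y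
    unfolding wedge_expand(2) 3 by (simp add: algebra_simps)
  moreover have "(\<delta> \<and>\<^sub>f \<beta> \<and>\<^sub>f \<gamma> \<and>\<^sub>f \<delta>) x [u, v, w, y] = 0" for u v w y
    by (simp add: wedge_expand(1,2) wedge_two algebra_simps)
  ultimately have 4: "(\<omega> \<and>\<^sub>f \<beta> \<and>\<^sub>f \<gamma> \<and>\<^sub>f \<delta>) x [u, v, w, y] = a * (\<alpha> \<and>\<^sub>f \<beta> \<and>\<^sub>f \<gamma> \<and>\<^sub>f \<delta>) x [u, v, w, y]
      + e * (\<epsilon> \<and>\<^sub>f \<beta> \<and>\<^sub>f \<gamma> \<and>\<^sub>f \<delta>) x [u, v, w, y]" for u v w y
    by simp
  have "(\<omega> \<and>\<^sub>f \<beta> \<and>\<^sub>f \<gamma> \<and>\<^sub>f \<delta> \<and>\<^sub>f \<epsilon>) x [v1, v2, v3, v4, v5] = a * (\<alpha> \<and>\<^sub>f \<beta> \<and>\<^sub>f \<gamma> \<and>\<^sub>f \<delta> \<and>\<^sub>f \<epsilon>) x [v1, v2, v3, v4, v5]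
      + e * (\<epsilon> \<and>\<^sub>f \<beta> \<and>\<^sub>f \<gamma> \<and>\<^sub>f \<delta> \<and>\<^sub>f \<epsilon>) x [v1, v2, v3, v4, v5]"
    unfolding wedge_expand(3) 4 by (simp add: algebra_simps)
  moreover have "(\<epsilon> \<and>\<^sub>f \<beta> \<and>\<^sub>f \<gamma> \<and>\<^sub>f \<delta> \<and>\<^sub>f \<epsilon>) x [v1, v2, v3, v4, v5] = 0"
    by (simp add: wedge_expand wedge_two algebra_simps)
  ultimately show ?thesis by simp
qed

section \<open>The dual frame on \<open>P\<close> and the structure equations\<close>

context fefferman_metric
begin

abbreviation coframe8 :: "(real^8) cform list" where
  "coframe8 \<equiv> cartan_coframe th1 th3 Om2 Om3 Om4"

lemma less8: "i < 8 \<longleftrightarrow> i = 0 \<or> i = 1 \<or> i = 2 \<or> i = 3 \<or> i = 4 \<or> i = 5 \<or> i = 6 \<or> i = (7::nat)"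
  by auto

lemma sum8: "(\<Sum>k<8. f k) = f 0 + f 1 + f 2 + f 3 + f 4 + f 5 + f 6 + f (7::nat)"
  by (simp add: eval_nat_numeral)

lemma smooth_coframe: "i < 8 \<Longrightarrow> smooth_one_form P (coframe8 ! i)"
  using smooth_forms by (auto simp: less8 intro: smooth_one_form_cnj[OF open_P])

definition is_dual :: "(nat \<Rightarrow> real^8 \<Rightarrow> complex^8) \<Rightarrow> bool" where
  "is_dual E \<longleftrightarrow> (\<forall>i<8. smooth_field P (E i)) \<and>
     (\<forall>x\<in>P. \<forall>i<8. \<forall>j<8. ceval (coframe8 ! i) x (E j x) = (if i = j then 1 else 0)) \<and>
     (\<forall>x\<in>P. \<forall>z. z = (\<Sum>i<8. ceval (coframe8 ! i) x z *s E i x))"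

text \<open>A dual frame fixed once by choice. Counting from 0, the fields are \<open>X1\<close>,
  \<open>X2\<close>, \<open>X3\<close>, \<open>Y2\<close>, \<open>Y2b\<close>, \<open>Y3\<close>,
  \<open>Y3b\<close>, \<open>Y4\<close>.\<close>

definition Z :: "nat \<Rightarrow> real^8 \<Rightarrow> complex^8" where "Z = (SOME E. is_dual E)"

lemma Z_dual: "is_dual Z"
proof -
  obtain E :: "nat \<Rightarrow> real^8 \<Rightarrow> complex^8"
    where "\<And>i. i < CARD(8) \<Longrightarrow> smooth_field P (E i)"
    and "\<And>x i j. x \<in> P \<Longrightarrow> i < CARD(8) \<Longrightarrow> j < CARD(8) \<Longrightarrow> ceval (coframe8 ! i) x (E j x) = (if i = j then 1 else 0)"
    and "\<And>x z. x \<in> P \<Longrightarrow> z = (\<Sum>i<CARD(8). ceval (coframe8 ! i) x z *s E i x)"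
    by (rule dual_frame_exists[where U = P and \<omega>s = coframe8]) (use open_P smooth_coframe coframe in auto)
  then have "is_dual E" unfolding is_dual_def by simp
  then show ?thesis unfolding Z_def using someI[of is_dual E] by blast
qed

lemma smooth_Z: "i < 8 \<Longrightarrow> smooth_field P (Z i)"
  using Z_dual by (simp add: is_dual_def)

lemma Z_eval: "x \<in> P \<Longrightarrow> i < 8 \<Longrightarrow> j < 8 \<Longrightarrow> ceval (coframe8 ! i) x (Z j x) = (if i = j then 1 else 0)"
  using Z_dual by (simp add: is_dual_def)

lemma Z_complete: "x \<in> P \<Longrightarrow> z = (\<Sum>i<8. ceval (coframe8 ! i) x z *s Z i x)"
  using Z_dual unfolding is_dual_def by blast

lemma ceval_Z:
  assumes "x \<in> P" "j < 8"
  shows "ceval th1 x (Z j x) = (if j = 0 then 1 else 0)" "ceval (cnj_form th1) x (Z j x) = (if j = 1 then 1 else 0)"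
    "ceval th3 x (Z j x) = (if j = 2 then 1 else 0)" "ceval Om2 x (Z j x) = (if j = 3 then 1 else 0)"
    "ceval (cnj_form Om2) x (Z j x) = (if j = 4 then 1 else 0)" "ceval Om3 x (Z j x) = (if j = 5 then 1 else 0)"
    "ceval (cnj_form Om3) x (Z j x) = (if j = 6 then 1 else 0)" "ceval Om4 x (Z j x) = (if j = 7 then 1 else 0)"
  using Z_eval[OF assms(1) _ assms(2), of 0] Z_eval[OF assms(1) _ assms(2), of 1] Z_eval[OF assms(1) _ assms(2), of 2]
    Z_eval[OF assms(1) _ assms(2), of 3] Z_eval[OF assms(1) _ assms(2), of 4] Z_eval[OF assms(1) _ assms(2), of 5]
    Z_eval[OF assms(1) _ assms(2), of 6] Z_eval[OF assms(1) _ assms(2), of 7] by auto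

lemma lin:
  assumes "x \<in> P"
  shows "lin_form_at x th1" "lin_form_at x th3" "lin_form_at x Om2" "lin_form_at x Om3" "lin_form_at x Om4"
    "lin_form_at x (cnj_form th1)" "lin_form_at x (cnj_form th3)" "lin_form_at x (cnj_form Om2)"
    "lin_form_at x (cnj_form Om3)" "lin_form_at x (cnj_form Om4)"
  using smooth_one_form_lin[OF smooth_forms(1) assms] smooth_one_form_lin[OF smooth_forms(2) assms]
    smooth_one_form_lin[OF smooth_forms(3) assms] smooth_one_form_lin[OF smooth_forms(4) assms]
    smooth_one_form_lin[OF smooth_forms(5) assms] by (simp_all add: lin_form_at_intros)

lemma real_cnj:
  assumes "x \<in> P"
  shows "ceval (cnj_form th3) x z = ceval th3 x z" "ceval (cnj_form Om4) x z = ceval Om4 x z"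
  using real_forms assms by (auto simp: ceval_def cnj_form_def real_one_form_def Reals_cnj_iff)

abbreviation wv :: "(real^8) cform \<Rightarrow> (real^8) cform \<Rightarrow> real^8 \<Rightarrow> complex^8 \<Rightarrow> complex^8 \<Rightarrow> complex" where
  "wv \<alpha> \<beta> x z w \<equiv> ceval \<alpha> x z * ceval \<beta> x w - ceval \<alpha> x w * ceval \<beta> x z"

text \<open>The conjugate equations come from \<open>ext_d_cnj\<close>, with the conjugates of
  \<open>th3\<close> and \<open>Om4\<close> replaced by the real forms themselves.\<close>

lemma structure_equations:
  assumes x: "x \<in> P"
  shows "ceval2 (ext_d th1) x z w = wv Om2 th1 x z w + wv Om3 th3 x z w"
    "ceval2 (ext_d (cnj_form th1)) x z w = wv (cnj_form Om2) (cnj_form th1) x z w + wv (cnj_form Om3) th3 x z w"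
    "ceval2 (ext_d th3) x z w = \<i> * wv th1 (cnj_form th1) x z w + wv Om2 th3 x z w + wv (cnj_form Om2) th3 x z w"
    "ceval2 (ext_d Om2) x z w = 2 * \<i> * wv th1 (cnj_form Om3) x z w + \<i> * wv (cnj_form th1) Om3 x z w + wv Om4 th3 x z w"
    "ceval2 (ext_d (cnj_form Om2)) x z w = - 2 * \<i> * wv (cnj_form th1) Om3 x z w - \<i> * wv th1 (cnj_form Om3) x z w + wv Om4 th3 x z w"
    "ceval2 (ext_d Om3) x z w = wv Om4 th1 x z w + wv Om3 (cnj_form Om2) x z w + R x * wv (cnj_form th1) th3 x z w"
    "ceval2 (ext_d (cnj_form Om3)) x z w = wv Om4 (cnj_form th1) x z w + wv (cnj_form Om3) Om2 x z w + cnj (R x) * wv th1 th3 x z w"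
    "ceval2 (ext_d Om4) x z w = \<i> * wv Om3 (cnj_form Om3) x z w + wv Om4 Om2 x z w + wv Om4 (cnj_form Om2) x z w
      + cnj (S x) * wv th1 th3 x z w + S x * wv (cnj_form th1) th3 x z w"
proof -
  note rules = ceval2_add ceval2_wedge ceval_add ceval_scale lin_form_at_intros lin[OF x] cnj_form_distrib real_cnj[OF x]
  have e_d_th1: "ceval2 (ext_d th1) x z w = ceval2 (Om2 \<and>\<^sub>f th1 +\<^sub>f Om3 \<and>\<^sub>f th3) x z w"
    by (rule ceval2_cong) (rule d_th1[rule_format, OF x])
  have e_d_th3: "ceval2 (ext_d th3) x z w = ceval2 (\<i> *\<^sub>f th1 \<and>\<^sub>f cnj_form th1 +\<^sub>f (Om2 +\<^sub>f cnj_form Om2) \<and>\<^sub>f th3) x z w"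
    by (rule ceval2_cong) (rule d_th3[rule_format, OF x])
  have e_d_Om2: "ceval2 (ext_d Om2) x z w = ceval2 ((2 * \<i>) *\<^sub>f th1 \<and>\<^sub>f cnj_form Om3 +\<^sub>f \<i> *\<^sub>f cnj_form th1 \<and>\<^sub>f Om3 +\<^sub>f Om4 \<and>\<^sub>f th3) x z w"
    by (rule ceval2_cong) (rule d_Om2[rule_format, OF x])
  have e_d_Om3: "ceval2 (ext_d Om3) x z w = ceval2 (Om4 \<and>\<^sub>f th1 +\<^sub>f Om3 \<and>\<^sub>f cnj_form Om2 +\<^sub>f R x *\<^sub>f cnj_form th1 \<and>\<^sub>f th3) x z w"
    by (rule ceval2_cong) (rule d_Om3[rule_format, OF x])
  have e_d_Om4: "ceval2 (ext_d Om4) x z w = ceval2 (\<i> *\<^sub>f Om3 \<and>\<^sub>f cnj_form Om3 +\<^sub>f Om4 \<and>\<^sub>f (Om2 +\<^sub>f cnj_form Om2) +\<^sub>f cnj (S x) *\<^sub>f th1 \<and>\<^sub>f th3 +\<^sub>f S x *\<^sub>f cnj_form th1 \<and>\<^sub>f th3) x z w"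
    by (rule ceval2_cong) (rule d_Om4[rule_format, OF x])
  show "ceval2 (ext_d th1) x z w = wv Om2 th1 x z w + wv Om3 th3 x z w"
    unfolding e_d_th1 by (simp add: rules)
  show "ceval2 (ext_d th3) x z w = \<i> * wv th1 (cnj_form th1) x z w + wv Om2 th3 x z w + wv (cnj_form Om2) th3 x z w"
    unfolding e_d_th3 by (simp add: rules algebra_simps)
  show "ceval2 (ext_d Om2) x z w = 2 * \<i> * wv th1 (cnj_form Om3) x z w + \<i> * wv (cnj_form th1) Om3 x z w + wv Om4 th3 x z w"
    unfolding e_d_Om2 by (simp add: rules algebra_simps)
  show "ceval2 (ext_d Om3) x z w = wv Om4 th1 x z w + wv Om3 (cnj_form Om2) x z w + R x * wv (cnj_form th1) th3 x z w"
    unfolding e_d_Om3 by (simp add: rules algebra_simps)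
  show "ceval2 (ext_d Om4) x z w = \<i> * wv Om3 (cnj_form Om3) x z w + wv Om4 Om2 x z w + wv Om4 (cnj_form Om2) x z w
      + cnj (S x) * wv th1 th3 x z w + S x * wv (cnj_form th1) th3 x z w"
    unfolding e_d_Om4 by (simp add: rules algebra_simps)
  have c1: "ext_d (cnj_form th1) x [u, v] = cnj_form (Om2 \<and>\<^sub>f th1 +\<^sub>f Om3 \<and>\<^sub>f th3) x [u, v]" for u v
    using ext_d_cnj[OF smooth_forms(1) x, of u v] d_th1 x by (simp add: cnj_form_def)
  have e_c1: "ceval2 (ext_d (cnj_form th1)) x z w = ceval2 (cnj_form (Om2 \<and>\<^sub>f th1 +\<^sub>f Om3 \<and>\<^sub>f th3)) x z w"
    by (rule ceval2_cong) (rule c1)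
  show "ceval2 (ext_d (cnj_form th1)) x z w = wv (cnj_form Om2) (cnj_form th1) x z w + wv (cnj_form Om3) th3 x z w"
    unfolding e_c1 by (simp add: rules)
  have c2: "ext_d (cnj_form Om2) x [u, v] = cnj_form ((2 * \<i>) *\<^sub>f th1 \<and>\<^sub>f cnj_form Om3 +\<^sub>f \<i> *\<^sub>f cnj_form th1 \<and>\<^sub>f Om3
        +\<^sub>f Om4 \<and>\<^sub>f th3) x [u, v]" for u v
    using ext_d_cnj[OF smooth_forms(3) x, of u v] d_Om2 x by (simp add: cnj_form_def)
  have e_c2: "ceval2 (ext_d (cnj_form Om2)) x z w = ceval2 (cnj_form ((2 * \<i>) *\<^sub>f th1 \<and>\<^sub>f cnj_form Om3 +\<^sub>f \<i> *\<^sub>f cnj_form th1 \<and>\<^sub>f Om3 +\<^sub>f Om4 \<and>\<^sub>f th3)) x z w"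
    by (rule ceval2_cong) (rule c2)
  show "ceval2 (ext_d (cnj_form Om2)) x z w = - 2 * \<i> * wv (cnj_form th1) Om3 x z w - \<i> * wv th1 (cnj_form Om3) x z w + wv Om4 th3 x z w"
    unfolding e_c2 by (simp add: rules algebra_simps)
  have c3: "ext_d (cnj_form Om3) x [u, v] = cnj_form (Om4 \<and>\<^sub>f th1 +\<^sub>f Om3 \<and>\<^sub>f cnj_form Om2 +\<^sub>f R x *\<^sub>f cnj_form th1 \<and>\<^sub>f th3) x [u, v]" for u v
    using ext_d_cnj[OF smooth_forms(4) x, of u v] d_Om3 x by (simp add: cnj_form_def)
  have e_c3: "ceval2 (ext_d (cnj_form Om3)) x z w = ceval2 (cnj_form (Om4 \<and>\<^sub>f th1 +\<^sub>f Om3 \<and>\<^sub>f cnj_form Om2 +\<^sub>f R x *\<^sub>f cnj_form th1 \<and>\<^sub>f th3)) x z w"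
    by (rule ceval2_cong) (rule c3)
  show "ceval2 (ext_d (cnj_form Om3)) x z w = wv Om4 (cnj_form th1) x z w + wv (cnj_form Om3) Om2 x z w + cnj (R x) * wv th1 th3 x z w"
    unfolding e_c3 by (simp add: rules algebra_simps)
qed

lemma Z_commutator:
  assumes x: "x \<in> P" and f: "smooth_map_on P f" and i: "i < 8" and j: "j < 8"
  shows "vder (Z i) (vder (Z j) f) x - vder (Z j) (vder (Z i) f) x
    = - (\<Sum>k<8. ceval2 (ext_d (coframe8 ! k)) x (Z i x) (Z j x) * vder (Z k) f x)"
  using frame_commutator[where U = P and \<omega>s = coframe8 and E = Z, OF open_P x _ _ _ _ f, of i j]
    smooth_coframe smooth_Z Z_eval Z_complete i j by simp

text \<open>Conjugation permutes the coframe, hence the dual frame in the same way.\<close>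

lemma Z_cnj:
  assumes x: "x \<in> P"
  shows "cnjv (Z 0 x) = Z 1 x" "cnjv (Z 1 x) = Z 0 x" "cnjv (Z 2 x) = Z 2 x" "cnjv (Z 3 x) = Z 4 x" "cnjv (Z 4 x) = Z 3 x"
    "cnjv (Z 5 x) = Z 6 x" "cnjv (Z 6 x) = Z 5 x" "cnjv (Z 7 x) = Z 7 x"
proof -
  have *: "cnjv z = cnj (ceval (cnj_form th1) x z) *s Z 0 x + cnj (ceval th1 x z) *s Z 1 x + cnj (ceval th3 x z) *s Z 2 x
    + cnj (ceval (cnj_form Om2) x z) *s Z 3 x + cnj (ceval Om2 x z) *s Z 4 x + cnj (ceval (cnj_form Om3) x z) *s Z 5 x
    + cnj (ceval Om3 x z) *s Z 6 x + cnj (ceval Om4 x z) *s Z 7 x" for z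
    using Z_complete[OF x, of "cnjv z"] by (simp add: sum8 ceval_cnjv lin[OF x] cnj_form_distrib real_cnj[OF x])
  show "cnjv (Z 0 x) = Z 1 x" "cnjv (Z 1 x) = Z 0 x" "cnjv (Z 2 x) = Z 2 x" "cnjv (Z 3 x) = Z 4 x" "cnjv (Z 4 x) = Z 3 x"
    "cnjv (Z 5 x) = Z 6 x" "cnjv (Z 6 x) = Z 5 x" "cnjv (Z 7 x) = Z 7 x"
    unfolding * by (simp_all add: ceval_Z[OF x])
qed

section \<open>The projection to the leaf space and the horizontal frame\<close>

definition Q :: "4 \<Rightarrow> real^8 \<Rightarrow> complex" where
  "Q i x = of_real (q x $ i)"

lemma smooth_q: "smooth_map_on P q" and q_image: "q ` P = M"
  using leaf_projection by (auto simp: submersion_onto_def)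

lemma smooth_Q: "smooth_map_on P (Q i)"
  unfolding Q_def[abs_def] by (intro smooth_of_real[OF open_P] smooth_nth[OF open_P] smooth_q)

lemma vder_Q:
  assumes x: "x \<in> P"
  shows "vder V (Q i) x = (\<Sum>j\<in>UNIV. V x $ j * of_real (frechet_derivative q (at x) (axis j 1) $ i))"
  unfolding Q_def[abs_def]
  by (rule vder_I[OF bounded_linear.has_derivative[OF bounded_linear_of_real
          bounded_linear.has_derivative[OF bounded_linear_vec_nth smooth_has_derivative[OF smooth_q x]]]])

lemma q_lin: "x \<in> P \<Longrightarrow> bounded_linear (frechet_derivative q (at x))"
  using has_derivative_bounded_linear[OF smooth_has_derivative[OF smooth_q]] .

lemma dq_expand:
  assumes x: "x \<in> P"
  shows "frechet_derivative q (at x) v $ i = (\<Sum>j\<in>UNIV. v $ j * frechet_derivative q (at x) (axis j 1) $ i)"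
proof -
  interpret bounded_linear "frechet_derivative q (at x)" by (rule q_lin[OF x])
  have "frechet_derivative q (at x) v = frechet_derivative q (at x) (\<Sum>j\<in>UNIV. v $ j *\<^sub>R axis j 1)"
    by (simp add: basis_expansion[of v, unfolded scalar_mult_eq_scaleR])
  then show ?thesis by (simp only: sum scaleR sum_component vector_scaleR_component real_scaleR_def)
qed

text \<open>\<open>leaf_tangent\<close> speaks of real vectors only. The four fields span a space
  stable under conjugation, so it contains the real and imaginary parts of each of them.\<close>

lemma vertical_kill:
  assumes x: "x \<in> P"
  shows "vder (Z 3) (Q i) x = - vder (Z 4) (Q i) x" "vder (Z 5) (Q i) x = 0" "vder (Z 6) (Q i) x = 0" "vder (Z 7) (Q i) x = 0"
proof -
  define B where "B = {Z 3 x + Z 4 x, Z 5 x, Z 6 x, Z 7 x}"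
  define L where "L z = (\<Sum>j\<in>UNIV. z $ j * complex_of_real (frechet_derivative q (at x) (axis j 1) $ i))" for z :: "complex^8"
  have dual: "dual_frame_at x coframe8 [Z 0 x, Z 1 x, Z 2 x, Z 3 x, Z 4 x, Z 5 x, Z 6 x, Z 7 x]"
  proof -
    have "[Z 0 x, Z 1 x, Z 2 x, Z 3 x, Z 4 x, Z 5 x, Z 6 x, Z 7 x] ! j = Z j x" if "j < 8" for j
      using that unfolding less8 by auto
    then show ?thesis unfolding dual_frame_at_def using Z_eval[OF x] by simp
  qed
  have real: "frechet_derivative q (at x) v = 0" if "cvec v \<in> vec.span B" for v
    using that dual leaf_tangent x unfolding fefferman_distribution_def B_def by blast
  have kill: "L z = 0" if z: "z \<in> vec.span B" and zc: "cnjv z \<in> vec.span B" for z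
  proof -
    have "cvec (\<chi> j. Re (z $ j)) = (1/2) *s (z + cnjv z)"
      by (simp add: vec_eq_iff cvec_def cnjv_def complex_eq_iff)
    then have 1: "frechet_derivative q (at x) (\<chi> j. Re (z $ j)) = 0"
      using z zc by (intro real) (simp add: vec.span_scale vec.span_add)
    have "cvec (\<chi> j. Im (z $ j)) = (- \<i> / 2) *s (z - cnjv z)"
      by (simp add: vec_eq_iff cvec_def cnjv_def complex_eq_iff)
    then have 2: "frechet_derivative q (at x) (\<chi> j. Im (z $ j)) = 0"
      using z zc by (intro real) (simp only: vec.span_scale vec.span_diff)
    have "L z = (\<Sum>j\<in>UNIV. (complex_of_real (Re (z $ j)) + \<i> * complex_of_real (Im (z $ j))) * complex_of_real (frechet_derivative q (at x) (axis j 1) $ i))"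
      unfolding L_def by (simp only: complex_eq[symmetric])
    also have "\<dots> = of_real (frechet_derivative q (at x) (\<chi> j. Re (z $ j)) $ i) + \<i> * of_real (frechet_derivative q (at x) (\<chi> j. Im (z $ j)) $ i)"
      unfolding dq_expand[OF x, of "\<chi> j. Re (z $ j)"] dq_expand[OF x, of "\<chi> j. Im (z $ j)"]
      by (simp add: sum_distrib_left sum.distrib algebra_simps)
    finally show ?thesis using 1 2 by simp
  qed
  have sp: "Z 3 x + Z 4 x \<in> vec.span B" "Z 5 x \<in> vec.span B" "Z 6 x \<in> vec.span B" "Z 7 x \<in> vec.span B"
    by (intro vec.span_base; simp add: B_def)+
  have "cnjv (Z 3 x + Z 4 x) = Z 3 x + Z 4 x"
    using Z_cnj(4,5)[OF x] by (simp add: cnjv_def vec_eq_iff)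
  then have "L (Z 3 x + Z 4 x) = 0" using sp by (intro kill) auto
  then show "vder (Z 3) (Q i) x = - vder (Z 4) (Q i) x"
    by (simp add: vder_Q[OF x] L_def algebra_simps sum.distrib add_eq_0_iff)
  show "vder (Z 5) (Q i) x = 0" "vder (Z 6) (Q i) x = 0" "vder (Z 7) (Q i) x = 0"
    using kill[of "Z 5 x"] kill[of "Z 6 x"] kill[of "Z 7 x"] sp Z_cnj[OF x] by (simp_all add: vder_Q[OF x] L_def)
qed

text \<open>The fourth field is dual to \<open>(\<Omega>\<^sub>2 - \<Omega>\<^sub>2\<^sup>b) / 3\<i>\<close>; it is real.\<close>

definition X :: "4 \<Rightarrow> real^8 \<Rightarrow> complex^8" where
  "X a = (if a = 1 then Z 0 else if a = 2 then Z 1 else if a = 3 then Z 2 else (\<lambda>x. (3 * \<i> / 2) *s (Z 3 x - Z 4 x)))"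

lemma X_simps:
  "X 1 = Z 0" "X 2 = Z 1" "X 3 = Z 2"
  "vder (X 4) f x = 3 * \<i> / 2 * (vder (Z 3) f x - vder (Z 4) f x)"
proof -
  have "X 4 = (\<lambda>x. (3 * \<i> / 2) *s (Z 3 x - Z 4 x))" by (simp add: X_def)
  then show "vder (X 4) f x = 3 * \<i> / 2 * (vder (Z 3) f x - vder (Z 4) f x)"
    by (simp only: vder_field_scale)
qed (simp_all add: X_def)

lemma smooth_X: "smooth_field P (X a)"
proof -
  have "smooth_map_on P (\<lambda>x. 3 * \<i> / 2 * (Z 3 x $ j - Z 4 x $ j))" for j
    using smooth_Z[of 3] smooth_Z[of 4] unfolding smooth_field_def
    by (intro smooth_mult[OF open_P] smooth_diff[OF open_P] smooth_const) auto
  then have "smooth_field P (\<lambda>x. (3 * \<i> / 2) *s (Z 3 x - Z 4 x))"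
    by (simp only: smooth_field_def vector_smult_component vector_minus_component simp_thms)
  then show ?thesis
    using smooth_Z[of 0] smooth_Z[of 1] smooth_Z[of 2] by (simp add: X_def split: if_split)
qed

lemma smooth_vder_Z: "smooth_map_on P f \<Longrightarrow> i < 8 \<Longrightarrow> smooth_map_on P (vder (Z i) f)"
  by (rule smooth_vder[OF open_P smooth_Z])

lemma vder_X4_right:
  assumes x: "x \<in> P" and f: "smooth_map_on P f"
  shows "vder V (vder (X 4) f) x = 3 * \<i> / 2 * (vder V (vder (Z 3) f) x - vder V (vder (Z 4) f) x)"
proof -
  have sm: "smooth_map_on P (vder (Z 3) f)" "smooth_map_on P (vder (Z 4) f)"
    by (simp_all add: smooth_vder_Z[OF f])
  have "vder V (vder (X 4) f) x = vder V (\<lambda>x. 3 * \<i> / 2 * (vder (Z 3) f x - vder (Z 4) f x)) x"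
    by (rule vder_cong[OF open_P x]) (rule X_simps(4))
  then show ?thesis
    using vder_cmult[OF x smooth_diff[OF open_P sm(1,2)]] vder_diff[OF x sm(1,2)] by metis
qed

text \<open>\<open>Om3\<close>, its conjugate and \<open>Om4\<close> vanish on all
  \<open>X a\<close>, and each term of \<open>d Om2\<close> contains one of them. The brackets
  therefore have no component along \<open>Z 3\<close> or \<open>Z 4\<close>.\<close>

lemma X_commutator:
  assumes x: "x \<in> P" and f: "smooth_map_on P f"
  shows "vder (X a) (vder (X b) f) x - vder (X b) (vder (X a) f) x = (\<Sum>c\<in>UNIV. C_fef a b c * vder (X c) f x)
    - (kron a 2 * kron b 3 - kron a 3 * kron b 2) * (R x * vder (Z 5) f x + S x * vder (Z 7) f x)
    - (kron a 1 * kron b 3 - kron a 3 * kron b 1) * (cnj (R x) * vder (Z 6) f x + cnj (S x) * vder (Z 7) f x)"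
proof -
  note cm = Z_commutator[OF x f]
  have "\<forall>a b. vder (X a) (vder (X b) f) x - vder (X b) (vder (X a) f) x = (\<Sum>c\<in>UNIV. C_fef a b c * vder (X c) f x)
    - (kron a 2 * kron b 3 - kron a 3 * kron b 2) * (R x * vder (Z 5) f x + S x * vder (Z 7) f x)
    - (kron a 1 * kron b 3 - kron a 3 * kron b 1) * (cnj (R x) * vder (Z 6) f x + cnj (S x) * vder (Z 7) f x)"
    using cm[of 0 1] cm[of 0 2] cm[of 1 2] cm[of 0 3] cm[of 0 4] cm[of 1 3] cm[of 1 4] cm[of 2 3] cm[of 2 4] 
    by (simp add: forall_4 sum_4 C_fef_def X_simps vder_X4_right[OF x f] sum8 structure_equations[OF x] ceval_Z[OF x])
      (auto simp: field_simps)
  then show ?thesis by blast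
qed

definition E :: "4 \<Rightarrow> 4 \<Rightarrow> real^8 \<Rightarrow> complex" where
  "E a i = vder (X a) (Q i)"

lemma smooth_E: "smooth_map_on P (E a i)"
  unfolding E_def by (rule smooth_vder[OF open_P smooth_X smooth_Q])

lemma vder_E_vertical:
  assumes x: "x \<in> P"
  shows "vder (Z 5) (E c i) x = kron c 2 * E 4 i x - kron c 3 * E 1 i x"
    "vder (Z 6) (E c i) x = kron c 1 * E 4 i x - kron c 3 * E 2 i x"
    "vder (Z 7) (E c i) x = 0"
proof -
  have 0: "vder V (vder (Z k) (Q i)) x = 0" if "k = 5 \<or> k = 6 \<or> k = 7" for V k
  proof -
    have "vder V (vder (Z k) (Q i)) x = vder V (\<lambda>x. 0) x"
      by (rule vder_cong[OF open_P x]) (use that vertical_kill in auto)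
    then show ?thesis by (simp add: vder_const)
  qed
  note cm = Z_commutator[OF x smooth_Q]
  have E4: "E 4 i x = - 3 * \<i> * vder (Z 4) (Q i) x"
    by (simp add: E_def X_simps vertical_kill[OF x])
  have "\<forall>c. vder (Z 5) (E c i) x = kron c 2 * E 4 i x - kron c 3 * E 1 i x"
    using cm[of 5 0 i] cm[of 5 1 i] cm[of 5 2 i] cm[of 5 3 i] cm[of 5 4 i]
    by (simp add: forall_4 E4) (simp add: E_def X_simps vder_X4_right[OF x smooth_Q] sum8 structure_equations[OF x]
      ceval_Z[OF x] vertical_kill[OF x] 0)
  then show "vder (Z 5) (E c i) x = kron c 2 * E 4 i x - kron c 3 * E 1 i x" by blast
  have "\<forall>c. vder (Z 6) (E c i) x = kron c 1 * E 4 i x - kron c 3 * E 2 i x"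
    using cm[of 6 0 i] cm[of 6 1 i] cm[of 6 2 i] cm[of 6 3 i] cm[of 6 4 i]
    by (simp add: forall_4 E4) (simp add: E_def X_simps vder_X4_right[OF x smooth_Q] sum8 structure_equations[OF x]
      ceval_Z[OF x] vertical_kill[OF x] 0)
  then show "vder (Z 6) (E c i) x = kron c 1 * E 4 i x - kron c 3 * E 2 i x" by blast
  have "\<forall>c. vder (Z 7) (E c i) x = 0"
    using cm[of 7 0 i] cm[of 7 1 i] cm[of 7 2 i] cm[of 7 3 i] cm[of 7 4 i]
    by (simp add: forall_4) (simp add: E_def X_simps vder_X4_right[OF x smooth_Q] sum8 structure_equations[OF x]
      ceval_Z[OF x] vertical_kill[OF x] 0)
  then show "vder (Z 7) (E c i) x = 0" by blast
qed

section \<open>The conformal factor and its derivatives\<close>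

text \<open>Both sides of \<open>descends\<close> are extended bilinearly from real basis vectors to
  complex fields.\<close>

lemma descends_complex:
  assumes x: "x \<in> P"
  obtains c :: real where "c > 0" "\<And>V W. (\<Sum>i\<in>UNIV. \<Sum>j\<in>UNIV. vder V (Q i) x * vder W (Q j) x * of_real (g (q x) $ i $ j))
    = of_real c * (ceval th1 x (V x) * ceval (cnj_form th1) x (W x) + ceval th1 x (W x) * ceval (cnj_form th1) x (V x)
      + 1 / (3 * \<i>) * (ceval th3 x (V x) * (ceval Om2 x (W x) - ceval (cnj_form Om2) x (W x))
        + ceval th3 x (W x) * (ceval Om2 x (V x) - ceval (cnj_form Om2) x (V x))))"
proof -
  let ?D = "frechet_derivative q (at x)"
  let ?d = "\<lambda>k i. complex_of_real (?D (axis k 1) $ i)"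
  let ?G = "\<lambda>i j. complex_of_real (g (q x) $ i $ j)"
  obtain c :: real where c: "c > 0" "\<And>u v. complex_of_real (?D u \<bullet> (g (q x) *v ?D v)) = of_real c * fefferman_form th1 th3 Om2 x u v"
    using descends x by blast
  have B: "(\<Sum>i\<in>UNIV. \<Sum>j\<in>UNIV. ?d k i * ?d l j * ?G i j) = of_real c * fefferman_form th1 th3 Om2 x (axis k 1) (axis l 1)" for k l
    unfolding c(2)[symmetric] by (simp add: inner_vec_def matrix_vector_mult_def sum_distrib_left mult_ac)
  have two: "(\<Sum>k\<in>UNIV. \<Sum>l\<in>UNIV. V $ k * W $ l * (\<alpha> x [axis k 1] * \<beta> x [axis l 1])) = ceval \<alpha> x V * ceval \<beta> x W"
    "(\<Sum>k\<in>UNIV. \<Sum>l\<in>UNIV. V $ k * W $ l * (\<alpha> x [axis l 1] * \<beta> x [axis k 1])) = ceval \<alpha> x W * ceval \<beta> x V"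
    if "lin_form_at x \<alpha>" "lin_form_at x \<beta>" for \<alpha> \<beta> :: "(real^8) cform" and V W :: "complex^8"
  proof -
    have *: "(\<Sum>k\<in>UNIV. \<Sum>l\<in>UNIV. (V $ k * \<alpha> x [axis k 1]) * (W $ l * \<beta> x [axis l 1])) = ceval \<alpha> x V * ceval \<beta> x W"
      if "lin_form_at x \<alpha>" "lin_form_at x \<beta>" for \<alpha> \<beta> :: "(real^8) cform" and V W :: "complex^8"
      using that by (simp only: sum_product[symmetric] ceval_expand)
    show "(\<Sum>k\<in>UNIV. \<Sum>l\<in>UNIV. V $ k * W $ l * (\<alpha> x [axis k 1] * \<beta> x [axis l 1])) = ceval \<alpha> x V * ceval \<beta> x W"
      using *[OF that, of V W] by (simp add: mult_ac)
    show "(\<Sum>k\<in>UNIV. \<Sum>l\<in>UNIV. V $ k * W $ l * (\<alpha> x [axis l 1] * \<beta> x [axis k 1])) = ceval \<alpha> x W * ceval \<beta> x V"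
      using *[OF that(2,1), of V W] by (simp add: mult_ac)
  qed
  define \<kappa> :: complex where "\<kappa> = 1 / (3 * \<i>)"
  let ?o = "Om2 +\<^sub>f (-1) *\<^sub>f cnj_form Om2"
  have o: "lin_form_at x ?o" by (intro lin_form_at_intros lin[OF x])
  have F: "fefferman_form th1 th3 Om2 x u v = th1 x [u] * cnj_form th1 x [v] + th1 x [v] * cnj_form th1 x [u]
      + \<kappa> * (th3 x [u] * ?o x [v] + th3 x [v] * ?o x [u])" for u v
    by (simp add: fefferman_form_def sym_prod_def \<kappa>_def)
  show thesis
  proof (rule that[OF c(1)])
    fix V W :: "real^8 \<Rightarrow> complex^8"
    let ?v = "\<lambda>k l. V x $ k * W x $ l"
    let ?f = "\<lambda>i j k l. ?v k l * (?d k i * ?d l j * ?G i j)"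
    have "(\<Sum>i\<in>UNIV. \<Sum>j\<in>UNIV. vder V (Q i) x * vder W (Q j) x * ?G i j)
      = (\<Sum>i\<in>UNIV. \<Sum>j\<in>UNIV. \<Sum>k\<in>UNIV. \<Sum>l\<in>UNIV. ?f i j k l)"
      unfolding vder_Q[OF x] sum_product unfolding sum_distrib_right by (simp add: mult_ac)
    also have "\<dots> = (\<Sum>k\<in>UNIV. \<Sum>i\<in>UNIV. \<Sum>j\<in>UNIV. \<Sum>l\<in>UNIV. ?f i j k l)"
      by (rule sum_rotate)
    also have "\<dots> = (\<Sum>k\<in>UNIV. \<Sum>l\<in>UNIV. \<Sum>i\<in>UNIV. \<Sum>j\<in>UNIV. ?f i j k l)"
      by (intro sum.cong refl sum_rotate)
    also have "\<dots> = (\<Sum>k\<in>UNIV. \<Sum>l\<in>UNIV. ?v k l * (of_real c * fefferman_form th1 th3 Om2 x (axis k 1) (axis l 1)))"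
      by (simp only: B sum_distrib_left[symmetric])
    also have "\<dots> = of_real c * ((\<Sum>k\<in>UNIV. \<Sum>l\<in>UNIV. ?v k l * (th1 x [axis k 1] * cnj_form th1 x [axis l 1]))
        + (\<Sum>k\<in>UNIV. \<Sum>l\<in>UNIV. ?v k l * (th1 x [axis l 1] * cnj_form th1 x [axis k 1]))
        + \<kappa> * ((\<Sum>k\<in>UNIV. \<Sum>l\<in>UNIV. ?v k l * (th3 x [axis k 1] * ?o x [axis l 1]))
          + (\<Sum>k\<in>UNIV. \<Sum>l\<in>UNIV. ?v k l * (th3 x [axis l 1] * ?o x [axis k 1]))))"
      unfolding F by (simp add: sum_distrib_left sum.distrib distrib_left mult_ac)
    also have "\<dots> = of_real c * (ceval th1 x (V x) * ceval (cnj_form th1) x (W x) + ceval th1 x (W x) * ceval (cnj_form th1) x (V x)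
      + \<kappa> * (ceval th3 x (V x) * (ceval Om2 x (W x) - ceval (cnj_form Om2) x (W x))
        + ceval th3 x (W x) * (ceval Om2 x (V x) - ceval (cnj_form Om2) x (V x))))"
      by (simp only: two[OF lin(1)[OF x] lin(6)[OF x]] two[OF lin(2)[OF x] o] ceval_add ceval_scale) simp
    finally show "(\<Sum>i\<in>UNIV. \<Sum>j\<in>UNIV. vder V (Q i) x * vder W (Q j) x * ?G i j)
      = of_real c * (ceval th1 x (V x) * ceval (cnj_form th1) x (W x) + ceval th1 x (W x) * ceval (cnj_form th1) x (V x)
      + 1 / (3 * \<i>) * (ceval th3 x (V x) * (ceval Om2 x (W x) - ceval (cnj_form Om2) x (W x))
        + ceval th3 x (W x) * (ceval Om2 x (V x) - ceval (cnj_form Om2) x (V x))))"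
      unfolding \<kappa>_def .
  qed
qed

text \<open>The factor in \<open>descends\<close> is merely chosen at each point. Reading it off as
  the product of \<open>E 1\<close> and \<open>E 2\<close> makes its smoothness evident.\<close>

definition F :: "real^8 \<Rightarrow> complex" where
  "F x = (\<Sum>i\<in>UNIV. \<Sum>j\<in>UNIV. E 1 i x * E 2 j x * of_real (g (q x) $ i $ j))"

lemma ceval_X4:
  assumes "x \<in> P" "lin_form_at x \<omega>"
  shows "ceval \<omega> x (X 4 x) = 3 * \<i> / 2 * (ceval \<omega> x (Z 3 x) - ceval \<omega> x (Z 4 x))"
proof -
  have X4: "X 4 x $ j = 3 * \<i> / 2 * (Z 3 x $ j - Z 4 x $ j)" for j
    by (simp add: X_def algebra_simps)
  show ?thesis
    unfolding ceval_expand[OF assms(2)] X4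
    by (simp add: sum_distrib_left sum_subtractf[symmetric] algebra_simps)
qed

lemma metric_frame:
  assumes x: "x \<in> P"
  shows "F x \<noteq> 0" "(\<Sum>i\<in>UNIV. \<Sum>j\<in>UNIV. E a i x * E b j x * of_real (g (q x) $ i $ j)) = F x * eta a b"
proof -
  obtain c :: real where c: "c > 0" and *: "\<And>V W. (\<Sum>i\<in>UNIV. \<Sum>j\<in>UNIV. vder V (Q i) x * vder W (Q j) x * of_real (g (q x) $ i $ j))
    = of_real c * (ceval th1 x (V x) * ceval (cnj_form th1) x (W x) + ceval th1 x (W x) * ceval (cnj_form th1) x (V x)
      + 1 / (3 * \<i>) * (ceval th3 x (V x) * (ceval Om2 x (W x) - ceval (cnj_form Om2) x (W x))
        + ceval th3 x (W x) * (ceval Om2 x (V x) - ceval (cnj_form Om2) x (V x))))"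
    by (rule descends_complex[OF x]) blast
  have G: "\<forall>a b. (\<Sum>i\<in>UNIV. \<Sum>j\<in>UNIV. E a i x * E b j x * of_real (g (q x) $ i $ j)) = of_real c * eta a b"
    unfolding E_def * by (simp add: forall_4 ceval_X4[OF x] lin[OF x] X_simps(1-3) ceval_Z[OF x] eta_def)
  then have F: "F x = of_real c" by (simp add: F_def eta_def)
  with c show "F x \<noteq> 0" by simp
  show "(\<Sum>i\<in>UNIV. \<Sum>j\<in>UNIV. E a i x * E b j x * of_real (g (q x) $ i $ j)) = F x * eta a b"
    using G F by simp
qed

lemma smooth_metric_g: "smooth_metric M g"
proof
  show "open M" by (rule open_M)
  show "smooth_map_on M g" using lorentzian by (simp add: lorentzian_metric_def)
  fix y assume y: "y \<in> M"
  have t: "transpose (g y) = g y" using lorentzian y by (simp add: lorentzian_metric_def)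
  have "transpose (g y) $ j $ i = g y $ i $ j" for i j by (simp add: transpose_def)
  then show "g y $ i $ j = g y $ j $ i" for i j using t by metis
  obtain A :: "real^4^4" where A: "invertible A" "transpose A ** g y ** A = (\<chi> i j. if i = j then (if i = 1 then -1 else 1) else 0)"
    using lorentzian y unfolding lorentzian_metric_def by blast
  have "det ((\<chi> i j. if i = j then (if i = 1 then -1 else 1) else 0) :: real^4^4) = (\<Prod>i\<in>UNIV. if i = (1::4) then -1 else 1)"
    by (subst det_diagonal) auto
  then have "det (transpose A ** g y ** A) \<noteq> 0" unfolding A(2) by simp
  then show "invertible (g y)" by (simp add: det_mul invertible_det_nz)
qed

lemma smooth_g: "smooth_map_on P (\<lambda>x. complex_of_real (g (q x) $ i $ j))"
proof -
  interpret smooth_metric M g by (rule smooth_metric_g)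
  show ?thesis
    using smooth_compose[OF open_P _ smooth_q smooth_g] q_image by (intro smooth_of_real[OF open_P]) blast
qed

lemma smooth_F: "smooth_map_on P F"
  unfolding F_def[abs_def] by (intro smooth_sum[OF open_P] smooth_mult[OF open_P] smooth_E smooth_g)

text \<open>Vertical differentiation turns \<open>E 1\<close> and \<open>E 2\<close> into zero or
  \<open>E 4\<close>, and \<open>E 4\<close> is orthogonal to both. Along \<open>Y2 + Y2b\<close>
  the corresponding statement fails.\<close>

lemma vder_F_vertical:
  assumes x: "x \<in> P" and k: "k = 5 \<or> k = 6 \<or> k = 7"
  shows "vder (Z k) F x = 0"
proof -
  interpret smooth_metric M g by (rule smooth_metric_g)
  let ?G = "\<lambda>i j x. complex_of_real (g (q x) $ i $ j)"
  have G0: "vder (Z k) (?G i j) x = 0" for i j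
  proof -
    have "vder (Z k) (?G i j) x = (\<Sum>l\<in>UNIV. vder (Z k) (Q l) x * of_real (pd l (\<lambda>y. g y $ i $ j) (q x)))"
      unfolding Q_def[abs_def] by (rule vder_chain[OF smooth_q x smooth_g]) (use q_image x in blast)
    then show ?thesis using k vertical_kill[OF x] by auto
  qed
  have "vder (Z k) F x = (\<Sum>i\<in>UNIV. \<Sum>j\<in>UNIV. vder (Z k) (\<lambda>x. E 1 i x * E 2 j x * ?G i j x) x)"
    unfolding F_def[abs_def]
    by (simp add: vder_sum[OF open_P x] smooth_sum[OF open_P] smooth_mult[OF open_P] smooth_E fefferman_metric.smooth_g[OF fefferman_metric_axioms])
  also have "\<dots> = (\<Sum>i\<in>UNIV. \<Sum>j\<in>UNIV. vder (Z k) (E 1 i) x * E 2 j x * ?G i j x + E 1 i x * vder (Z k) (E 2 j) x * ?G i j x)"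
    by (simp only: vder_mult[OF x smooth_mult[OF open_P smooth_E smooth_E] fefferman_metric.smooth_g[OF fefferman_metric_axioms]]
        vder_mult[OF x smooth_E smooth_E] G0 distrib_right mult_zero_right add_0_right)
  also have "\<dots> = 0"
  proof -
    have m: "(\<Sum>i\<in>UNIV. \<Sum>j\<in>UNIV. E 4 i x * E 2 j x * ?G i j x) = 0" "(\<Sum>i\<in>UNIV. \<Sum>j\<in>UNIV. E 1 i x * E 4 j x * ?G i j x) = 0"
      by (simp_all add: metric_frame(2)[OF x] eta_def)
    show ?thesis
      using k m by (auto simp: vder_E_vertical[OF x] sum.distrib)
  qed
  finally show ?thesis .
qed

definition s :: "4 \<Rightarrow> real^8 \<Rightarrow> complex" where
  "s a x = vder (X a) F x / (2 * F x)"

lemma smooth_s: "smooth_map_on P (s a)"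
proof -
  have "smooth_map_on P (\<lambda>x. vder (X a) F x / (2 * F x))"
    by (intro smooth_divide[OF open_P] smooth_mult[OF open_P] smooth_const smooth_F smooth_vder[OF open_P smooth_X smooth_F])
      (simp add: metric_frame(1))
  then show ?thesis by (simp add: s_def[abs_def])
qed

lemma vder_F: "x \<in> P \<Longrightarrow> vder (X a) F x = 2 * F x * s a x"
  by (simp add: s_def metric_frame(1))

text \<open>The bracket is applied to \<open>F\<close>: its vertical part vanishes by
  \<open>vder_F_vertical\<close>, and the terms quadratic in \<open>s\<close> are symmetric.\<close>

lemma vder_s_commutator:
  assumes x: "x \<in> P"
  shows "vder (X a) (s b) x - vder (X b) (s a) x = (\<Sum>c\<in>UNIV. C_fef a b c * s c x)"
proof -
  have 1: "vder (X a) (vder (X b) F) x = 4 * F x * s a x * s b x + 2 * F x * vder (X a) (s b) x" for a b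
  proof -
    have "vder (X a) (vder (X b) F) x = vder (X a) (\<lambda>x. 2 * (F x * s b x)) x"
      by (rule vder_cong[OF open_P x]) (simp add: vder_F)
    also have "\<dots> = 2 * (vder (X a) F x * s b x + F x * vder (X a) (s b) x)"
      by (simp only: vder_cmult[OF x smooth_mult[OF open_P smooth_F smooth_s]] vder_mult[OF x smooth_F smooth_s])
    finally show ?thesis by (simp add: vder_F[OF x] algebra_simps)
  qed
  have "2 * F x * (vder (X a) (s b) x - vder (X b) (s a) x) = (\<Sum>c\<in>UNIV. C_fef a b c * vder (X c) F x)"
    using X_commutator[OF x smooth_F, of a b] by (simp add: 1 vder_F_vertical[OF x] algebra_simps)
  also have "\<dots> = 2 * F x * (\<Sum>c\<in>UNIV. C_fef a b c * s c x)"
    by (simp add: vder_F[OF x] sum_distrib_left mult_ac)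
  finally show ?thesis using metric_frame(1)[OF x] by simp
qed

lemma vder_RS:
  assumes x: "x \<in> P"
  shows "vder V R x = - R x * (ceval Om2 x (V x) + 3 * ceval (cnj_form Om2) x (V x)) - S x * ceval th1 x (V x)
      + R2 x * ceval (cnj_form th1) x (V x) + R3 x * ceval th3 x (V x)"
    "vder V S x = - S x * (2 * ceval Om2 x (V x) + 3 * ceval (cnj_form Om2) x (V x)) - \<i> * R x * ceval (cnj_form Om3) x (V x)
      + S1 x * ceval th1 x (V x) + S2 x * ceval (cnj_form th1) x (V x) + S3 x * ceval th3 x (V x)"
proof -
  have "vder V R x = ceval ((- R x) *\<^sub>f (Om2 +\<^sub>f 3 *\<^sub>f cnj_form Om2) +\<^sub>f (- S x) *\<^sub>f th1
        +\<^sub>f R2 x *\<^sub>f cnj_form th1 +\<^sub>f R3 x *\<^sub>f th3) x (V x)"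
    by (rule one_form_vder) (use d_R x in blast, intro lin_form_at_intros lin[OF x])
  then show "vder V R x = - R x * (ceval Om2 x (V x) + 3 * ceval (cnj_form Om2) x (V x)) - S x * ceval th1 x (V x)
      + R2 x * ceval (cnj_form th1) x (V x) + R3 x * ceval th3 x (V x)"
    by (simp add: ceval_add ceval_scale)
  have "vder V S x = ceval ((- S x) *\<^sub>f (2 *\<^sub>f Om2 +\<^sub>f 3 *\<^sub>f cnj_form Om2) +\<^sub>f (- \<i> * R x) *\<^sub>f cnj_form Om3
        +\<^sub>f S1 x *\<^sub>f th1 +\<^sub>f S2 x *\<^sub>f cnj_form th1 +\<^sub>f S3 x *\<^sub>f th3) x (V x)"
    by (rule one_form_vder) (use d_S x in blast, intro lin_form_at_intros lin[OF x])
  then show "vder V S x = - S x * (2 * ceval Om2 x (V x) + 3 * ceval (cnj_form Om2) x (V x)) - \<i> * R x * ceval (cnj_form Om3) x (V x)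
      + S1 x * ceval th1 x (V x) + S2 x * ceval (cnj_form th1) x (V x) + S3 x * ceval th3 x (V x)"
    by (simp add: ceval_add ceval_scale)
qed

text \<open>\<open>X 1\<close> and \<open>X 2\<close> are conjugate. \<open>X 4\<close> is real,
  since conjugation exchanges \<open>Z 3\<close> and \<open>Z 4\<close> and also changes the sign of
  the imaginary coefficient.\<close>

lemma vder_cnj_X:
  assumes x: "x \<in> P" and f: "smooth_map_on P f"
  shows "vder (X 2) (\<lambda>x. cnj (f x)) x = cnj (vder (X 1) f x)" "vder (X 4) (\<lambda>x. cnj (f x)) x = cnj (vder (X 4) f x)"
proof -
  have *: "vder V (\<lambda>x. cnj (f x)) x = cnj (vder W f x)" if "cnjv (V x) = W x" for V W
    unfolding vder_cnj[OF x f] unfolding vder_def that[unfolded cnjv_def] ..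
  show "vder (X 2) (\<lambda>x. cnj (f x)) x = cnj (vder (X 1) f x)"
    by (rule *) (simp only: X_simps Z_cnj[OF x])
  have "vder (Z 3) (\<lambda>x. cnj (f x)) x = cnj (vder (Z 4) f x)"
    "vder (Z 4) (\<lambda>x. cnj (f x)) x = cnj (vder (Z 3) f x)"
    by (rule *, rule Z_cnj[OF x])+
  then show "vder (X 4) (\<lambda>x. cnj (f x)) x = cnj (vder (X 4) f x)"
    by (simp add: X_simps(4) algebra_simps)
qed

lemma fefferman_frame: "fefferman_frame M g P q X E F s R (\<lambda>x. cnj (R x)) S (\<lambda>x. cnj (S x)) S1"
proof -
  interpret smooth_metric M g by (rule smooth_metric_g)
  show ?thesis
  proof unfold_locales
    show "E a i = vder (X a) (\<lambda>x. of_real (q x $ i))" for a i by (simp add: E_def Q_def[abs_def])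
    show "q ` P \<subseteq> M" using q_image by simp
    show "smooth_map_on P (w_fef s a b c)" for a b c
      unfolding w_fef_def[abs_def]
      by (intro smooth_diff[OF open_P] smooth_add[OF open_P] smooth_mult[OF open_P] smooth_const smooth_s)
    show "smooth_map_on P R" "smooth_map_on P (\<lambda>x. cnj (R x))" "smooth_map_on P S" "smooth_map_on P (\<lambda>x. cnj (S x))"
      using smooth_functions by (auto intro: smooth_cnj[OF open_P])
    fix x assume x: "x \<in> P"
    show "vder (X a) (E b i) x - vder (X b) (E a i) x = (\<Sum>c\<in>UNIV. C_fef a b c * E c i x)" for a b i
      using X_commutator[OF x smooth_Q, of a b i] by (simp add: E_def vertical_kill[OF x])
    show "w_fef s a b c x - w_fef s b a c x = C_fef a b c" for a b c by (rule w_fef_torsion)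
    show "F x * (w_fef s a b (st c) x + w_fef s a c (st b) x) = vder (X a) F x * eta b c" for a b c
      by (simp add: w_fef_metric vder_F[OF x])
    show "vder (X a) (vder (X b) (E c i)) x - vder (X b) (vder (X a) (E c i)) x
        = (\<Sum>d\<in>UNIV. C_fef a b d * vder (X d) (E c i) x) + (\<Sum>d\<in>UNIV. v_fef R (\<lambda>x. cnj (R x)) a b c d x * E d i x)" for a b c i
    proof -
      \<comment> \<open>The vertical parts of \<open>X_commutator\<close> applied to
        \<open>E c i\<close>; the parts along \<open>Z 7\<close> vanish on it, which is why
        \<open>S\<close> is absent from \<open>v_fef\<close>.\<close>
      have "(\<Sum>d\<in>UNIV. v_fef R (\<lambda>x. cnj (R x)) a b c d x * E d i x)
        = - (kron a 2 * kron b 3 - kron a 3 * kron b 2) * (R x * (kron c 2 * E 4 i x - kron c 3 * E 1 i x))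
          - (kron a 1 * kron b 3 - kron a 3 * kron b 1) * (cnj (R x) * (kron c 1 * E 4 i x - kron c 3 * E 2 i x))"
        by (simp add: v_fef_def sum_4 algebra_simps)
      then show ?thesis
        using X_commutator[OF x smooth_E, of a b c i] by (simp only:) (simp add: vder_E_vertical[OF x] algebra_simps)
    qed
    show dX: "vder (X 1) R x = - S x" "vder (X 4) R x = 3 * \<i> * R x" "vder (X 1) S x = S1 x" "vder (X 4) S x = 3 * \<i> / 2 * S x"
      by (simp_all add: X_simps(1-3) vder_RS[OF x] ceval_X4[OF x] lin[OF x] ceval_Z[OF x] algebra_simps)
    \<comment> \<open>Reality of \<open>S1\<close> lets one function serve for \<open>S\<close>
      along \<open>X 1\<close> and for its conjugate along \<open>X 2\<close>.\<close>
    have "cnj (S1 x) = S1 x" using real_S1 x by (simp add: Reals_cnj_iff)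
    then show "vder (X 2) (\<lambda>x. cnj (R x)) x = - cnj (S x)" "vder (X 4) (\<lambda>x. cnj (R x)) x = - 3 * \<i> * cnj (R x)"
      "vder (X 2) (\<lambda>x. cnj (S x)) x = S1 x" "vder (X 4) (\<lambda>x. cnj (S x)) x = - 3 * \<i> / 2 * cnj (S x)"
      unfolding vder_cnj_X[OF x smooth_functions(1)] vder_cnj_X[OF x smooth_functions(2)] dX by simp_all
  qed (use open_P smooth_q smooth_X smooth_F smooth_s metric_frame vder_F vder_s_commutator in auto)
qed

theorem bach_iff: "satisfies_bach_equations M g \<longleftrightarrow> (\<forall>x\<in>P. S1 x = 0)"
proof -
  interpret fefferman_frame M g P q X E F s R "\<lambda>x. cnj (R x)" S "\<lambda>x. cnj (S x)" S1
    by (rule fefferman_frame)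
  have "satisfies_bach_equations M g \<longleftrightarrow> (\<forall>x\<in>P. \<forall>i j. bach g (q x) i j = 0)"
    unfolding satisfies_bach_equations_def q_image[symmetric] by blast
  then show ?thesis using bach_eq_0_iff by blast
qed

section \<open>The condition as a vanishing exterior product\<close>

text \<open>The other four factors absorb every term of \<open>d S\<close> except \<open>S1\<close>
  times \<open>th1\<close>, and together with \<open>th1\<close> they are independent, so their
  product with it is nonzero.\<close>

lemma wedge_iff:
  "(\<forall>x\<in>P. S1 x = 0) \<longleftrightarrow> (\<forall>x\<in>P. \<forall>v1 v2 v3 v4 v5.
     (ext_d (fun_form S) \<and>\<^sub>f cnj_form th1 \<and>\<^sub>f th3 \<and>\<^sub>f (2 *\<^sub>f Om2 +\<^sub>f 3 *\<^sub>f cnj_form Om2)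
          \<and>\<^sub>f cnj_form Om3) x [v1, v2, v3, v4, v5] = 0)"
proof -
  let ?o = "2 *\<^sub>f Om2 +\<^sub>f 3 *\<^sub>f cnj_form Om2"
  have "S1 x = 0 \<longleftrightarrow> (\<forall>v1 v2 v3 v4 v5.
     (ext_d (fun_form S) \<and>\<^sub>f cnj_form th1 \<and>\<^sub>f th3 \<and>\<^sub>f ?o \<and>\<^sub>f cnj_form Om3) x [v1, v2, v3, v4, v5] = 0)" if x: "x \<in> P" for x
  proof -
    have dS: "ext_d (fun_form S) x [v] = S1 x * th1 x [v] + S2 x * cnj_form th1 x [v] + S3 x * th3 x [v] + (- S x) * ?o x [v]
        + (- \<i> * R x) * cnj_form Om3 x [v]" for v
      using d_S x by (simp add: form_add_def form_scale_def algebra_simps)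
    have alt: "(ext_d (fun_form S) \<and>\<^sub>f cnj_form th1 \<and>\<^sub>f th3 \<and>\<^sub>f ?o \<and>\<^sub>f cnj_form Om3) x [v1, v2, v3, v4, v5]
      = S1 x * (th1 \<and>\<^sub>f cnj_form th1 \<and>\<^sub>f th3 \<and>\<^sub>f ?o \<and>\<^sub>f cnj_form Om3) x [v1, v2, v3, v4, v5]" for v1 v2 v3 v4 v5
      by (rule wedge5_alternating) (rule dS)
    have "lin_indep_at x [th1, cnj_form th1, th3, ?o, cnj_form Om3]"
      unfolding lin_indep_at_def
    proof (intro allI impI)
      fix c :: "nat \<Rightarrow> complex" and i
      assume z: "\<forall>v. (\<Sum>i<length [th1, cnj_form th1, th3, ?o, cnj_form Om3]. c i * ([th1, cnj_form th1, th3, ?o, cnj_form Om3] ! i) x [v]) = 0"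
        and i: "i < length [th1, cnj_form th1, th3, ?o, cnj_form Om3]"
      \<comment> \<open>The relation rewritten in the full coframe: the combined form spreads
        \<open>c 3\<close> over \<open>Om2\<close> and its conjugate with weights 2 and 3, and
        \<open>Om3\<close>, \<open>Om4\<close> receive 0.\<close>
      let ?c = "\<lambda>i. [c 0, c 1, c 2, 2 * c 3, 3 * c 3, 0, c 4, 0] ! i"
      have "\<forall>v. (\<Sum>i<length coframe8. ?c i * (coframe8 ! i) x [v]) = 0"
        using z by (simp add: eval_nat_numeral form_add_def form_scale_def algebra_simps)
      then have c: "\<forall>i<length coframe8. ?c i = 0"
        using coframe x unfolding lin_indep_at_def by (elim ballE[of _ _ x] allE[of _ ?c]) blast+
      have "c 0 = 0" "c 1 = 0" "c 2 = 0" "c 3 = 0" "c 4 = 0"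
        using c[rule_format, of 0] c[rule_format, of 1] c[rule_format, of 2] c[rule_format, of 3] c[rule_format, of 6]
        by simp_all
      then show "c i = 0" using i by (auto simp: eval_nat_numeral less_Suc_eq)
    qed
    from wedge5_nonzero[OF this] show ?thesis unfolding alt by auto
  qed
  then show ?thesis by blast
qed

end

theorem mainTheorem6:
  fixes N :: "(real^3) set" and lam mu :: "(real^3) cform"
    and P :: "(real^8) set" and pr :: "real^8 \<Rightarrow> real^3"
    and th1 th3 Om2 Om3 Om4 :: "(real^8) cform"
    and R S R2 R3 S1 S2 S3 :: "real^8 \<Rightarrow> complex"
    and M :: "(real^4) set" and q :: "real^8 \<Rightarrow> real^4" and g :: "real^4 \<Rightarrow> real^4^4"
  assumes "fefferman_metric N lam mu P pr th1 th3 Om2 Om3 Om4 R S R2 R3 S1 S2 S3 M q g"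
  shows "(satisfies_bach_equations M g \<longleftrightarrow> (\<forall>x\<in>P. S1 x = 0)) \<and>
    ((\<forall>x\<in>P. S1 x = 0) \<longleftrightarrow>
      (\<forall>x\<in>P. \<forall>v1 v2 v3 v4 v5.
        (ext_d (fun_form S) \<and>\<^sub>f cnj_form th1 \<and>\<^sub>f th3 \<and>\<^sub>f (2 *\<^sub>f Om2 +\<^sub>f 3 *\<^sub>f cnj_form Om2)
          \<and>\<^sub>f cnj_form Om3) x [v1, v2, v3, v4, v5] = 0))"
  using fefferman_metric.bach_iff[OF assms] fefferman_metric.wedge_iff[OF assms] by (rule conjI)

end
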